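(* There is an algorithm which, given two NFAs $\mathcal{A}_1,\mathcal{A}_2$ over a finite alphabet $A$, decides whether $L(\mathcal{A}_1)$ and $L(\mathcal{A}_2)$ are PT-separable, in time polynomial in both the number of states of the automata and the size $|A|$ of the alphabet.
   Context: For $u,v\in A^*$, write $u\lhd v$ ($u$ is a scattered subword of $v$) if $u=a_1\cdots a_n$ with $a_i\in A$ and $v=v_0a_1v_1\cdots v_{n-1}a_nv_n$ with $v_i\in A^*$. A regular language over $A$ is piecewise testable (PT) if it is a finite Boolean combination of languages of the form $A^*a_1A^*a_2\cdots A^*a_nA^*$ with $a_i\in A$; equivalently, there is $n$ such that $L$ is a union of classes of the equivalence $u\sim_n v \iff \mathrm{Sub}_n(u)=\mathrm{Sub}_n(v)$, where $\mathrm{Sub}_n(u)=\{w\in A^*: |w|\le n,\ w\lhd u\}$. Two languages $L_1,L_2$ are PT-separable if there exists a piecewise testable language $L$ with $L_1\subseteq L$ and $L\cap L_2=\varnothing$. *)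

theory Defs
  imports Main "HOL-Library.Sublist"
begin

text \<open>Finite Boolean combinations (relative to the universe lists A) of the languages
  A*a1A*a2...A*anA* = the words over A having a1...an as a scattered subword.\<close>
inductive_set pt_langs :: "'a set \<Rightarrow> 'a list set set" for A :: "'a set" where
  atom: "u \<in> lists A \<Longrightarrow> {v \<in> lists A. subseq u v} \<in> pt_langs A"
| compl: "L \<in> pt_langs A \<Longrightarrow> lists A - L \<in> pt_langs A"
| union: "L1 \<in> pt_langs A \<Longrightarrow> L2 \<in> pt_langs A \<Longrightarrow> L1 \<union> L2 \<in> pt_langs A"
| inter: "L1 \<in> pt_langs A \<Longrightarrow> L2 \<in> pt_langs A \<Longrightarrow> L1 \<inter> L2 \<in> pt_langs A"

definition piecewise_testable :: "'a set \<Rightarrow> 'a list set \<Rightarrow> bool" where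
  "piecewise_testable A L \<longleftrightarrow> L \<in> pt_langs A"

definition PT_separable :: "'a set \<Rightarrow> 'a list set \<Rightarrow> 'a list set \<Rightarrow> bool" where
  "PT_separable A L1 L2 \<longleftrightarrow>
     (\<exists>L. piecewise_testable A L \<and> L1 \<subseteq> L \<and> L \<inter> L2 = {})"

text \<open>An NFA over the alphabet {0..<k}: states {0..<n}, lists of initial states, final
  states and transitions (p, a, p').\<close>
datatype nfa = NFA (nstates: nat) (initial: "nat list") (final: "nat list")
                   (trans: "(nat \<times> nat \<times> nat) list")

fun path :: "(nat \<times> nat \<times> nat) list \<Rightarrow> nat \<Rightarrow> nat list \<Rightarrow> nat \<Rightarrow> bool" where
  "path T p [] q \<longleftrightarrow> p = q"
| "path T p (a # w) q \<longleftrightarrow> (\<exists>r. (p, a, r) \<in> set T \<and> path T r w q)"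

definition nfa_lang :: "nat \<Rightarrow> nfa \<Rightarrow> nat list set" where
  "nfa_lang k M = {w \<in> lists {..<k}.
      \<exists>p \<in> set (initial M). \<exists>q \<in> set (final M). path (trans M) p w q}"

definition wf_nfa :: "nat \<Rightarrow> nfa \<Rightarrow> bool" where
  "wf_nfa k M \<longleftrightarrow>
     distinct (initial M) \<and> distinct (final M) \<and> distinct (trans M) \<and>
     set (initial M) \<subseteq> {..<nstates M} \<and> set (final M) \<subseteq> {..<nstates M} \<and>
     (\<forall>(p, a, q) \<in> set (trans M). p < nstates M \<and> a < k \<and> q < nstates M)"

definition enc_nfa :: "nfa \<Rightarrow> nat list" where
  "enc_nfa M = [nstates M, length (initial M)] @ initial M @ [length (final M)] @ final M
     @ [length (trans M)] @ concat (map (\<lambda>(p, a, q). [p, a, q]) (trans M))"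

definition enc_input :: "nat \<Rightarrow> nfa \<Rightarrow> nfa \<Rightarrow> nat list" where
  "enc_input k M1 M2 = k # enc_nfa M1 @ enc_nfa M2"

datatype instr =
    LoadC nat nat
  | Add nat nat nat
  | Sub nat nat nat      \<comment> \<open>mem[r] := mem[s] - mem[t] (truncated)\<close>
  | LoadI nat nat
  | StoreI nat nat
  | Jz nat nat
  | Halt

type_synonym config = "nat \<times> (nat \<Rightarrow> nat)"

definition halted :: "instr list \<Rightarrow> config \<Rightarrow> bool" where
  "halted P c \<longleftrightarrow> fst c \<ge> length P \<or> P ! fst c = Halt"

fun exec :: "instr \<Rightarrow> config \<Rightarrow> config" where
  "exec (LoadC r v) (pc, m) = (Suc pc, m(r := v))"
| "exec (Add r s t) (pc, m) = (Suc pc, m(r := m s + m t))"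
| "exec (Sub r s t) (pc, m) = (Suc pc, m(r := m s - m t))"
| "exec (LoadI r s) (pc, m) = (Suc pc, m(r := m (m s)))"
| "exec (StoreI r s) (pc, m) = (Suc pc, m(m r := m s))"
| "exec (Jz r l) (pc, m) = (if m r = 0 then l else Suc pc, m)"
| "exec Halt (pc, m) = (pc, m)"

definition step :: "instr list \<Rightarrow> config \<Rightarrow> config" where
  "step P c = (if halted P c then c else exec (P ! fst c) c)"

definition run :: "instr list \<Rightarrow> nat \<Rightarrow> config \<Rightarrow> config" where
  "run P t c = (step P ^^ t) c"

definition init_config :: "nat list \<Rightarrow> config" where
  "init_config xs = (0, \<lambda>i. if i = 0 then length xs
                            else if i \<le> length xs then xs ! (i - 1) else 0)"

definition halts_with :: "instr list \<Rightarrow> nat list \<Rightarrow> nat \<Rightarrow> nat \<Rightarrow> bool" where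
  "halts_with P xs t b \<longleftrightarrow>
     (\<exists>t' \<le> t. halted P (run P t' (init_config xs)) \<and> snd (run P t' (init_config xs)) 0 = b)"

end

theory Submission
  imports Defs
begin

text \<open>The languages fail to be separable iff, for every n, they contain words u and v with the same
  subwords of length at most n. If they do, the words u of a suitable infinite set of such pairs
  converge to a reduced word ideal, a product of atoms a? and B*: all of them lie in the ideal, and
  each element of the ideal is a subword of almost all of them. Membership in an ideal depends on
  short subwords only, so the words v converge to the same ideal. Both words factor along the atoms,
  with factors at the stars B* that contain an arbitrarily high power of a word over all of B;
  hence both automata loop there, with exactly the letters of B. So the pair of runs is a path in the
  graph on pairs of states whose edges read a common letter, or pass in both automata through a loop
  with the same set of letters.

  Reachability in this graph is decided by saturation: for a pair of loop states, the greatest common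
  set of loop letters is found by repeatedly removing the letters that lie on no loop within the
  current set. All loops of the program run up to one bound that is polynomial in the size of the
  automata, so polynomial running time is a closure property of the program constructs.\<close>

section \<open>Subword profiles\<close>

text \<open>Why the ideal must be reduced: in an arbitrary product, letters demanded by one atom may
  be read inside the factor of a neighbour, so a long test word says nothing about the single
  factors. If no atom absorbs a neighbour, a test word can slip across a border only by less than a
  full copy of an atom's alphabet. One spare copy on each side, hence the exponent
  \<open>Suc (Suc N)\<close>, protects the N copies between them; N is chosen at least the number of
  states, so that a state must recur. The set B in \<open>pair_step\<close> is existential, with
  exponentially many candidates. For fixed loop states the suitable sets are closed under union,
  since loops can be concatenated while the paths into and out of the loop may use any part of B. So
  one greatest set per pair of states replaces the search. Registers, input and tables share one
  memory, and the only arithmetic is addition and truncated subtraction. This forces the relocation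
  of the low input cells, table addresses built by multiplying with the loop bound only, and a bound
  that is a plain sum of fields of the input.\<close>

definition simn :: "nat \<Rightarrow> 'a list \<Rightarrow> 'a list \<Rightarrow> bool" where
  "simn n u v \<longleftrightarrow> (\<forall>w. length w \<le> n \<longrightarrow> subseq w u = subseq w v)"

lemma simn_refl [simp]: "simn n u u"
  by (simp add: simn_def)

lemma simn_mono: "simn n u v \<Longrightarrow> m \<le> n \<Longrightarrow> simn m u v"
  by (auto simp: simn_def)

lemma subseq_set: "subseq x y \<Longrightarrow> set x \<subseteq> set y"
  by (induction rule: list_emb.induct) auto

lemma subseq_lists: "subseq x y \<Longrightarrow> y \<in> lists A \<Longrightarrow> x \<in> lists A"
  using subseq_set by (metis in_listsD in_listsI subsetD)

text \<open>A subword of a concatenation splits into two subwords, and both parts are again of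
  length at most n.\<close>

lemma simn_append:
  assumes "simn n u u'" "simn n v v'"
  shows "simn n (u @ v) (u' @ v')"
  unfolding simn_def
proof (intro allI impI)
  fix w :: "'a list" assume w: "length w \<le> n"
  have "subseq s u = subseq s u' \<and> subseq t v = subseq t v'" if "w = s @ t" for s t
    using w that assms unfolding simn_def by simp
  then show "subseq w (u @ v) = subseq w (u' @ v')"
    unfolding subseq_append_iff by blast
qed

text \<open>An atom is decided by subwords up to its own length; a union or intersection takes the
  larger of the two levels.\<close>

lemma pt_langs_simn:
  assumes "L \<in> pt_langs A"
  shows "\<exists>n. \<forall>u \<in> lists A. \<forall>v \<in> lists A. simn n u v \<longrightarrow> (u \<in> L \<longleftrightarrow> v \<in> L)"
  using assms
proof induction
  case (atom u)
  then show ?case by (intro exI[of _ "length u"]) (auto simp: simn_def)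
next
  case (compl L)
  then show ?case by blast
next
  case (union L1 L2)
  then obtain n1 n2 where "\<forall>u \<in> lists A. \<forall>v \<in> lists A. simn n1 u v \<longrightarrow> (u \<in> L1 \<longleftrightarrow> v \<in> L1)"
    "\<forall>u \<in> lists A. \<forall>v \<in> lists A. simn n2 u v \<longrightarrow> (u \<in> L2 \<longleftrightarrow> v \<in> L2)" by blast
  then show ?case
    by (intro exI[of _ "max n1 n2"]) (metis Un_iff simn_mono max.cobounded1 max.cobounded2)
next
  case (inter L1 L2)
  then obtain n1 n2 where "\<forall>u \<in> lists A. \<forall>v \<in> lists A. simn n1 u v \<longrightarrow> (u \<in> L1 \<longleftrightarrow> v \<in> L1)"
    "\<forall>u \<in> lists A. \<forall>v \<in> lists A. simn n2 u v \<longrightarrow> (u \<in> L2 \<longleftrightarrow> v \<in> L2)" by blast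
  then show ?case
    by (intro exI[of _ "max n1 n2"]) (metis Int_iff simn_mono max.cobounded1 max.cobounded2)
qed

lemma pt_langs_UNIV: "lists A \<in> pt_langs A"
  using pt_langs.atom[of "[]" A] by (simp add: Collect_mem_eq)

lemma pt_langs_empty: "{} \<in> pt_langs A"
  using pt_langs.compl[OF pt_langs_UNIV[of A]] by simp

lemma pt_langs_Union:
  assumes "finite F" "F \<subseteq> pt_langs A"
  shows "\<Union>F \<in> pt_langs A"
  using assms by (induction F) (auto intro: pt_langs_empty pt_langs.union)

text \<open>With W the words of length at most n, these sets are the classes of
  \<open>simn n\<close>. Each word of W contributes its atom or the complement to a finite
  intersection.\<close>

lemma pt_langs_profile:
  assumes "finite W" "W \<subseteq> lists A"
  shows "{v \<in> lists A. \<forall>w \<in> W. subseq w v \<longleftrightarrow> w \<in> S} \<in> pt_langs A"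
  using assms
proof (induction W)
  case empty
  then show ?case by (simp add: Collect_mem_eq pt_langs_UNIV)
next
  case (insert w W)
  let ?X = "{v \<in> lists A. subseq w v}"
  have X: "?X \<in> pt_langs A" using insert.prems by (auto intro: pt_langs.atom)
  have "{v \<in> lists A. \<forall>x \<in> insert w W. subseq x v \<longleftrightarrow> x \<in> S} =
    (if w \<in> S then ?X else lists A - ?X) \<inter> {v \<in> lists A. \<forall>x \<in> W. subseq x v \<longleftrightarrow> x \<in> S}"
    by auto
  also have "\<dots> \<in> pt_langs A"
    using insert.IH insert.prems X by (auto intro!: pt_langs.inter pt_langs.compl)
  finally show ?case .
qed

text \<open>If no class of \<open>simn n\<close> meets both languages, the union of the classes that
  meet L1 is a separator. It is a finite union, because over a finite alphabet there are finitely
  many profiles of level n.\<close>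

lemma PT_separable_iff_simn:
  assumes "finite A" "L1 \<subseteq> lists A" "L2 \<subseteq> lists A"
  shows "PT_separable A L1 L2 \<longleftrightarrow> (\<exists>n. \<forall>u \<in> L1. \<forall>v \<in> L2. \<not> simn n u v)"
proof
  assume "PT_separable A L1 L2"
  then obtain L where L: "L \<in> pt_langs A" "L1 \<subseteq> L" "L \<inter> L2 = {}"
    unfolding PT_separable_def piecewise_testable_def by blast
  obtain n where "\<forall>u \<in> lists A. \<forall>v \<in> lists A. simn n u v \<longrightarrow> (u \<in> L \<longleftrightarrow> v \<in> L)"
    using pt_langs_simn[OF L(1)] by blast
  then show "\<exists>n. \<forall>u \<in> L1. \<forall>v \<in> L2. \<not> simn n u v" using L assms by blast
next
  assume "\<exists>n. \<forall>u \<in> L1. \<forall>v \<in> L2. \<not> simn n u v"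
  then obtain n where n: "\<forall>u \<in> L1. \<forall>v \<in> L2. \<not> simn n u v" by blast
  define W where "W = {w \<in> lists A. length w \<le> n}"
  have W: "finite W" unfolding W_def
    using finite_lists_length_le[OF assms(1), of n] by (simp add: lists_eq_set conj_commute)
  define sub where "sub u = {w \<in> W. subseq w u}" for u :: "'a list"
  have sub_simn: "sub u = sub v \<longleftrightarrow> simn n u v" if "u \<in> lists A" "v \<in> lists A" for u v
  proof -
    have "w \<in> lists A" if "subseq w u \<or> subseq w v" for w
      using that \<open>u \<in> lists A\<close> \<open>v \<in> lists A\<close> subseq_lists by blast
    then have "w \<in> W \<longleftrightarrow> length w \<le> n" if "subseq w u \<or> subseq w v" for w
      using that by (auto simp: W_def)
    then show ?thesis unfolding sub_def simn_def by blast
  qed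
  define cls where "cls S = {v \<in> lists A. \<forall>w \<in> W. subseq w v \<longleftrightarrow> w \<in> S}" for S
  have "finite (cls ` sub ` L1)"
    using W by (intro finite_imageI finite_subset[of "sub ` L1" "Pow W"]) (auto simp: sub_def)
  then have PT: "\<Union>(cls ` sub ` L1) \<in> pt_langs A"
    using pt_langs_profile[OF W] by (intro pt_langs_Union) (auto simp: cls_def W_def)
  have cls: "v \<in> cls (sub u) \<longleftrightarrow> v \<in> lists A \<and> sub u = sub v" for u v
    by (auto simp: cls_def sub_def)
  have "L1 \<subseteq> \<Union>(cls ` sub ` L1)"
  proof
    fix u assume "u \<in> L1"
    then have "u \<in> cls (sub u)" using assms(2) cls by blast
    then show "u \<in> \<Union>(cls ` sub ` L1)" using \<open>u \<in> L1\<close> by blast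
  qed
  moreover have "v \<notin> cls (sub u)" if "u \<in> L1" "v \<in> L2" for u v
    using that assms(2,3) n sub_simn[of u v] by (auto simp: cls)
  then have "\<Union>(cls ` sub ` L1) \<inter> L2 = {}" by auto
  ultimately show "PT_separable A L1 L2"
    using PT unfolding PT_separable_def piecewise_testable_def by blast
qed

section \<open>Ideals of words\<close>

datatype 'a atom = Letter 'a | Star "'a set"

fun letters :: "'a atom \<Rightarrow> 'a set" where
  "letters (Letter a) = {a}"
| "letters (Star B) = B"

fun lang :: "'a atom \<Rightarrow> 'a list set" where
  "lang (Letter a) = {[], [a]}"
| "lang (Star B) = lists B"

fun ideal :: "'a atom list \<Rightarrow> 'a list set" where
  "ideal [] = {[]}"
| "ideal (\<alpha> # p) = {x @ y | x y. x \<in> lang \<alpha> \<and> y \<in> ideal p}"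

text \<open>Only the set of letters of this word matters, so order and repetitions are left
  open.\<close>

definition enum :: "'a set \<Rightarrow> 'a list" where
  "enum B = (SOME xs. set xs = B)"

lemma set_enum: "finite B \<Longrightarrow> set (enum B) = B"
  unfolding enum_def by (rule someI_ex) (rule finite_list)

text \<open>For finite alphabets the products \<open>wits N p\<close> are cofinal in
  \<open>ideal p\<close>: every element of length at most N is a subword of
  \<open>wits N p\<close>.\<close>

fun wit :: "nat \<Rightarrow> 'a atom \<Rightarrow> 'a list" where
  "wit N (Letter a) = [a]"
| "wit N (Star B) = concat (replicate N (enum B))"

definition wits :: "nat \<Rightarrow> 'a atom list \<Rightarrow> 'a list" where
  "wits N p = concat (map (wit N) p)"

lemma wits_simps [simp]:
  "wits N [] = []" "wits N (\<alpha> # p) = wit N \<alpha> @ wits N p" "wits N (p @ q) = wits N p @ wits N q"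
  by (simp_all add: wits_def)

lemma lang_subseq: "x \<in> lang \<alpha> \<Longrightarrow> subseq y x \<Longrightarrow> y \<in> lang \<alpha>"
proof (cases \<alpha>)
  case (Letter a)
  assume "x \<in> lang \<alpha>" "subseq y x"
  then show ?thesis using Letter by (cases y) (auto simp: Cons_in_lists_iff split: if_splits)
next
  case (Star B)
  assume "x \<in> lang \<alpha>" "subseq y x"
  then show ?thesis using Star subseq_lists by auto
qed

lemma ideal_subseq: "x \<in> ideal p \<Longrightarrow> subseq y x \<Longrightarrow> y \<in> ideal p"
proof (induction p arbitrary: x y)
  case Nil
  then show ?case by simp
next
  case (Cons \<alpha> p)
  then obtain x1 x2 where "x = x1 @ x2" "x1 \<in> lang \<alpha>" "x2 \<in> ideal p" by auto
  with Cons.prems obtain y1 y2 where "y = y1 @ y2" "subseq y1 x1" "subseq y2 x2"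
    by (auto simp: subseq_append_iff)
  then show ?case
    using Cons.IH lang_subseq \<open>x1 \<in> lang \<alpha>\<close> \<open>x2 \<in> ideal p\<close> by (auto intro!: exI)
qed

lemma Nil_in_ideal: "[] \<in> ideal p"
proof (induction p)
  case (Cons \<alpha> p)
  then show ?case by (cases \<alpha>) auto
qed simp

lemma ideal_append: "ideal (p @ q) = {x @ y | x y. x \<in> ideal p \<and> y \<in> ideal q}"
proof (induction p)
  case Nil
  then show ?case by simp
next
  case (Cons \<alpha> p)
  show ?case unfolding append_Cons ideal.simps Cons.IH
    by (auto, metis append.assoc, metis append.assoc)
qed

lemma ideal_iff_factors: "w \<in> ideal p \<longleftrightarrow> (\<exists>xs. list_all2 (\<lambda>\<alpha> x. x \<in> lang \<alpha>) p xs \<and> w = concat xs)"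
proof (induction p arbitrary: w)
  case (Cons \<alpha> p)
  show ?case unfolding ideal.simps list_all2_Cons1 Cons.IH mem_Collect_eq
    by (metis (no_types, lifting) concat.simps(2))
qed simp

lemma first_outside:
  assumes "w \<notin> lists B" obtains x c y where "w = x @ c # y" "x \<in> lists B" "c \<notin> B"
  using assms split_list_first_prop[of w "\<lambda>c. c \<notin> B"] by (auto simp: in_lists_conv_set)

lemma ideal_Cons_head:
  assumes "\<And>x. x \<in> lang \<alpha> \<Longrightarrow> x \<noteq> [] \<Longrightarrow> hd x \<noteq> c" and "c # y \<in> ideal (\<alpha> # p)"
  shows "c # y \<in> ideal p"
proof -
  obtain x z where "c # y = x @ z" "x \<in> lang \<alpha>" "z \<in> ideal p" using assms(2) by auto
  then show ?thesis using assms(1)[of x] by (cases x) auto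
qed

text \<open>Makes a witness start with c, at the cost of at most one letter: if it does not start
  with c, it embeds in w, and putting c in front keeps it outside the ideal by downward
  closure.\<close>

lemma not_ideal_head_witness:
  assumes "x \<notin> ideal p" "subseq x (c # w)"
  obtains x' where "length x' \<le> Suc (length x)" "c # x' \<notin> ideal p"
    "subseq (c # x') (c # w)" "length (c # x') \<le> Suc (length x)"
proof (cases "\<exists>x'. x = c # x'")
  case True
  then show ?thesis using that assms by auto
next
  case False
  then have "subseq x w" using assms(2) by (cases x) (auto split: if_splits)
  moreover have "c # x \<notin> ideal p" using assms(1) ideal_subseq[of "c # x" p x] by auto
  ultimately show ?thesis using that[of x] by auto
qed

text \<open>Greedy parsing from the left: each atom consumes as much as it can, and one letter per
  atom suffices to certify where it had to stop. The additional letter is the one left over when the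
  atoms are exhausted.\<close>

lemma not_ideal_short_witness:
  "w \<notin> ideal p \<Longrightarrow> \<exists>x. subseq x w \<and> x \<notin> ideal p \<and> length x \<le> Suc (length p)"
proof (induction p arbitrary: w)
  case Nil
  then show ?case by (cases w) (auto intro!: exI[of _ "[hd w]"])
next
  case (Cons \<alpha> p)
  \<comment> \<open>In \<open>head\<close>, c is the first letter that \<alpha> cannot consume, so
    the suffix beginning with c has to be read by p alone. In \<open>skip\<close>, the letter atom
    is spent on the first letter of w.\<close>
  consider (head) y c v where "w = y @ c # v" "c # v \<notin> ideal p"
      "\<And>x. x \<in> lang \<alpha> \<Longrightarrow> x \<noteq> [] \<Longrightarrow> hd x \<noteq> c"
    | (skip) a v where "\<alpha> = Letter a" "w = a # v" "v \<notin> ideal p"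
  proof (cases \<alpha>)
    case (Letter a)
    have "w \<notin> ideal p" using Cons.prems Letter by auto
    show thesis
    proof (cases w)
      case Nil
      then show ?thesis using Nil_in_ideal[of p] \<open>w \<notin> ideal p\<close> by simp
    next
      case W: (Cons c v)
      show ?thesis
      proof (cases "c = a")
        case True
        have "v \<notin> ideal p"
        proof
          assume "v \<in> ideal p"
          then have "[a] @ v \<in> ideal (\<alpha> # p)" using Letter by (auto simp del: append_Cons)
          then show False using Cons.prems W True by simp
        qed
        then show ?thesis using skip Letter W True by blast
      next
        case False
        then show ?thesis using head[of "[]" c v] W \<open>w \<notin> ideal p\<close> Letter by auto
      qed
    qed
  next
    case (Star B)
    then have "w \<notin> lists B" using Cons.prems Nil_in_ideal[of p] by auto
    then obtain x c y where "w = x @ c # y" "x \<in> lists B" "c \<notin> B" by (rule first_outside)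
    moreover have "hd x \<noteq> c" if "x \<in> lang \<alpha>" "x \<noteq> []" for x
      using that Star \<open>c \<notin> B\<close> by (cases x) auto
    moreover have "c # y \<notin> ideal p" using Cons.prems Star calculation(1,2) by auto
    ultimately show thesis using head by blast
  qed
  then show ?case
  proof cases
    case head
    obtain x where "subseq x (c # v)" "x \<notin> ideal p" "length x \<le> Suc (length p)"
      using Cons.IH[OF head(2)] by blast
    then obtain x' where "c # x' \<notin> ideal p" "subseq (c # x') (c # v)"
      "length (c # x') \<le> Suc (length x)" using not_ideal_head_witness by metis
    then show ?thesis using ideal_Cons_head[OF head(3)] \<open>length x \<le> _\<close> head(1)
      by (intro exI[of _ "c # x'"]) (auto simp del: ideal.simps)
  next
    case skip
    then obtain x where x: "subseq x v" "x \<notin> ideal p" "length x \<le> Suc (length p)"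
      using Cons.IH by blast
    have "a # x \<notin> ideal p" using x(2) ideal_subseq[of "a # x" p x] by auto
    have "a # x \<notin> ideal (\<alpha> # p)"
    proof
      assume "a # x \<in> ideal (\<alpha> # p)"
      then have "\<exists>y z. a # x = y @ z \<and> y \<in> lang (Letter a) \<and> z \<in> ideal p"
        unfolding skip(1) ideal.simps by (simp only: mem_Collect_eq)
      then obtain y z where yz: "a # x = y @ z" "y \<in> lang (Letter a)" "z \<in> ideal p"
        by (elim exE conjE)
      then consider "y = []" | "y = [a]" by auto
      then show False using yz x(2) \<open>a # x \<notin> ideal p\<close> by cases simp_all
    qed
    moreover have "subseq (a # x) w" using x skip by simp
    moreover have "length (a # x) \<le> Suc (length (\<alpha> # p))" using x by simp
    ultimately show ?thesis by (intro exI[of _ "a # x"] conjI)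
  qed
qed

section \<open>Sequences of words converging to an ideal\<close>

definition converges :: "nat set \<Rightarrow> (nat \<Rightarrow> 'a list) \<Rightarrow> 'a atom list \<Rightarrow> bool" where
  "converges S w p \<longleftrightarrow> infinite S \<and> (\<forall>\<alpha> \<in> set p. finite (letters \<alpha>)) \<and> (\<forall>n \<in> S. w n \<in> ideal p) \<and>
     (\<forall>N. finite {n \<in> S. \<not> subseq (wits N p) (w n)})"

lemma converges_subset:
  assumes "converges S w p" "T \<subseteq> S" "infinite T"
  shows "converges T w p"
proof -
  have "{n \<in> T. \<not> subseq (wits N p) (w n)} \<subseteq> {n \<in> S. \<not> subseq (wits N p) (w n)}" for N
    using assms(2) by blast
  then have "finite {n \<in> T. \<not> subseq (wits N p) (w n)}" for N
    by (rule finite_subset) (use assms(1) in \<open>simp add: converges_def\<close>)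
  moreover have "\<forall>n \<in> T. w n \<in> ideal p" using assms(1,2) by (auto simp: converges_def)
  ultimately show ?thesis using assms(1,3) by (simp add: converges_def)
qed

lemma converges_append:
  assumes "converges S x p" "converges S y q"
  shows "converges S (\<lambda>n. x n @ y n) (p @ q)"
proof -
  have "finite {n \<in> S. \<not> subseq (wits N (p @ q)) (x n @ y n)}" for N
  proof (rule finite_subset)
    show "{n \<in> S. \<not> subseq (wits N (p @ q)) (x n @ y n)} \<subseteq>
      {n \<in> S. \<not> subseq (wits N p) (x n)} \<union> {n \<in> S. \<not> subseq (wits N q) (y n)}"
      using list_emb_append_mono[of "(=)" "wits N p" _ "wits N q"] by auto
  qed (use assms in \<open>auto simp: converges_def\<close>)
  moreover have "x n @ y n \<in> ideal (p @ q)" if "n \<in> S" for n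
    using assms that unfolding converges_def ideal_append by blast
  ultimately show ?thesis using assms unfolding converges_def by auto
qed

lemma converges_cong: "(\<And>n. n \<in> S \<Longrightarrow> w n = w' n) \<Longrightarrow> converges S w p = converges S w' p"
  unfolding converges_def by (simp cong: conj_cong)

text \<open>A compactness argument by induction on the alphabet. Either every power of
  \<open>enum B\<close> occurs in almost all words, and the limit is the single atom
  \<open>Star B\<close>; or infinitely many words avoid one fixed power, and then they decompose
  over smaller alphabets.\<close>

lemma converges_subsequence:
  assumes "finite B" "infinite S" "\<And>n. n \<in> S \<Longrightarrow> w n \<in> lists B"
  shows "\<exists>p T. T \<subseteq> S \<and> converges T w p"
  using assms
proof (induction B arbitrary: S w rule: finite_psubset_induct)
  case (psubset B)
  text \<open>A sequence that avoids a fixed word splits at the first occurrences of its letters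
    into sequences over smaller alphabets.\<close>
  have avoid: "\<exists>p T. T \<subseteq> S \<and> converges T w p"
    if "infinite S" "\<And>n. n \<in> S \<Longrightarrow> w n \<in> lists B" "\<And>n. n \<in> S \<Longrightarrow> \<not> subseq z (w n)" "set z \<subseteq> B" for z S w
    using that
  proof (induction z arbitrary: S w)
    case Nil
    then have "S = {}" by auto
    then show ?case using Nil.prems by simp
  next
    case (Cons c z)
    define U where "U = {n \<in> S. c \<in> set (w n)}"
    have sm: "B - {c} \<subset> B" using Cons.prems by auto
    show ?case
    proof (cases "finite U")
      case True
      then have "infinite (S - U)" using Cons.prems(1) by simp
      moreover have "w n \<in> lists (B - {c})" if "n \<in> S - U" for n
        using that Cons.prems(2)[of n] by (auto simp: U_def in_lists_conv_set)
      ultimately show ?thesis using psubset.IH[OF sm, of "S - U" w] by blast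
    next
      case False
      have "\<forall>n \<in> U. \<exists>x y. w n = x @ c # y \<and> c \<notin> set x" unfolding U_def using split_list_first by fastforce
      then obtain x y where xy: "\<And>n. n \<in> U \<Longrightarrow> w n = x n @ c # y n \<and> c \<notin> set (x n)" by metis
      have U: "x n \<in> lists (B - {c})" "y n \<in> lists B" "\<not> subseq z (y n)" if "n \<in> U" for n
      proof -
        have "w n \<in> lists B" "\<not> subseq (c # z) (w n)" using that Cons.prems by (auto simp: U_def)
        then show "x n \<in> lists (B - {c})" "y n \<in> lists B" "\<not> subseq z (y n)"
          using xy[OF that] by (auto simp: in_lists_conv_set intro: list_emb_append2)
      qed
      have "\<exists>p T. T \<subseteq> U \<and> converges T x p" by (rule psubset.IH[OF sm False U(1)])
      then obtain p1 T1 where T1: "T1 \<subseteq> U" "converges T1 x p1" by (elim exE conjE)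
      then have "infinite T1" by (simp add: converges_def)
      then have "\<exists>p T. T \<subseteq> T1 \<and> converges T y p"
        using U(2,3) T1(1) Cons.prems(4) by (intro Cons.IH) auto
      then obtain p2 T2 where T2: "T2 \<subseteq> T1" "converges T2 y p2" by (elim exE conjE)
      have "infinite T2" using T2 by (simp add: converges_def)
      then have "converges T2 (\<lambda>n. [c]) [Letter c]" by (simp add: converges_def)
      then have "converges T2 (\<lambda>n. x n @ [c] @ y n) (p1 @ [Letter c] @ p2)"
        using T1 T2 \<open>infinite T2\<close> by (intro converges_append) (auto intro: converges_subset)
      moreover have "n \<in> T2 \<Longrightarrow> w n = x n @ [c] @ y n" for n using xy T1 T2 by auto
      ultimately have "converges T2 w (p1 @ [Letter c] @ p2)"
        using converges_cong[of T2 w "\<lambda>n. x n @ [c] @ y n"] by simp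
      moreover have "T2 \<subseteq> S" using T1(1) T2(1) by (auto simp: U_def)
      ultimately show ?thesis by (intro exI conjI)
    qed
  qed
  show ?case
  proof (cases "\<exists>N. infinite {n \<in> S. \<not> subseq (wit N (Star B)) (w n)}")
    case True
    then obtain N where N: "infinite {n \<in> S. \<not> subseq (wit N (Star B)) (w n)}" by blast
    have "set (wit N (Star B)) \<subseteq> B" using set_enum[OF psubset.hyps] by auto
    with N have "\<exists>p T. T \<subseteq> {n \<in> S. \<not> subseq (wit N (Star B)) (w n)} \<and> converges T w p"
      using psubset.prems by (intro avoid) auto
    then show ?thesis by (elim ex_forward) auto
  next
    case False
    then have "converges S w [Star B]"
      using psubset.prems psubset.hyps by (auto simp: converges_def)
    then show ?thesis by (intro exI[of _ "[Star B]"] exI[of _ S]) simp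
  qed
qed

section \<open>Reduction of ideals\<close>

definition absorbs :: "'a atom \<Rightarrow> 'a atom \<Rightarrow> bool" where
  "absorbs \<alpha> \<beta> \<longleftrightarrow> (\<exists>B. \<alpha> = Star B \<and> letters \<beta> \<subseteq> B)"

lemma lang_letters: "x \<in> lang \<alpha> \<Longrightarrow> set x \<subseteq> letters \<alpha>"
  by (cases \<alpha>) auto

lemma absorbs_lang:
  assumes "absorbs \<alpha> \<beta>" "x \<in> lang \<alpha>" "y \<in> lang \<beta>"
  shows "x @ y \<in> lang \<alpha>" "y @ x \<in> lang \<alpha>"
proof -
  obtain B where "\<alpha> = Star B" "letters \<beta> \<subseteq> B" using assms(1) by (auto simp: absorbs_def)
  then have "y \<in> lists B" using lang_letters[OF assms(3)] unfolding lists_eq_set by blast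
  then show "x @ y \<in> lang \<alpha>" "y @ x \<in> lang \<alpha>" using assms(2) \<open>\<alpha> = Star B\<close> by simp_all
qed

text \<open>A local rewriting rule for limits: enlarging the ideal keeps the words inside, and
  shrinking the test words keeps them contained in almost all words.\<close>

lemma converges_coarsen:
  assumes "converges S w (q @ ps @ r)" "ideal ps \<subseteq> ideal ps'" "\<And>N. subseq (wits N ps') (wits N ps)"
    "set ps' \<subseteq> set ps"
  shows "converges S w (q @ ps' @ r)"
proof -
  have "ideal (q @ ps @ r) \<subseteq> ideal (q @ ps' @ r)" using assms(2) unfolding ideal_append by blast
  moreover have "subseq (wits N (q @ ps' @ r)) (wits N (q @ ps @ r))" for N
    unfolding wits_simps by (intro list_emb_append_mono assms(3) subseq_order.order_refl)
  then have "{n \<in> S. \<not> subseq (wits N (q @ ps' @ r)) (w n)} \<subseteq>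
      {n \<in> S. \<not> subseq (wits N (q @ ps @ r)) (w n)}" for N
    by (intro Collect_mono) (use subseq_order.order_trans in metis)
  then have "finite {n \<in> S. \<not> subseq (wits N (q @ ps' @ r)) (w n)}" for N
    by (rule finite_subset) (use assms(1) in \<open>simp add: converges_def\<close>)
  ultimately show ?thesis using assms(1,4) unfolding converges_def by auto
qed

definition compat :: "'a atom \<Rightarrow> 'a atom \<Rightarrow> bool" where
  "compat \<alpha> \<beta> \<longleftrightarrow> \<not> absorbs \<alpha> \<beta> \<and> \<not> absorbs \<beta> \<alpha>"

text \<open>Equal adjacent letter atoms are allowed, since only a star absorbs.\<close>

definition reduced :: "'a atom list \<Rightarrow> bool" where
  "reduced p \<longleftrightarrow> successively compat p \<and> (\<forall>\<alpha> \<in> set p. letters \<alpha> \<noteq> {})"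

lemma not_successively_split:
  "\<not> successively P xs \<Longrightarrow> \<exists>us a b vs. xs = us @ a # b # vs \<and> \<not> P a b"
proof (induction xs rule: induct_list012)
  case (3 x y zs)
  show ?case
  proof (cases "P x y")
    case True
    then have "\<not> successively P (y # zs)" using 3 by simp
    then obtain us a b vs where "y # zs = us @ a # b # vs" "\<not> P a b" using 3 by blast
    then show ?thesis by (intro exI[of _ "x # us"]) auto
  next
    case False
    then show ?thesis by (intro exI[of _ "[]"]) auto
  qed
qed auto

text \<open>A limit of minimal length is reduced: an absorbed neighbour or a star over the empty
  alphabet could be deleted by \<open>converges_coarsen\<close>.\<close>

lemma converges_reduced:
  assumes "converges S w p"
  shows "\<exists>p. converges S w p \<and> reduced p"
proof -
  obtain p where p: "converges S w p" and min: "\<And>q. converges S w q \<Longrightarrow> length p \<le> length q"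
    using assms ex_has_least_nat[of "converges S w" p length] by blast
  have "reduced p"
  proof (rule ccontr)
    assume "\<not> reduced p"
    then consider "\<not> successively compat p" | \<alpha> where "\<alpha> \<in> set p" "letters \<alpha> = {}"
      by (auto simp: reduced_def)
    then obtain q where "converges S w q" "length q < length p"
    proof cases
      case 1
      then obtain us \<alpha> \<beta> vs where p_eq: "p = us @ \<alpha> # \<beta> # vs" and "\<not> compat \<alpha> \<beta>"
        using not_successively_split by blast
      then consider "absorbs \<alpha> \<beta>" | "absorbs \<beta> \<alpha>" by (auto simp: compat_def)
      then show thesis
      proof cases
        case 1
        have idl: "ideal [\<alpha>, \<beta>] \<subseteq> ideal [\<alpha>]" using absorbs_lang(1)[OF 1] by auto
        have sub: "subseq (wits N [\<alpha>]) (wits N [\<alpha>, \<beta>])" for N by (simp add: subseq_rev_drop_many)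
        have "converges S w (us @ [\<alpha>, \<beta>] @ vs)" using p p_eq by simp
        from converges_coarsen[OF this idl sub] have "converges S w (us @ [\<alpha>] @ vs)" by simp
        then show thesis using that p_eq by auto
      next
        case 2
        have idl: "ideal [\<alpha>, \<beta>] \<subseteq> ideal [\<beta>]" using absorbs_lang(2)[OF 2] by auto
        have sub: "subseq (wits N [\<beta>]) (wits N [\<alpha>, \<beta>])" for N by (simp add: subseq_drop_many)
        have "converges S w (us @ [\<alpha>, \<beta>] @ vs)" using p p_eq by simp
        from converges_coarsen[OF this idl sub] have "converges S w (us @ [\<beta>] @ vs)" by simp
        then show thesis using that p_eq by auto
      qed
    next
      case 2
      then obtain us vs where p_eq: "p = us @ \<alpha> # vs" by (meson split_list)
      have "\<alpha> = Star {}" using 2(2) by (cases \<alpha>) simp_all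
      then have idl: "ideal [\<alpha>] \<subseteq> ideal []" by simp
      have sub: "subseq (wits N []) (wits N [\<alpha>])" for N by simp
      have "converges S w (us @ [\<alpha>] @ vs)" using p p_eq by simp
      from converges_coarsen[OF this idl sub] have "converges S w (us @ [] @ vs)" by simp
      then show thesis using that p_eq by auto
    qed
    then show False using min[of q] by simp
  qed
  then show ?thesis using p by blast
qed

section \<open>Factorizations along a reduced ideal\<close>

text \<open>For a star the letters of \<beta> do not all lie in its alphabet; for a letter atom two
  letters are already too many. The extra letter c is essential when \<alpha> and \<beta> are the
  same letter atom.\<close>

lemma compat_lang:
  assumes "compat \<alpha> \<beta>" "set y = letters \<beta>" "letters \<beta> \<noteq> {}" "x \<in> lang \<alpha>"
  shows "\<not> subseq (c # y) x" "\<not> subseq (y @ [c]) x"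
proof -
  have *: "\<not> subseq z x" if z: "length z \<ge> 2" "set y \<subseteq> set z" for z
  proof (cases \<alpha>)
    case (Letter a)
    then have "length x \<le> 1" using assms(4) by auto
    then show ?thesis using z list_emb_length[of "(=)" z x] by auto
  next
    case (Star B)
    then have "\<not> letters \<beta> \<subseteq> B" using assms(1) by (simp add: compat_def absorbs_def)
    moreover have "set x \<subseteq> B" using assms(4) Star by auto
    ultimately show ?thesis using subseq_set[of z x] z(2) assms(2) by blast
  qed
  have "y \<noteq> []" using assms by auto
  then have "length y \<ge> 1" by (cases y) simp_all
  then show "\<not> subseq (c # y) x" "\<not> subseq (y @ [c]) x"
    by (rule_tac[!] *) auto
qed

lemma compat_sym: "compat \<alpha> \<beta> \<Longrightarrow> compat \<beta> \<alpha>"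
  by (auto simp: compat_def)

text \<open>A factor list consists of triples: an atom, a factor of the word in the language of the
  atom, and a test word that uses all letters of the atom.\<close>
definition factors :: "('a atom \<times> 'a list \<times> 'a list) list \<Rightarrow> bool" where
  "factors ts \<longleftrightarrow> (\<forall>(\<alpha>, x, y) \<in> set ts. x \<in> lang \<alpha> \<and> set y = letters \<alpha> \<and> letters \<alpha> \<noteq> {})"

abbreviation word :: "('a atom \<times> 'a list \<times> 'a list) list \<Rightarrow> 'a list" where
  "word ts \<equiv> concat (map (\<lambda>(\<alpha>, x, y). x) ts)"

abbreviation test :: "('a atom \<times> 'a list \<times> 'a list) list \<Rightarrow> 'a list" where
  "test ts \<equiv> concat (map (\<lambda>(\<alpha>, x, y). y) ts)"

lemma factors_simps [simp]:
  "factors []"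
  "factors ((\<alpha>, x, y) # ts) \<longleftrightarrow> x \<in> lang \<alpha> \<and> set y = letters \<alpha> \<and> letters \<alpha> \<noteq> {} \<and> factors ts"
  "factors (ts @ us) \<longleftrightarrow> factors ts \<and> factors us"
  by (simp_all add: factors_def ball_Un)

lemma append_eq_cases:
  assumes "a @ b = c @ d"
  obtains u where "a = c @ u" "d = u @ b" | u where "u \<noteq> []" "c = a @ u" "b = u @ d"
proof -
  from assms obtain u where "a = c @ u \<and> u @ b = d \<or> a @ u = c \<and> b = u @ d"
    unfolding append_eq_append_conv2 by blast
  then show thesis using that by (cases "u = []") auto
qed

text \<open>The tests of one atom more than there are factors cannot be squeezed in. Either the
  first factor takes at most y, and the remaining tests are again one too many for the remaining
  factors, or it takes y and one more letter, against \<open>compat_lang\<close>.\<close>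

lemma no_embedding_right:
  assumes "successively compat (\<alpha> # map fst ts)" "factors ts" "set y = letters \<alpha>" "letters \<alpha> \<noteq> {}"
  shows "\<not> subseq (y @ test ts) (word ts)"
  using assms
proof (induction ts arbitrary: \<alpha> y)
  case Nil
  then show ?case by (cases y) simp_all
next
  case (Cons t ts)
  obtain \<beta> x z where t: "t = (\<beta>, x, z)" by (cases t)
  have IH: "\<not> subseq (z @ test ts) (word ts)"
    using Cons.IH[of \<beta> z] Cons.prems t by simp
  show ?case
  proof
    assume "subseq (y @ test (t # ts)) (word (t # ts))"
    then have "subseq (y @ z @ test ts) (x @ word ts)" by (simp add: t)
    then obtain s r where sr: "y @ z @ test ts = s @ r" "subseq s x" "subseq r (word ts)"
      by (auto elim: subseq_appendE)
    from sr(1) show False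
    proof (cases rule: append_eq_cases)
      case 1
      have "subseq (z @ test ts) r"
        unfolding 1 by (simp only: subseq_drop_many subseq_order.order_refl)
      from subseq_order.order_trans[OF this sr(3)] IH show False by contradiction
    next
      case (2 us)
      then obtain c us' where "us = c # us'" by (cases us) auto
      then have "s = (y @ [c]) @ us'" using 2 by simp
      then have "subseq (y @ [c]) s" by (simp only: subseq_rev_drop_many subseq_order.order_refl)
      then have "subseq (y @ [c]) x" using sr(2) by (rule subseq_order.order_trans)
      moreover have "compat \<beta> \<alpha>" using Cons.prems(1) t by (auto intro: compat_sym)
      ultimately show False
        using compat_lang(2)[of \<beta> \<alpha> y x c] Cons.prems t by simp
    qed
  qed
qed

text \<open>Mirror image of \<open>no_embedding_right\<close>, by induction from the right
  end.\<close>

lemma no_embedding_left: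
  assumes "successively compat (map fst ts @ [\<alpha>])" "factors ts" "set y = letters \<alpha>" "letters \<alpha> \<noteq> {}"
  shows "\<not> subseq (test ts @ y) (word ts)"
  using assms
proof (induction ts arbitrary: \<alpha> y rule: rev_induct)
  case Nil
  then show ?case by (cases y) simp_all
next
  case (snoc t ts)
  obtain \<beta> x z where t: "t = (\<beta>, x, z)" by (cases t)
  have suc: "successively compat (map fst ts @ [\<beta>])" "compat \<beta> \<alpha>"
    using snoc.prems(1) t by (simp_all add: successively_append_iff)
  have IH: "\<not> subseq (test ts @ z) (word ts)"
    using snoc.IH[of \<beta> z] snoc.prems t suc by simp
  show ?case
  proof
    assume "subseq (test (ts @ [t]) @ y) (word (ts @ [t]))"
    then have "subseq ((test ts @ z) @ y) (word ts @ x)" by (simp add: t)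
    then obtain s r where sr: "(test ts @ z) @ y = s @ r" "subseq s (word ts)" "subseq r x"
      by (auto elim: subseq_appendE)
    from sr(1)[symmetric] show False
    proof (cases rule: append_eq_cases)
      case (1 us)
      have "subseq (test ts @ z) s"
        unfolding 1 by (simp only: subseq_rev_drop_many subseq_order.order_refl)
      from subseq_order.order_trans[OF this sr(2)] IH show False by contradiction
    next
      case (2 us)
      then obtain us' c where "us = us' @ [c]" by (cases us rule: rev_cases) auto
      then have "r = us' @ (c # y)" using 2 by simp
      then have "subseq (c # y) r" by (simp only: subseq_drop_many subseq_order.order_refl)
      then have "subseq (c # y) x" using sr(3) by (rule subseq_order.order_trans)
      then show False
        using compat_lang(1)[of \<beta> \<alpha> y x c] snoc.prems t suc by simp
    qed
  qed
qed

text \<open>The factors before the distinguished one cannot swallow their own tests and then a word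
  using all letters of \<alpha>; likewise the factors behind it. So t, the part left for x, loses
  less than such a word at either end.\<close>

lemma middle_embedding:
  assumes red: "successively compat (map fst ts @ \<alpha> # map fst us)" and fac: "factors ts" "factors us"
    and ne: "letters \<alpha> \<noteq> {}"
    and emb: "subseq (test ts @ y @ test us) (word ts @ x @ word us)"
  obtains s t r where "test ts @ y @ test us = s @ t @ r" "subseq t x"
    "\<And>b v. set b = letters \<alpha> \<Longrightarrow> s \<noteq> test ts @ b @ v"
    "\<And>b v. set b = letters \<alpha> \<Longrightarrow> r \<noteq> v @ b @ test us"
proof -
  obtain s t r where str: "test ts @ y @ test us = s @ t @ r" "subseq s (word ts)" "subseq t x" "subseq r (word us)"
    using emb by (auto elim!: subseq_appendE)
  have no: "\<not> subseq (test ts @ b) (word ts)" "\<not> subseq (b @ test us) (word us)" if "set b = letters \<alpha>" for b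
    using no_embedding_left[of ts \<alpha> b] no_embedding_right[of \<alpha> us b] red fac ne that
    by (auto simp: successively_append_iff split: list.splits)
  have sub: "subseq (test ts @ b) ((test ts @ b) @ v)" "subseq (b @ test us) (v @ (b @ test us))" for b v
    by (simp_all only: subseq_rev_drop_many subseq_drop_many subseq_order.order_refl)
  have "s \<noteq> test ts @ b @ v" "r \<noteq> v @ b @ test us" if "set b = letters \<alpha>" for b v
  proof -
    show "s \<noteq> test ts @ b @ v"
    proof
      assume "s = test ts @ b @ v"
      then have "subseq (test ts @ b) s" using sub(1)[of b v] by simp
      from subseq_order.order_trans[OF this str(2)] show False using no(1)[OF that] by contradiction
    qed
    show "r \<noteq> v @ b @ test us"
    proof
      assume "r = v @ b @ test us"
      then have "subseq (b @ test us) r" using sub(2)[of b v] by simp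
      from subseq_order.order_trans[OF this str(4)] show False using no(2)[OF that] by contradiction
    qed
  qed
  then show thesis using that[OF str(1,3)] by blast
qed

text \<open>Here the middle test is a single letter, so any loss at an end would be a full copy;
  hence x receives it.\<close>

lemma factor_Letter:
  assumes "successively compat (map fst ts @ Letter a # map fst us)" "factors ts" "factors us"
    and "subseq (test ts @ [a] @ test us) (word ts @ x @ word us)" "x \<in> lang (Letter a)"
  shows "x = [a]"
proof -
  have ne: "letters (Letter a) \<noteq> {}" by simp
  obtain s t r where str: "test ts @ [a] @ test us = s @ t @ r" "subseq t x"
    "\<And>b v. set b = letters (Letter a) \<Longrightarrow> s \<noteq> test ts @ b @ v"
    "\<And>b v. set b = letters (Letter a) \<Longrightarrow> r \<noteq> v @ b @ test us"
    by (rule middle_embedding[OF assms(1-3) ne assms(4)]) (rule that)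
  have "t \<noteq> []"
  proof
    assume "t = []"
    then have "test ts @ a # test us = s @ r" using str(1) by simp
    then show False
    proof (cases rule: append_eq_cases)
      case (1 u)
      then show False using str(4)[of "[a]" u] by simp
    next
      case (2 u)
      then show False using str(3)[of "[a]"] by (cases u) auto
    qed
  qed
  then show ?thesis using str(2) assms(5) by auto
qed

text \<open>The two outer copies of z are the spare ones: each absorbs the possible loss at its end,
  and m survives.\<close>

lemma factor_Star:
  assumes "successively compat (map fst ts @ Star B # map fst us)" "factors ts" "factors us"
    and "subseq (test ts @ (z @ m @ z) @ test us) (word ts @ x @ word us)" "set z = B" "B \<noteq> {}"
  shows "subseq m x"
proof -
  have ne: "letters (Star B) \<noteq> {}" using assms(6) by simp
  obtain s t r where str: "test ts @ (z @ m @ z) @ test us = s @ t @ r" "subseq t x"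
    and b: "\<And>b v. set b = letters (Star B) \<Longrightarrow> s \<noteq> test ts @ b @ v"
    "\<And>b v. set b = letters (Star B) \<Longrightarrow> r \<noteq> v @ b @ test us"
    by (rule middle_embedding[OF assms(1-3) ne assms(4)]) (rule that)
  have z: "\<And>v. s \<noteq> test ts @ z @ v" "\<And>v. r \<noteq> v @ z @ test us" using b assms(5) by simp_all
  have 1: "(test ts @ z) @ (m @ z @ test us) = s @ (t @ r)" using str(1) by simp
  obtain u where u: "test ts @ z = s @ u" "t @ r = u @ m @ z @ test us"
    by (rule append_eq_cases[OF 1]) (use z(1) in auto)
  then have "t @ r = (u @ m) @ (z @ test us)" by simp
  then obtain v where "t = u @ m @ v"
    by (rule append_eq_cases) (use z(2) in auto)
  then have "subseq m t" by (simp add: subseq_drop_many subseq_rev_drop_many)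
  then show ?thesis using str(2) by (rule subseq_order.order_trans)
qed


definition fills :: "nat \<Rightarrow> 'a atom \<Rightarrow> 'a list \<Rightarrow> bool" where
  "fills N \<alpha> x \<longleftrightarrow> (case \<alpha> of Letter a \<Rightarrow> x = [a] | Star B \<Rightarrow> set x \<subseteq> B \<and> subseq (wit N \<alpha>) x)"

lemma wit_Star_split: "wit (Suc (Suc N)) (Star B) = enum B @ wit N (Star B) @ enum B"
  by (simp flip: replicate_append_same)

lemma set_wit: "finite (letters \<alpha>) \<Longrightarrow> N > 0 \<Longrightarrow> set (wit N \<alpha>) = letters \<alpha>"
  by (cases \<alpha>) (simp_all add: set_enum)

text \<open>Any factorization of w along p works: the test words of all atoms together embed in w,
  and the embedding is localised at each atom by \<open>factor_Letter\<close> or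
  \<open>factor_Star\<close>, which costs two powers.\<close>

theorem reduced_ideal_factors:
  assumes "reduced p" and fin: "\<forall>\<alpha> \<in> set p. finite (letters \<alpha>)"
    and w: "w \<in> ideal p" "subseq (wits (Suc (Suc N)) p) w"
  obtains xs where "w = concat xs" "list_all2 (fills N) p xs"
proof -
  obtain xs where xs: "list_all2 (\<lambda>\<alpha> x. x \<in> lang \<alpha>) p xs" "w = concat xs"
    using w(1) by (auto simp: ideal_iff_factors)
  then have len: "length p = length xs" by (auto dest: list_all2_lengthD)
  define ts where "ts = map (\<lambda>(\<alpha>, x). (\<alpha>, x, wit (Suc (Suc N)) \<alpha>)) (zip p xs)"
  have fst: "map fst ts = p" and word: "word ts = w" and test: "test ts = wits (Suc (Suc N)) p"
  proof -
    have "map fst ts = map fst (zip p xs)" unfolding ts_def by (simp add: case_prod_beta)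
    then show "map fst ts = p" using len by simp
    have "map (\<lambda>(\<alpha>, x, y). x) ts = map snd (zip p xs)" unfolding ts_def by (simp add: case_prod_beta)
    then show "word ts = w" using len xs(2) by simp
    have "map (\<lambda>(\<alpha>, x, y). y) ts = map (wit (Suc (Suc N))) (map fst (zip p xs))"
      unfolding ts_def by (simp add: case_prod_beta)
    then show "test ts = wits (Suc (Suc N)) p" using len by (simp add: wits_def)
  qed
  have "factors ts"
    unfolding factors_def ts_def
    using xs(1) fin assms(1)
    by (auto simp: reduced_def list_all2_iff set_wit simp del: wit.simps dest: set_zip_leftD)
  have "fills N (p ! i) (xs ! i)" if i: "i < length p" for i
  proof -
    have ti: "ts ! i = (p ! i, xs ! i, wit (Suc (Suc N)) (p ! i))" using i len by (simp add: ts_def)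
    have "i < length ts" using i len by (simp add: ts_def)
    then have ts: "ts = take i ts @ ts ! i # drop (Suc i) ts" by (rule id_take_nth_drop)
    define us vs where "us = take i ts" and "vs = drop (Suc i) ts"
    have ts': "ts = us @ (p ! i, xs ! i, wit (Suc (Suc N)) (p ! i)) # vs"
      using ts unfolding us_def vs_def ti .
    have fac: "factors us" "factors vs" "xs ! i \<in> lang (p ! i)"
      using \<open>factors ts\<close> arg_cong[OF ts', of factors] by simp_all
    have suc: "successively compat (map fst us @ p ! i # map fst vs)"
      using assms(1) arg_cong[OF ts', of "map fst"] by (simp add: reduced_def fst)
    have emb: "subseq (test us @ wit (Suc (Suc N)) (p ! i) @ test vs) (word us @ xs ! i @ word vs)"
      using w(2) arg_cong[OF ts', of test] arg_cong[OF ts', of word] by (simp add: test word del: wit.simps)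
    show ?thesis
    proof (cases "p ! i")
      case (Letter a)
      then show ?thesis using factor_Letter[of us a vs "xs ! i"] suc fac emb by (simp add: fills_def)
    next
      case (Star B)
      have "p ! i \<in> set p" using i by simp
      then have "letters (p ! i) \<noteq> {}" "finite (letters (p ! i))"
        using assms(1) fin unfolding reduced_def by blast+
      then have "B \<noteq> {}" "finite B" using Star by simp_all
      then have "subseq (wit N (Star B)) (xs ! i)"
        using factor_Star[of us B vs "enum B" "wit N (Star B)" "xs ! i"] suc fac emb
        unfolding Star wit_Star_split by (simp add: set_enum)
      then show ?thesis using fac(3) Star unfolding fills_def by (auto simp: Star)
    qed
  qed
  then have "list_all2 (fills N) p xs" using len by (simp add: list_all2_conv_all_nth)
  then show thesis using that xs(2) by blast
qed

section \<open>Common patterns in two automata\<close>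

lemma path_append: "path T p (u @ v) q \<longleftrightarrow> (\<exists>r. path T p u r \<and> path T r v q)"
  by (induction u arbitrary: p) auto

text \<open>The paths into and out of the loop need only stay within B, as the pumped loop alone
  already contains all short words over B.\<close>

definition conn :: "(nat \<times> nat \<times> nat) list \<Rightarrow> nat set \<Rightarrow> nat \<Rightarrow> nat \<Rightarrow> nat \<Rightarrow> bool" where
  "conn T B p r q \<longleftrightarrow> (\<exists>x y z. path T p x r \<and> path T r y r \<and> path T r z q \<and>
     set x \<subseteq> B \<and> set y = B \<and> set z \<subseteq> B)"

definition pair_step ::
  "(nat \<times> nat \<times> nat) list \<Rightarrow> (nat \<times> nat \<times> nat) list \<Rightarrow> ((nat \<times> nat) \<times> (nat \<times> nat)) set" where
  "pair_step T1 T2 = {((p1, p2), (q1, q2)).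
     (\<exists>a. (p1, a, q1) \<in> set T1 \<and> (p2, a, q2) \<in> set T2) \<or>
     (\<exists>B r1 r2. conn T1 B p1 r1 q1 \<and> conn T2 B p2 r2 q2)}"

text \<open>The word is cut behind an occurrence of each copy of z; s lists the states at the cuts,
  so each segment between consecutive cuts contains z.\<close>

lemma path_pump:
  assumes "path T p x q" "subseq (concat (replicate N z)) x"
  shows "\<exists>s. s 0 = p \<and>
    (\<forall>i < N. \<exists>w. path T (s i) w (s (Suc i)) \<and> set w \<subseteq> set x \<and> subseq z w) \<and>
    (\<exists>w. path T (s N) w q \<and> set w \<subseteq> set x)"
  using assms
proof (induction N arbitrary: p x)
  case 0
  then show ?case by (intro exI[of _ "\<lambda>_. p"]) auto
next
  case (Suc N)
  then have "subseq (z @ concat (replicate N z)) x" by simp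
  then obtain x1 x2 where x: "x = x1 @ x2" "subseq z x1" "subseq (concat (replicate N z)) x2"
    by (auto dest: list_emb_appendD)
  then obtain r where r: "path T p x1 r" "path T r x2 q" using Suc.prems(1) by (auto simp: path_append)
  obtain s where s: "s 0 = r"
    "\<And>i. i < N \<Longrightarrow> \<exists>w. path T (s i) w (s (Suc i)) \<and> set w \<subseteq> set x2 \<and> subseq z w"
    "\<exists>w. path T (s N) w q \<and> set w \<subseteq> set x2"
    using Suc.IH[OF r(2) x(3)] by blast
  have sub: "set x1 \<subseteq> set x" "set x2 \<subseteq> set x" using x(1) by auto
  have "\<exists>w. path T (case_nat p s i) w (case_nat p s (Suc i)) \<and> set w \<subseteq> set x \<and> subseq z w"
    if "i < Suc N" for i
  proof (cases i)
    case 0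
    then show ?thesis using s(1) r(1) x(2) sub(1) by auto
  next
    case (Suc j)
    then show ?thesis using s(2)[of j] that sub(2) by (auto intro: subset_trans)
  qed
  moreover have "\<exists>w. path T (case_nat p s (Suc N)) w q \<and> set w \<subseteq> set x"
    using s(3) sub(2) by (auto intro: subset_trans)
  ultimately show ?case by (intro exI[of _ "case_nat p s"]) auto
qed

lemma path_less:
  assumes "path T p w q" "p < n" "\<forall>(p, a, q) \<in> set T. q < n"
  shows "q < n"
  using assms by (induction w arbitrary: p) auto

lemma path_labels:
  assumes "path T p w q" "\<forall>(p, a, q) \<in> set T. a < k"
  shows "w \<in> lists {..<k}"
  using assms by (induction w arbitrary: p) auto

text \<open>Pigeonhole on the states at the cuts. Every segment reads all letters of B and no
  others, so the piece between two equal states is a loop with letter set exactly B.\<close>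

lemma conn_of_path:
  assumes x: "path T p x q" "set x \<subseteq> B" and z: "set z = B" "subseq (concat (replicate n z)) x"
    and n: "p < n" "\<forall>(p, a, q) \<in> set T. q < n"
  shows "\<exists>r. conn T B p r q"
proof -
  obtain s where s: "s 0 = p"
    "\<And>i. i < n \<Longrightarrow> \<exists>w. path T (s i) w (s (Suc i)) \<and> set w \<subseteq> set x \<and> subseq z w"
    "\<exists>w. path T (s n) w q \<and> set w \<subseteq> set x"
    using path_pump[OF x(1) z(2)] by blast
  have seg: "\<exists>w. path T (s i) w (s j) \<and> set w \<subseteq> B \<and> (i < j \<longrightarrow> set w = B)"
    if "i \<le> j" "j \<le> n" for i j
    using that
  proof (induction j rule: dec_induct)
    case base
    show ?case by (intro exI[of _ "[]"]) simp
  next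
    case (step j)
    then obtain w where w: "path T (s i) w (s j)" "set w \<subseteq> B" by auto
    obtain v where v: "path T (s j) v (s (Suc j))" "set v \<subseteq> set x" "subseq z v"
      using s(2)[of j] step by auto
    have "set v = B" using v x(2) z(1) subseq_set[OF v(3)] by blast
    then show ?case using w v by (intro exI[of _ "w @ v"]) (auto simp: path_append)
  qed
  have "s i < n" if "i \<le> n" for i
    using seg[of 0 i] that s(1) path_less n by fastforce
  \<comment> \<open>There are n + 1 cut points but only n states.\<close>
  then have "s ` {..n} \<subseteq> {..<n}" by auto
  then have "card (s ` {..n}) \<le> n" using card_mono[of "{..<n}"] by fastforce
  then have "\<not> inj_on s {..n}" using card_image[of s "{..n}"] by auto
  then obtain i j where ij: "i < j" "j \<le> n" "s i = s j"
    unfolding inj_on_def by (metis atMost_iff linorder_neqE_nat)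
  obtain u where u: "path T p u (s i)" "set u \<subseteq> B" using seg[of 0 i] ij s(1) by auto
  obtain v where v: "path T (s i) v (s j)" "set v = B" using seg[of i j] ij by auto
  obtain w where w: "path T (s j) w (s n)" "set w \<subseteq> B" using seg[of j n] ij by auto
  obtain w' where w': "path T (s n) w' q" "set w' \<subseteq> B" using s(3) x(2) by blast
  have "path T (s j) (w @ w') q" using w w' by (auto simp: path_append)
  then have "conn T B p (s j) q"
    unfolding conn_def using u v w w' ij(3) by (intro exI[of _ u] exI[of _ v] exI[of _ "w @ w'"]) auto
  then show ?thesis by blast
qed

text \<open>Both runs are cut along the same atoms: a letter atom gives an edge with a common
  letter, a star gives loops with the same letter set in both automata.\<close>

lemma path_fills_pair_step:
  assumes "list_all2 (fills n) p xs" "list_all2 (fills n) p ys" "\<forall>\<alpha> \<in> set p. finite (letters \<alpha>)"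
    and "path T1 p1 (concat xs) q1" "path T2 p2 (concat ys) q2" "p1 < n" "p2 < n"
    and T: "\<forall>(p, a, q) \<in> set T1. q < n" "\<forall>(p, a, q) \<in> set T2. q < n"
  shows "((p1, p2), (q1, q2)) \<in> (pair_step T1 T2)\<^sup>*"
  using assms(1-7)
proof (induction p arbitrary: xs ys p1 p2)
  case Nil
  then show ?case by simp
next
  case (Cons \<alpha> p)
  obtain x xs' where xs: "xs = x # xs'" "fills n \<alpha> x" "list_all2 (fills n) p xs'"
    using Cons.prems(1) by (auto simp: list_all2_Cons1)
  obtain y ys' where ys: "ys = y # ys'" "fills n \<alpha> y" "list_all2 (fills n) p ys'"
    using Cons.prems(2) by (auto simp: list_all2_Cons1)
  obtain r1 where r1: "path T1 p1 x r1" "path T1 r1 (concat xs') q1"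
    using Cons.prems(4) xs(1) by (auto simp: path_append)
  obtain r2 where r2: "path T2 p2 y r2" "path T2 r2 (concat ys') q2"
    using Cons.prems(5) ys(1) by (auto simp: path_append)
  have less: "r1 < n" "r2 < n"
    using path_less[OF r1(1) _ T(1)] path_less[OF r2(1) _ T(2)] Cons.prems(6,7) by auto
  have "((p1, p2), (r1, r2)) \<in> pair_step T1 T2"
  proof (cases \<alpha>)
    case (Letter a)
    then show ?thesis using xs(2) ys(2) r1(1) r2(1) by (auto simp: fills_def pair_step_def)
  next
    case (Star B)
    then have "set (enum B) = B" using Cons.prems(3) by (simp add: set_enum)
    then obtain s1 s2 where "conn T1 B p1 s1 r1" "conn T2 B p2 s2 r2"
      using conn_of_path[OF r1(1), of B "enum B" n] conn_of_path[OF r2(1), of B "enum B" n]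
        xs(2) ys(2) Star T Cons.prems(6,7) unfolding fills_def by auto
    then show ?thesis unfolding pair_step_def by blast
  qed
  moreover have "((r1, r2), (q1, q2)) \<in> (pair_step T1 T2)\<^sup>*"
    using Cons.IH[OF xs(3) ys(3) _ r1(2) r2(2) less] Cons.prems(3) by simp
  ultimately show ?case by (rule converse_rtrancl_into_rtrancl)
qed

text \<open>Each copy of y supplies one letter of w.\<close>

lemma subseq_concat_replicate: "length w \<le> n \<Longrightarrow> set w \<subseteq> set y \<Longrightarrow> subseq w (concat (replicate n y))"
proof (induction n arbitrary: w)
  case (Suc n)
  show ?case
  proof (cases w)
    case (Cons a v)
    then have "subseq ([a] @ v) (y @ concat (replicate n y))"
      using Suc by (intro list_emb_append_mono) (simp_all add: subseq_singleton_left)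
    then show ?thesis using Cons by simp
  qed simp
qed simp

text \<open>For a given n, every star edge is realised by running its loop n times. Both resulting
  words then contain exactly the words over B among those of length at most n, and
  \<open>simn_append\<close> glues the edges together.\<close>

lemma pair_step_words:
  assumes "(P, Q) \<in> (pair_step T1 T2)\<^sup>*"
  shows "\<exists>u v. path T1 (fst P) u (fst Q) \<and> path T2 (snd P) v (snd Q) \<and> simn n u v"
  using assms
proof (induction rule: rtrancl_induct)
  case base
  show ?case by (intro exI[of _ "[]"]) simp
next
  case (step Q R)
  have "\<exists>u v. path T1 (fst Q) u (fst R) \<and> path T2 (snd Q) v (snd R) \<and> simn n u v"
  proof -
    obtain p1 p2 q1 q2 where QR: "Q = (p1, p2)" "R = (q1, q2)" by (metis surj_pair)
    then consider a where "(p1, a, q1) \<in> set T1" "(p2, a, q2) \<in> set T2"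
      | B r1 r2 where "conn T1 B p1 r1 q1" "conn T2 B p2 r2 q2"
      using step.hyps(2) unfolding pair_step_def by auto
    then show ?thesis
    proof cases
      case 1
      then show ?thesis using QR by (intro exI[of _ "[a]"]) simp
    next
      case 2
      have "\<exists>u. path T p u q \<and> (\<forall>w. length w \<le> n \<longrightarrow> subseq w u = (set w \<subseteq> B))" if c: "conn T B p r q" for T p r q
      proof -
        obtain x y z where xyz: "path T p x r" "path T r y r" "path T r z q"
          "set x \<subseteq> B" "set y = B" "set z \<subseteq> B" using c unfolding conn_def by blast
        have "path T r (concat (replicate n y)) r"
          using xyz(2) by (induction n) (auto simp: path_append)
        then have p: "path T p (x @ concat (replicate n y) @ z) q" using xyz by (auto simp: path_append)
        have "subseq w (x @ concat (replicate n y) @ z) = (set w \<subseteq> B)" if "length w \<le> n" for w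
        proof
          assume "set w \<subseteq> B"
          then have "subseq w (concat (replicate n y))" using subseq_concat_replicate that xyz(5) by blast
          then show "subseq w (x @ concat (replicate n y) @ z)"
            by (simp add: subseq_drop_many subseq_rev_drop_many)
        next
          assume "subseq w (x @ concat (replicate n y) @ z)"
          then show "set w \<subseteq> B" using xyz subseq_set[of w] by fastforce
        qed
        then show ?thesis using p by blast
      qed
      then obtain u v where "path T1 p1 u q1" "\<forall>w. length w \<le> n \<longrightarrow> subseq w u = (set w \<subseteq> B)"
        "path T2 p2 v q2" "\<forall>w. length w \<le> n \<longrightarrow> subseq w v = (set w \<subseteq> B)" using 2 by metis
      then show ?thesis using QR unfolding simn_def by (intro exI[of _ u] exI[of _ v]) simp
    qed
  qed
  then obtain u' v' where "path T1 (fst Q) u' (fst R)" "path T2 (snd Q) v' (snd R)" "simn n u' v'" by blast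
  moreover obtain u v where "path T1 (fst P) u (fst Q)" "path T2 (snd P) v (snd Q)" "simn n u v"
    using step.IH by blast
  ultimately show ?case
    by (intro exI[of _ "u @ u'"] exI[of _ "v @ v'"]) (auto simp: path_append simn_append)
qed

theorem PT_separable_iff_no_pattern:
  assumes wf: "wf_nfa k M1" "wf_nfa k M2"
  shows "PT_separable {..<k} (nfa_lang k M1) (nfa_lang k M2) \<longleftrightarrow>
    \<not> (\<exists>p1 \<in> set (initial M1). \<exists>p2 \<in> set (initial M2). \<exists>q1 \<in> set (final M1). \<exists>q2 \<in> set (final M2).
        ((p1, p2), (q1, q2)) \<in> (pair_step (trans M1) (trans M2))\<^sup>*)" (is "_ \<longleftrightarrow> \<not> ?R")
proof -
  have sub: "nfa_lang k M1 \<subseteq> lists {..<k}" "nfa_lang k M2 \<subseteq> lists {..<k}"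
    by (auto simp: nfa_lang_def)
  have iff: "PT_separable {..<k} (nfa_lang k M1) (nfa_lang k M2) \<longleftrightarrow>
      (\<exists>n. \<forall>u \<in> nfa_lang k M1. \<forall>v \<in> nfa_lang k M2. \<not> simn n u v)"
    using sub by (intro PT_separable_iff_simn) auto
  have "?R" if ns: "\<And>n. \<exists>u \<in> nfa_lang k M1. \<exists>v \<in> nfa_lang k M2. simn n u v"
  proof -
    obtain u v where uv: "\<And>n. u n \<in> nfa_lang k M1" "\<And>n. v n \<in> nfa_lang k M2" "\<And>n. simn n (u n) (v n)"
      using ns by metis
    have "\<exists>p T. T \<subseteq> UNIV \<and> converges T u p"
      by (rule converges_subsequence[of "{..<k}"]) (use uv(1) sub in \<open>auto simp del: lists_eq_set\<close>)
    then obtain p0 S where "converges S u p0" by auto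
    then obtain p where p: "converges S u p" "reduced p" using converges_reduced by blast
    \<comment> \<open>One pumping constant that bounds the states of both automata.\<close>
    define m where "m = nstates M1 + nstates M2"
    let ?t = "wits (Suc (Suc m)) p"
    \<comment> \<open>An index is chosen outside the finitely many exceptions and so large that
      \<open>simn n\<close> carries both the test word and any witness of non-membership in the
      ideal from one word to the other.\<close>
    have "infinite (S - {n \<in> S. \<not> subseq ?t (u n)} - {..length ?t + Suc (length p)})"
      using p(1) by (simp add: converges_def)
    then have "S - {n \<in> S. \<not> subseq ?t (u n)} - {..length ?t + Suc (length p)} \<noteq> {}"
      by (metis finite.emptyI)
    then obtain n where "n \<in> S - {n \<in> S. \<not> subseq ?t (u n)} - {..length ?t + Suc (length p)}"
      by blast
    then have n: "n \<in> S" "subseq ?t (u n)" "length ?t \<le> n" "Suc (length p) \<le> n" by simp_all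
    have fin: "\<forall>\<alpha> \<in> set p. finite (letters \<alpha>)" and u: "u n \<in> ideal p"
      using p(1) n(1) by (auto simp: converges_def)
    have v: "v n \<in> ideal p"
    proof (rule ccontr)
      assume "v n \<notin> ideal p"
      then obtain x where x: "subseq x (v n)" "x \<notin> ideal p" "length x \<le> Suc (length p)"
        using not_ideal_short_witness by blast
      then have "subseq x (u n)" using uv(3)[of n] n(4) unfolding simn_def by simp
      then show False using u x(2) ideal_subseq by blast
    qed
    have t: "subseq ?t (v n)" using uv(3)[of n] n(2,3) unfolding simn_def by simp
    obtain xs where xs: "u n = concat xs" "list_all2 (fills m) p xs"
      using reduced_ideal_factors[OF p(2) fin u n(2)] by blast
    obtain ys where ys: "v n = concat ys" "list_all2 (fills m) p ys"
      using reduced_ideal_factors[OF p(2) fin v t] by blast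
    obtain p1 q1 where 1: "p1 \<in> set (initial M1)" "q1 \<in> set (final M1)" "path (trans M1) p1 (concat xs) q1"
      using uv(1)[of n] xs(1) by (auto simp: nfa_lang_def)
    obtain p2 q2 where 2: "p2 \<in> set (initial M2)" "q2 \<in> set (final M2)" "path (trans M2) p2 (concat ys) q2"
      using uv(2)[of n] ys(1) by (auto simp: nfa_lang_def)
    have "p1 < m" "p2 < m" using 1 2 wf unfolding wf_nfa_def m_def by force+
    moreover have "\<forall>(p, a, q) \<in> set (trans M1). q < m" "\<forall>(p, a, q) \<in> set (trans M2). q < m"
      using wf unfolding wf_nfa_def m_def by force+
    ultimately have "((p1, p2), (q1, q2)) \<in> (pair_step (trans M1) (trans M2))\<^sup>*"
      using path_fills_pair_step[OF xs(2) ys(2) fin 1(3) 2(3)] by blast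
    then show ?R using 1 2 by blast
  qed
  moreover have "\<exists>u \<in> nfa_lang k M1. \<exists>v \<in> nfa_lang k M2. simn n u v" if ?R for n
  proof -
    obtain p1 p2 q1 q2 where pq: "p1 \<in> set (initial M1)" "p2 \<in> set (initial M2)"
      "q1 \<in> set (final M1)" "q2 \<in> set (final M2)"
      "((p1, p2), (q1, q2)) \<in> (pair_step (trans M1) (trans M2))\<^sup>*" using \<open>?R\<close> by blast
    obtain u v where uv: "path (trans M1) p1 u q1" "path (trans M2) p2 v q2" "simn n u v"
      using pair_step_words[OF pq(5), of n] by auto
    have "\<forall>(p, a, q) \<in> set (trans M1). a < k" "\<forall>(p, a, q) \<in> set (trans M2). a < k"
      using wf unfolding wf_nfa_def by force+
    then have "u \<in> lists {..<k}" "v \<in> lists {..<k}"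
      using path_labels[OF uv(1)] path_labels[OF uv(2)] by simp_all
    then have "u \<in> nfa_lang k M1" "v \<in> nfa_lang k M2"
      using uv(1,2) pq unfolding nfa_lang_def by auto
    then show ?thesis using uv(3) by blast
  qed
  ultimately show ?thesis using iff by blast
qed

section \<open>Hoare triples for machine code\<close>

type_synonym mem = "nat \<Rightarrow> nat"

text \<open>Code is a function of its absolute start address, since jumps are absolute.\<close>
type_synonym code = "nat \<Rightarrow> instr list"

definition reaches :: "instr list \<Rightarrow> nat \<Rightarrow> config \<Rightarrow> config \<Rightarrow> bool" where
  "reaches P t a b \<longleftrightarrow> (\<exists>t' \<le> t. run P t' a = b)"

lemma reaches_refl: "reaches P t a a"
  unfolding reaches_def by (intro exI[of _ 0]) (simp add: run_def)

lemma reaches_trans: "reaches P s a b \<Longrightarrow> reaches P t b c \<Longrightarrow> reaches P (s + t) a c"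
  unfolding reaches_def run_def
  by (metis (no_types, lifting) add.commute add_mono comp_apply funpow_add)

lemma reaches_mono: "reaches P s a b \<Longrightarrow> s \<le> t \<Longrightarrow> reaches P t a b"
  unfolding reaches_def using order.trans by blast

lemma reaches_nth:
  assumes "pc < length P" "P ! pc = i" "i \<noteq> Halt" "exec i (pc, m) = b"
  shows "reaches P 1 (pc, m) b"
  unfolding reaches_def run_def using assms
  by (intro exI[of _ 1]) (simp add: step_def halted_def)

text \<open>Total correctness with a time bound. The surrounding program is arbitrary and control
  ends just behind the code, so that pieces can be placed anywhere and composed.\<close>

definition triple :: "(mem \<Rightarrow> bool) \<Rightarrow> code \<Rightarrow> (mem \<Rightarrow> bool) \<Rightarrow> nat \<Rightarrow> bool" where
  "triple P c Q t \<longleftrightarrow> (\<forall>pre post m. P m \<longrightarrow>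
     (\<exists>m'. reaches (pre @ c (length pre) @ post) t (length pre, m)
        (length pre + length (c (length pre)), m') \<and> Q m'))"

lemma tripleI:
  assumes "\<And>pre post m. P m \<Longrightarrow> \<exists>m'. reaches (pre @ c (length pre) @ post) t (length pre, m)
        (length pre + length (c (length pre)), m') \<and> Q m'"
  shows "triple P c Q t"
  using assms unfolding triple_def by blast

lemma tripleD:
  assumes "triple P c Q t" "P m" "Pr = pre @ c (length pre) @ post" "l = length pre"
  obtains m' where "reaches Pr t (l, m) (l + length (c l), m')" "Q m'"
  using assms unfolding triple_def by blast

lemma triple_conseq:
  assumes "triple P c Q t" "\<And>m. P' m \<Longrightarrow> P m" "\<And>m. Q m \<Longrightarrow> Q' m" "t \<le> t'"
  shows "triple P' c Q' t'"
  using assms unfolding triple_def by (meson reaches_mono)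

text \<open>Fixes the starting memory, so that a postcondition can refer to it.\<close>

lemma triple_start: "(\<And>m0. P m0 \<Longrightarrow> triple ((=) m0) c Q t) \<Longrightarrow> triple P c Q t"
  unfolding triple_def by blast

definition seq :: "code \<Rightarrow> code \<Rightarrow> code" where
  "seq c1 c2 = (\<lambda>l. c1 l @ c2 (l + length (c1 l)))"

lemma triple_seq:
  assumes "triple P c1 Q s" "triple Q c2 S t"
  shows "triple P (seq c1 c2) S (s + t)"
proof (rule tripleI)
  fix pre post :: "instr list" and m assume "P m"
  let ?l = "length pre"
  let ?P = "pre @ seq c1 c2 ?l @ post"
  obtain m1 where m1: "reaches ?P s (?l, m) (?l + length (c1 ?l), m1)" "Q m1"
    by (rule tripleD[OF assms(1) \<open>P m\<close>, of ?P pre "c2 (?l + length (c1 ?l)) @ post" ?l])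
      (simp_all add: seq_def)
  obtain m2 where m2: "reaches ?P t (?l + length (c1 ?l), m1)
      (?l + length (c1 ?l) + length (c2 (?l + length (c1 ?l))), m2)" "S m2"
    by (rule tripleD[OF assms(2) m1(2), of ?P "pre @ c1 ?l" post "?l + length (c1 ?l)"])
      (simp_all add: seq_def)
  show "\<exists>m'. reaches ?P (s + t) (?l, m) (?l + length (seq c1 c2 ?l), m') \<and> S m'"
    using reaches_trans[OF m1(1) m2(1)] m2(2) by (auto simp: seq_def add.assoc)
qed

definition upd :: "instr \<Rightarrow> mem \<Rightarrow> mem" where
  "upd i m = snd (exec i (0, m))"

lemma upd_simps [simp]:
  "upd (LoadC r v) m = m(r := v)"
  "upd (Add r s t) m = m(r := m s + m t)"
  "upd (Sub r s t) m = m(r := m s - m t)"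
  "upd (LoadI r s) m = m(r := m (m s))"
  "upd (StoreI r s) m = m(m r := m s)"
  by (simp_all add: upd_def)

fun basic :: "instr \<Rightarrow> bool" where
  "basic (Jz r l) = False"
| "basic Halt = False"
| "basic _ = True"

lemma exec_basic: "basic i \<Longrightarrow> exec i (pc, m) = (Suc pc, upd i m)"
  by (cases i) auto

lemma triple_block:
  assumes "list_all basic is" "\<And>m. P m \<Longrightarrow> Q (fold upd is m)"
  shows "triple P (\<lambda>_. is) Q (length is)"
proof (rule tripleI)
  fix pre post :: "instr list" and m assume "P m"
  have "reaches (pre @ is @ post) (length is) (length pre, m) (length pre + length is, fold upd is m)"
    using assms(1)
  proof (induction "is" arbitrary: pre m)
    case Nil
    then show ?case by (simp add: reaches_refl)
  next
    case (Cons i "is")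
    have "reaches (pre @ (i # is) @ post) 1 (length pre, m) (Suc (length pre), upd i m)"
      using Cons.prems by (intro reaches_nth[of _ _ i]) (auto simp: exec_basic)
    from reaches_trans[OF this, of "length is"] show ?case
      using Cons.IH[of "pre @ [i]" "upd i m"] Cons.prems by simp
  qed
  then show "\<exists>m'. reaches (pre @ is @ post) (length is) (length pre, m) (length pre + length is, m') \<and> Q m'"
    using assms(2)[OF \<open>P m\<close>] by blast
qed

text \<open>Cells 1, 2 and 3 hold the constants 1 and 0 and the loop bound D.\<close>

definition ifz :: "nat \<Rightarrow> code \<Rightarrow> code \<Rightarrow> code" where
  "ifz r c1 c2 = (\<lambda>l. let l1 = l + 2 + length (c2 (l + 1)) in
     Jz r l1 # c2 (l + 1) @ Jz 2 (l1 + length (c1 l1)) # c1 l1)"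

text \<open>The branch for a nonzero value comes first and leaves by a jump on cell 2, which is
  taken only while that cell holds 0; hence the additional conjunct in its postcondition. The two
  extra steps are the jumps.\<close>

lemma triple_ifz:
  assumes "triple (\<lambda>m. P m \<and> m r = 0) c1 Q t" "triple (\<lambda>m. P m \<and> m r \<noteq> 0) c2 (\<lambda>m. Q m \<and> m 2 = 0) t"
  shows "triple P (ifz r c1 c2) Q (t + 2)"
proof (rule tripleI)
  fix pre post :: "instr list" and m assume "P m"
  let ?l = "length pre"
  let ?P = "pre @ ifz r c1 c2 ?l @ post"
  let ?c2 = "c2 (?l + 1)"
  let ?l1 = "?l + 2 + length ?c2"
  let ?le = "?l1 + length (c1 ?l1)"
  have P: "?P = pre @ (Jz r ?l1 # ?c2 @ Jz 2 ?le # c1 ?l1) @ post" by (simp add: ifz_def Let_def)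
  have len: "?l + length (ifz r c1 c2 ?l) = ?le" by (simp add: ifz_def Let_def)
  have jz: "reaches ?P 1 (?l, m) (if m r = 0 then ?l1 else ?l + 1, m)"
    unfolding P by (intro reaches_nth[of _ _ "Jz r ?l1"]) auto
  show "\<exists>m'. reaches ?P (t + 2) (?l, m) (?l + length (ifz r c1 c2 ?l), m') \<and> Q m'"
  proof (cases "m r = 0")
    case True
    obtain m1 where m1: "reaches ?P t (?l1, m) (?le, m1)" "Q m1"
      by (rule tripleD[OF assms(1), of m ?P "pre @ Jz r ?l1 # ?c2 @ [Jz 2 ?le]" post ?l1])
        (use \<open>P m\<close> True P in simp_all)
    have "reaches ?P 1 (?l, m) (?l1, m)" using jz True by simp
    from reaches_trans[OF this m1(1)] have "reaches ?P (1 + t) (?l, m) (?le, m1)" .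
    then have "reaches ?P (t + 2) (?l, m) (?le, m1)" by (rule reaches_mono) simp
    then show ?thesis unfolding len using m1(2) by blast
  next
    case False
    obtain m1 where m1: "reaches ?P t (?l + 1, m) (?l + 1 + length ?c2, m1)" "Q m1" "m1 2 = 0"
      by (rule tripleD[OF assms(2), of m ?P "pre @ [Jz r ?l1]" "Jz 2 ?le # c1 ?l1 @ post" "?l + 1"])
        (use \<open>P m\<close> False P in simp_all)
    have "reaches ?P 1 (?l + 1 + length ?c2, m1) (?le, m1)"
      unfolding P by (intro reaches_nth[of _ _ "Jz 2 ?le"]) (auto simp: nth_append m1(3))
    note 1 = reaches_trans[OF m1(1) this]
    have "reaches ?P 1 (?l, m) (?l + 1, m)" using jz False by simp
    from reaches_trans[OF this 1] have "reaches ?P (1 + (t + 1)) (?l, m) (?le, m1)" .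
    then have "reaches ?P (t + 2) (?l, m) (?le, m1)" by (rule reaches_mono) simp
    then show ?thesis unfolding len using m1(2) by blast
  qed
qed

definition forc :: "nat \<Rightarrow> code \<Rightarrow> code" where
  "forc x body = (\<lambda>l. let b = body (l + 3) in
     [LoadC x 0, Sub 4 3 x, Jz 4 (l + 5 + length b)] @ b @ [Add x x 1, Jz 2 (l + 1)])"

text \<open>The remaining count goes to cell 4, so the invariant must tolerate changes there. Cell 1
  must hold 1 before the increment of x. A round costs four steps besides the body; loading 0 and
  the last failing test cost three.\<close>

lemma triple_forc:
  assumes inv: "\<And>i m. J i m \<Longrightarrow> m 1 = 1 \<and> m 2 = 0 \<and> m 3 = D \<and> m x = i"
    and init: "\<And>m. P m \<Longrightarrow> J 0 (m(x := 0))"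
    and stable: "\<And>i m v. J i m \<Longrightarrow> J i (m(4 := v))"
    and x: "x > 4"
    and body: "\<And>i. i < D \<Longrightarrow> triple (J i) body (\<lambda>m. m 1 = 1 \<and> J (Suc i) (m(x := m x + 1))) t"
  shows "triple P (forc x body) (J D) (D * (t + 4) + 3)"
proof (rule tripleI)
  fix pre post :: "instr list" and m assume "P m"
  let ?l = "length pre"
  let ?P = "pre @ forc x body ?l @ post"
  let ?b = "body (?l + 3)"
  let ?le = "?l + 5 + length ?b"
  have P: "?P = pre @ ([LoadC x 0, Sub 4 3 x, Jz 4 ?le] @ ?b @ [Add x x 1, Jz 2 (?l + 1)]) @ post"
    by (simp add: forc_def Let_def)
  have loop: "\<exists>m'. reaches ?P (n * (t + 4) + 2) (?l + 1, m) (?le, m') \<and> J D m'"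
    if "J i m" "i + n = D" for i n m
    using that
  proof (induction n arbitrary: i m)
    case 0
    have 1: "reaches ?P 1 (?l + 1, m) (?l + 2, m(4 := 0))"
      unfolding P using inv[OF 0(1)] 0(2) by (intro reaches_nth[of _ _ "Sub 4 3 x"]) (auto simp: nth_append)
    have 2: "reaches ?P 1 (?l + 2, m(4 := 0)) (?le, m(4 := 0))"
      unfolding P by (intro reaches_nth[of _ _ "Jz 4 ?le"]) (auto simp: nth_append)
    show ?case using reaches_trans[OF 1 2] stable[OF 0(1), of 0] 0(2)
      by (intro exI[of _ "m(4 := 0)"] conjI) (simp_all only: mult_0 add_0 one_add_one add_0_right)
  next
    case (Suc n)
    let ?m = "m(4 := D - i)"
    have "D - i \<noteq> 0" using Suc.prems(2) by simp
    have 1: "reaches ?P 1 (?l + 1, m) (?l + 2, ?m)"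
      unfolding P using inv[OF Suc.prems(1)] by (intro reaches_nth[of _ _ "Sub 4 3 x"]) (auto simp: nth_append)
    have 2: "reaches ?P 1 (?l + 2, ?m) (?l + 3, ?m)"
      unfolding P using \<open>D - i \<noteq> 0\<close> by (intro reaches_nth[of _ _ "Jz 4 ?le"]) (auto simp: nth_append)
    have "i < D" using Suc.prems(2) by simp
    note tb = body[OF this] and J4 = stable[OF Suc.prems(1), of "D - i"]
    obtain m1 where m1: "reaches ?P t (?l + 3, ?m) (?l + 3 + length ?b, m1)"
      "m1 1 = 1 \<and> J (Suc i) (m1(x := m1 x + 1))"
      using tb[unfolded triple_def, rule_format, OF J4, of "pre @ [LoadC x 0, Sub 4 3 x, Jz 4 ?le]"
          "[Add x x 1, Jz 2 (?l + 1)] @ post"] P by (auto simp: numeral_3_eq_3)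
    let ?m1 = "m1(x := m1 x + 1)"
    have 3: "reaches ?P 1 (?l + 3 + length ?b, m1) (?l + 4 + length ?b, ?m1)"
      unfolding P using m1(2) by (intro reaches_nth[of _ _ "Add x x 1"]) (auto simp: nth_append)
    have "?m1 2 = 0" using inv[of "Suc i" ?m1] m1(2) x by simp
    then have 4: "reaches ?P 1 (?l + 4 + length ?b, ?m1) (?l + 1, ?m1)"
      unfolding P by (intro reaches_nth[of _ _ "Jz 2 (?l + 1)"]) (auto simp: nth_append)
    have "Suc i + n = D" using Suc.prems(2) by simp
    from Suc.IH[OF conjunct2[OF m1(2)] this]
    obtain m2 where m2: "reaches ?P (n * (t + 4) + 2) (?l + 1, ?m1) (?le, m2)" "J D m2"
      by (elim exE conjE)
    have "reaches ?P (1 + (1 + (t + (1 + (1 + (n * (t + 4) + 2)))))) (?l + 1, m) (?le, m2)"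
      by (rule reaches_trans[OF 1 reaches_trans[OF 2 reaches_trans[OF m1(1) reaches_trans[OF 3
              reaches_trans[OF 4 m2(1)]]]]])
    then have "reaches ?P (Suc n * (t + 4) + 2) (?l + 1, m) (?le, m2)" by (rule reaches_mono) simp
    then show ?case using m2(2) by blast
  qed
  have 0: "reaches ?P 1 (?l, m) (?l + 1, m(x := 0))"
    unfolding P by (intro reaches_nth[of _ _ "LoadC x 0"]) (auto simp: nth_append)
  obtain m' where m': "reaches ?P (D * (t + 4) + 2) (?l + 1, m(x := 0)) (?le, m')" "J D m'"
    using loop[OF init[OF \<open>P m\<close>], of D] by auto
  have len: "?l + length (forc x body ?l) = ?le" by (simp add: forc_def Let_def)
  have "reaches ?P (D * (t + 4) + 3) (?l, m) (?le, m')"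
    by (rule reaches_mono[OF reaches_trans[OF 0 m'(1)]]) simp
  then show "\<exists>m'. reaches ?P (D * (t + 4) + 3) (?l, m) (?l + length (forc x body ?l), m') \<and> J D m'"
    unfolding len using m'(2) by blast
qed

section \<open>Polynomial bounds\<close>

text \<open>The base D + 1 is at least 1, so exponents can be increased freely, also at D =
  0.\<close>

definition poly :: "(nat \<Rightarrow> nat) \<Rightarrow> bool" where
  "poly t \<longleftrightarrow> (\<exists>c k. \<forall>D. t D \<le> c * (D + 1) ^ k)"

lemma poly_const: "poly (\<lambda>_. c)"
  unfolding poly_def by (intro exI[of _ c] exI[of _ 0]) simp

lemma poly_id: "poly (\<lambda>D. D)"
  unfolding poly_def by (intro exI[of _ 1] exI[of _ 1]) simp

lemma poly_add:
  assumes "poly s" "poly t" shows "poly (\<lambda>D. s D + t D)"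
proof -
  obtain c1 k1 c2 k2 where *: "\<And>D. s D \<le> c1 * (D + 1) ^ k1" "\<And>D. t D \<le> c2 * (D + 1) ^ k2"
    using assms unfolding poly_def by blast
  have "s D + t D \<le> (c1 + c2) * (D + 1) ^ (k1 + k2)" for D
  proof -
    have "c1 * (D + 1) ^ k1 \<le> c1 * (D + 1) ^ (k1 + k2)" "c2 * (D + 1) ^ k2 \<le> c2 * (D + 1) ^ (k1 + k2)"
      by (intro mult_left_mono power_increasing; simp)+
    then have "s D + t D \<le> c1 * (D + 1) ^ (k1 + k2) + c2 * (D + 1) ^ (k1 + k2)"
      using *[of D] by linarith
    then show ?thesis by (simp add: algebra_simps)
  qed
  then show ?thesis unfolding poly_def by blast
qed

lemma poly_mult:
  assumes "poly s" "poly t" shows "poly (\<lambda>D. s D * t D)"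
proof -
  obtain c1 k1 c2 k2 where *: "\<And>D. s D \<le> c1 * (D + 1) ^ k1" "\<And>D. t D \<le> c2 * (D + 1) ^ k2"
    using assms unfolding poly_def by blast
  have "s D * t D \<le> (c1 * c2) * (D + 1) ^ (k1 + k2)" for D
    using mult_mono[OF *(1)[of D] *(2)[of D]] by (simp add: power_add algebra_simps)
  then show ?thesis unfolding poly_def by blast
qed

lemmas poly_intros = poly_const poly_id poly_add poly_mult


section \<open>Memory layout\<close>

text \<open>Cell 0 holds the start h of the heap. The register of nesting level d is cell 10 + 2d, and
  the next cell is local to that level. Input cell a + 1 for a < low is saved to cell h - low + a.\<close>

definition low :: nat where "low = 200"

abbreviation rg :: "nat \<Rightarrow> nat" where
  "rg d \<equiv> 10 + 2 * d"

text \<open>The cells that code of nesting level d may overwrite: the scratch cells 4 to 9 and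
  everything belonging to levels from d on. The limits of the form d \<le> 90 keep these registers
  below \<open>low\<close>.\<close>

definition vol :: "nat \<Rightarrow> nat set" where
  "vol d = {4..9} \<union> {rg d..<low}"

definition agree :: "nat \<Rightarrow> mem \<Rightarrow> mem \<Rightarrow> bool" where
  "agree d m m' \<longleftrightarrow> (\<forall>a. a \<notin> vol d \<longrightarrow> m' a = m a)"

type_synonym env = "nat \<Rightarrow> nat"
type_synonym rels = "nat \<Rightarrow> (nat \<times> nat) set"

text \<open>A number with the digits i, x, y in base D, in Horner form: the only multiplications are
  by D, which one loop performs.\<close>

definition idx :: "nat \<Rightarrow> nat \<Rightarrow> nat \<Rightarrow> nat \<Rightarrow> nat" where
  "idx D i x y = (i * D + x) * D + y"

definition saved :: "nat \<Rightarrow> nat \<Rightarrow> nat" where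
  "saved h a = h - low + a"

text \<open>The relations on {..<D} with numbers from 1 on are stored in the heap; the place of number 0
  is a hidden buffer.\<close>
definition rep :: "nat \<Rightarrow> nat \<Rightarrow> (nat \<Rightarrow> nat) \<Rightarrow> env \<Rightarrow> rels \<Rightarrow> mem \<Rightarrow> bool" where
  "rep d D I e rel m \<longleftrightarrow> m 1 = 1 \<and> m 2 = 0 \<and> m 3 = D \<and> 3 * low \<le> m 0 \<and>
     (\<forall>a < low. m (saved (m 0) a) = I a) \<and>
     (\<forall>a \<ge> low. a + 1 < m 0 - low \<longrightarrow> m (a + 1) = I a) \<and>
     (\<forall>a. m 0 - low \<le> a + 1 \<longrightarrow> I a = 0) \<and>
     (\<forall>i < d. m (rg i) = e i) \<and>
     (\<forall>i x y. 1 \<le> i \<longrightarrow> x < D \<longrightarrow> y < D \<longrightarrow> (m (m 0 + idx D i x y) \<noteq> 0) = ((x, y) \<in> rel i))"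

lemma agree_refl: "agree d m m"
  by (simp add: agree_def)

lemma agree_trans: "agree d m m' \<Longrightarrow> agree d m' m'' \<Longrightarrow> agree d m m''"
  by (simp add: agree_def)

lemma agree_Suc: "agree (Suc d) m m' \<Longrightarrow> agree d m m'"
  by (auto simp: agree_def vol_def)

lemma agree_upd: "a \<in> vol d \<Longrightarrow> agree d m m' \<Longrightarrow> agree d m (m'(a := v))"
  by (auto simp: agree_def)

lemma rep_consts:
  assumes "rep d D I e rel m"
  shows "m 1 = 1" "m (Suc 0) = 1" "m 2 = 0" "m 3 = D"
  using assms by (auto simp: rep_def)

lemma agree_consts:
  assumes "agree d m m'"
  shows "m' 0 = m 0" "m' 1 = m 1" "m' (Suc 0) = m 1" "m' 2 = m 2" "m' 3 = m 3" "a \<ge> low \<Longrightarrow> m' a = m a"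
    "i < d \<Longrightarrow> m' (rg i) = m (rg i)" "i < d \<Longrightarrow> m' (11 + 2 * i) = m (11 + 2 * i)"
  using assms by (auto simp: agree_def vol_def low_def)

lemma rep_agree:
  assumes "rep d D I e rel m" "agree d m m'"
  shows "rep d D I e rel m'"
proof -
  note c = agree_consts[OF assms(2)]
  have "m 0 \<ge> 3 * low" using assms(1) by (simp add: rep_def)
  then have "m' (saved (m 0) a) = m (saved (m 0) a)" "m' (m 0 + a) = m (m 0 + a)"
    "a \<ge> low \<Longrightarrow> m' (a + 1) = m (a + 1)" for a by (simp_all add: c(6) saved_def)
  then show ?thesis using assms(1) unfolding rep_def c by (simp add: c)
qed

lemma rep_rel_cong:
  assumes "rep d D I e rel m" "\<And>i x y. x < D \<Longrightarrow> y < D \<Longrightarrow> ((x, y) \<in> rel i) = ((x, y) \<in> rel' i)"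
  shows "rep d D I e rel' m"
  using assms unfolding rep_def by simp

lemma rep_enter:
  assumes "rep d D I e rel m" shows "rep (Suc d) D I (e(d := m (rg d))) rel m"
  using assms unfolding rep_def by (auto simp: less_Suc_eq)

lemma rep_leave:
  assumes "rep (Suc d) D I (e(d := v)) rel m" shows "rep d D I e rel m" "m (rg d) = v"
  using assms unfolding rep_def by (auto simp: less_Suc_eq)

lemma idx_inject:
  assumes "x < D" "y < D" "x' < D" "y' < D" "idx D i x y = idx D j x' y'"
  shows "i = j" "x = x'" "y = y'"
proof -
  have 1: "idx D i x y div D = i * D + x" "idx D i x y mod D = y" if "y < D" for i x y
    using that by (simp_all add: idx_def)
  have 2: "i * D + x = j * D + x'" "y = y'" using 1[of y i x] 1[of y' j x'] assms by simp_all
  have 3: "(i * D + x) div D = i" "(i * D + x) mod D = x" if "x < D" for i x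
    using that by simp_all
  show "i = j" using 3(1)[OF assms(1), of i] 3(1)[OF assms(3), of j] unfolding 2(1) by (rule trans[OF sym])
  show "x = x'" using 3(2)[OF assms(1), of i] 3(2)[OF assms(3), of j] unfolding 2(1) by (rule trans[OF sym])
  show "y = y'" by (rule 2(2))
qed

text \<open>The heap lies above all registers and saved input cells, and distinct entries have
  distinct addresses by \<open>idx_inject\<close>; so a store changes exactly one truth
  value.\<close>

lemma rep_store:
  assumes rep: "rep d D I e rel m" and xy: "x < D" "y < D" and "d \<le> 90"
  shows "rep d D I e (rel(i := if v \<noteq> 0 then insert (x, y) (rel i) else rel i - {(x, y)}))
    (m(m 0 + idx D i x y := v))"
proof -
  define a where "a = m 0 + idx D i x y"
  define m' where "m' = m(a := v)"
  define rel' where "rel' = rel(i := if v \<noteq> 0 then insert (x, y) (rel i) else rel i - {(x, y)})"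
  have h: "m 0 \<ge> 3 * low" using rep by (simp add: rep_def)
  have "a \<ge> 3 * low" using h by (simp add: a_def)
  then have "m' b = m b" if "b < 3 * low" for b using that by (simp add: m'_def)
  then have m': "m' 0 = m 0" "m' 1 = m 1" "m' 2 = m 2" "m' 3 = m 3" "\<And>j. j < d \<Longrightarrow> m' (rg j) = m (rg j)"
    using \<open>d \<le> 90\<close> by (simp_all add: low_def)
  have below: "m' b = m b" if "b < m 0" for b using that by (simp add: m'_def a_def)
  have "(m' (m 0 + idx D j x' y') \<noteq> 0) = ((x', y') \<in> rel' j)"
    if "1 \<le> j" "x' < D" "y' < D" for j x' y'
  proof (cases "i = j \<and> x = x' \<and> y = y'")
    case True
    then show ?thesis by (simp add: m'_def rel'_def a_def)
  next
    case False
    then have "a \<noteq> m 0 + idx D j x' y'" using idx_inject[OF xy that(2,3), of i j] by (auto simp: a_def)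
    then have "m' (m 0 + idx D j x' y') = m (m 0 + idx D j x' y')" by (simp add: m'_def)
    moreover have "((x', y') \<in> rel' j) = ((x', y') \<in> rel j)" using False by (auto simp: rel'_def)
    ultimately show ?thesis using rep that by (simp add: rep_def)
  qed
  moreover have "m' (saved (m 0) b) = m (saved (m 0) b)" if "b < low" for b
    using that h by (intro below) (simp add: saved_def low_def)
  moreover have "m' (b + 1) = m (b + 1)" if "b + 1 < m 0 - low" for b
    using that by (intro below) simp
  ultimately have "rep d D I e rel' m'" using rep m' unfolding rep_def by simp
  then show ?thesis by (simp only: m'_def rel'_def a_def)
qed

section \<open>Programs for terms, formulas and updates of relations\<close>

text \<open>One code and one polynomial serve all D and all inputs. Hiding them behind an
  existential makes the program a product of closure lemmas; it is never written out.\<close>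

definition computes :: "nat \<Rightarrow> (nat \<Rightarrow> (nat \<Rightarrow> nat) \<Rightarrow> env \<Rightarrow> nat) \<Rightarrow> bool" where
  "computes d f \<longleftrightarrow> (\<exists>c t. poly t \<and> (\<forall>D I e rel m0. rep d D I e rel m0 \<longrightarrow>
     triple ((=) m0) c (\<lambda>m. agree d m0 m \<and> m (rg d) = f D I e) (t D)))"

text \<open>Unlike terms, formulas look up tables, whose contents are described by
  \<open>rep\<close> only for indices below D; hence the condition on e.\<close>

definition decides :: "nat \<Rightarrow> (nat \<Rightarrow> (nat \<Rightarrow> nat) \<Rightarrow> env \<Rightarrow> rels \<Rightarrow> bool) \<Rightarrow> bool" where
  "decides d \<phi> \<longleftrightarrow> (\<exists>c t. poly t \<and> (\<forall>D I e rel m0. rep d D I e rel m0 \<longrightarrow> (\<forall>i < d. e i < D) \<longrightarrow>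
     triple ((=) m0) c (\<lambda>m. agree d m0 m \<and> (m (rg d) \<noteq> 0) = \<phi> D I e rel) (t D)))"

text \<open>Heap cells change, so the postcondition is \<open>rep\<close> with the new relations
  instead of \<open>agree\<close>.\<close>

definition updates :: "nat \<Rightarrow> (nat \<Rightarrow> (nat \<Rightarrow> nat) \<Rightarrow> env \<Rightarrow> rels \<Rightarrow> rels) \<Rightarrow> bool" where
  "updates d F \<longleftrightarrow> (\<exists>c t. poly t \<and> (\<forall>D I e rel m0. rep d D I e rel m0 \<longrightarrow> (\<forall>i < d. e i < D) \<longrightarrow>
     triple ((=) m0) c (rep d D I e (F D I e rel)) (t D)))"

section \<open>Evaluation of terms\<close>

lemma computes_block:
  assumes "list_all basic is"
    and "\<And>D I e rel m0. rep d D I e rel m0 \<Longrightarrow> agree d m0 (fold upd is m0) \<and> fold upd is m0 (rg d) = f D I e"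
  shows "computes d f"
  unfolding computes_def
  by (intro exI[of _ "\<lambda>_. is"] exI[of _ "\<lambda>_. length is"] conjI poly_const allI impI triple_block)
    (use assms in auto)

lemma vol_simps:
  "d \<le> 90 \<Longrightarrow> rg d \<in> vol d" "d \<le> 90 \<Longrightarrow> 11 + 2 * d \<in> vol d" "d \<le> 90 \<Longrightarrow> rg (Suc d) \<in> vol d"
  "d \<le> 90 \<Longrightarrow> 12 + 2 * d \<in> vol d"
  "4 \<in> vol d" "5 \<in> vol d" "6 \<in> vol d" "7 \<in> vol d"
  by (auto simp: vol_def low_def)

lemma computes_const: "d \<le> 90 \<Longrightarrow> computes d (\<lambda>D I e. n)"
  by (rule computes_block[of "[LoadC (rg d) n]"]) (auto intro!: agree_upd agree_refl vol_simps)

lemma computes_var: "i < d \<Longrightarrow> d \<le> 90 \<Longrightarrow> computes d (\<lambda>D I e. e i)"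
  by (rule computes_block[of "[Add (rg d) (rg i) 2]"])
    (auto intro!: agree_upd agree_refl vol_simps simp: rep_def)

text \<open>The second argument is evaluated one level up, where the value of the first one occupies
  the register of level d.\<close>
lemma pair_code:
  assumes "computes d f" "computes (Suc d) g" "\<And>D I e v. g D I (e(d := v)) = g D I e"
  obtains c t where "poly t" "\<And>D I e rel m0. rep d D I e rel m0 \<Longrightarrow>
    triple ((=) m0) c (\<lambda>m. agree d m0 m \<and> m (rg d) = f D I e \<and> m (rg (Suc d)) = g D I e) (t D)"
proof -
  obtain c1 t1 where 1: "poly t1" "\<And>D I e rel m0. rep d D I e rel m0 \<Longrightarrow>
     triple ((=) m0) c1 (\<lambda>m. agree d m0 m \<and> m (rg d) = f D I e) (t1 D)"
    using assms(1) unfolding computes_def by blast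
  obtain c2 t2 where 2: "poly t2" "\<And>D I e rel m0. rep (Suc d) D I e rel m0 \<Longrightarrow>
     triple ((=) m0) c2 (\<lambda>m. agree (Suc d) m0 m \<and> m (rg (Suc d)) = g D I e) (t2 D)"
    using assms(2) unfolding computes_def by blast
  show thesis
  proof (rule that)
    show "poly (\<lambda>D. t1 D + t2 D)" by (intro poly_intros 1 2)
    fix D I e rel m0 assume rep: "rep d D I e rel m0"
    show "triple ((=) m0) (seq c1 c2)
       (\<lambda>m. agree d m0 m \<and> m (rg d) = f D I e \<and> m (rg (Suc d)) = g D I e) (t1 D + t2 D)"
    proof (rule triple_seq[OF 1(2)[OF rep]], rule triple_start, elim conjE)
      fix m1 assume m1: "agree d m0 m1" "m1 (rg d) = f D I e"
      note 3 = 2(2)[OF rep_enter[OF rep_agree[OF rep m1(1)]]]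
      show "triple ((=) m1) c2
       (\<lambda>m. agree d m0 m \<and> m (rg d) = f D I e \<and> m (rg (Suc d)) = g D I e) (t2 D)"
        by (rule triple_conseq[OF 3])
          (use m1 agree_consts(7)[of "Suc d" m1 _ d] assms(3) agree_trans[OF m1(1) agree_Suc] in auto)
    qed
  qed
qed

lemma computes_binop:
  assumes "computes d f" "computes (Suc d) g" "\<And>D I e v. g D I (e(d := v)) = g D I e" "d \<le> 90"
    and "basic i" "\<And>m. m 2 = 0 \<Longrightarrow> upd i m = m(rg d := h (m (rg d)) (m (rg (Suc d))))"
  shows "computes d (\<lambda>D I e. h (f D I e) (g D I e))"
proof -
  obtain c t where 1: "poly t" "\<And>D I e rel m0. rep d D I e rel m0 \<Longrightarrow>
    triple ((=) m0) c (\<lambda>m. agree d m0 m \<and> m (rg d) = f D I e \<and> m (rg (Suc d)) = g D I e) (t D)"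
    by (rule pair_code[OF assms(1-3)]) (rule that)
  show ?thesis unfolding computes_def
  proof (intro exI conjI allI impI)
    show "poly (\<lambda>D. t D + length [i])" by (intro poly_intros 1)
    fix D I e rel m0 assume rep: "rep d D I e rel m0"
    show "triple ((=) m0) (seq c (\<lambda>_. [i]))
       (\<lambda>m. agree d m0 m \<and> m (rg d) = h (f D I e) (g D I e)) (t D + length [i])"
    proof (rule triple_seq[OF 1(2)[OF rep]], rule triple_block, goal_cases)
      case 1
      then show ?case using assms(5) by simp
    next
      case (2 m)
      then have "m 2 = 0" using rep_agree[OF rep] by (auto simp: rep_def)
      then show ?case using 2 assms(4,6) by (auto intro!: agree_upd vol_simps)
    qed
  qed
qed

lemma computes_add:
  assumes "computes d f" "computes (Suc d) g" "\<And>D I e v. g D I (e(d := v)) = g D I e" "d \<le> 90"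
  shows "computes d (\<lambda>D I e. f D I e + g D I e)"
  by (rule computes_binop[OF assms, where i = "Add (rg d) (rg d) (rg (Suc d))" and h = "(+)"]) simp_all

text \<open>Truncated subtraction is nonzero exactly for the strict inequality.\<close>

lemma decides_less:
  assumes "computes d f" "computes (Suc d) g" "\<And>D I e v. g D I (e(d := v)) = g D I e" "d \<le> 90"
  shows "decides d (\<lambda>D I e rel. f D I e < g D I e)"
proof -
  have "computes d (\<lambda>D I e. g D I e - f D I e)"
    by (rule computes_binop[OF assms, where i = "Sub (rg d) (rg (Suc d)) (rg d)" and h = "\<lambda>x y. y - x"])
      simp_all
  then obtain c t where "poly t" and 1: "\<And>D I e rel m0. rep d D I e rel m0 \<Longrightarrow>
    triple ((=) m0) c (\<lambda>m. agree d m0 m \<and> m (rg d) = g D I e - f D I e) (t D)"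
    unfolding computes_def by blast
  have "triple ((=) m0) c (\<lambda>m. agree d m0 m \<and> (m (rg d) \<noteq> 0) = (f D I e < g D I e)) (t D)"
    if "rep d D I e rel m0" for D I e rel m0
    by (rule triple_conseq[OF 1[OF that]]) auto
  then show ?thesis unfolding decides_def using \<open>poly t\<close> by blast
qed

text \<open>Repeated addition. The summand is kept in the cell local to level d, and the register of
  the next level counts.\<close>

lemma computes_times_D:
  assumes "computes d f" "d \<le> 80"
  shows "computes d (\<lambda>D I e. f D I e * D)"
proof -
  obtain c t where 1: "poly t" "\<And>D I e rel m0. rep d D I e rel m0 \<Longrightarrow>
    triple ((=) m0) c (\<lambda>m. agree d m0 m \<and> m (rg d) = f D I e) (t D)"
    using assms(1) unfolding computes_def by blast
  let ?b1 = "[Add (11 + 2 * d) (rg d) 2, LoadC (rg d) 0]"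
  let ?b2 = "[Add (rg d) (rg d) (11 + 2 * d)]"
  show ?thesis unfolding computes_def
  proof (intro exI conjI allI impI)
    show "poly (\<lambda>D. t D + (length ?b1 + (D * (length ?b2 + 4) + 3)))" by (intro poly_intros 1)
    fix D I e rel m0 assume rep: "rep d D I e rel m0"
    let ?J = "\<lambda>i m. agree d m0 m \<and> m (11 + 2 * d) = f D I e \<and> m (rg d) = f D I e * i \<and> m (rg (Suc d)) = i"
    have cs: "m 1 = 1" "m (Suc 0) = 1" "m 2 = 0" "m 3 = D" if "agree d m0 m" for m
      using rep_consts[OF rep_agree[OF rep that]] by auto
    show "triple ((=) m0) (seq c (seq (\<lambda>_. ?b1) (forc (rg (Suc d)) (\<lambda>_. ?b2))))
       (\<lambda>m. agree d m0 m \<and> m (rg d) = f D I e * D) (t D + (length ?b1 + (D * (length ?b2 + 4) + 3)))"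
    proof (rule triple_seq[OF 1(2)[OF rep]], rule triple_seq)
      show "triple (\<lambda>m. agree d m0 m \<and> m (rg d) = f D I e) (\<lambda>_. ?b1)
        (\<lambda>m. agree d m0 m \<and> m (11 + 2 * d) = f D I e \<and> m (rg d) = 0) (length ?b1)"
        using cs assms(2) by (intro triple_block) (auto intro!: agree_upd vol_simps)
      show "triple (\<lambda>m. agree d m0 m \<and> m (11 + 2 * d) = f D I e \<and> m (rg d) = 0)
        (forc (rg (Suc d)) (\<lambda>_. ?b2)) (\<lambda>m. agree d m0 m \<and> m (rg d) = f D I e * D) (D * (length ?b2 + 4) + 3)"
      proof (rule triple_conseq[OF triple_forc[where J = ?J and D = D and
              P = "\<lambda>m. agree d m0 m \<and> m (11 + 2 * d) = f D I e \<and> m (rg d) = 0" and t = "length ?b2"]], goal_cases)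
        case (5 i)
        then show ?case using cs assms(2) by (intro triple_block) (auto intro!: agree_upd vol_simps)
      qed (use cs assms(2) in \<open>auto intro!: agree_upd vol_simps\<close>)
    qed
  qed
qed

text \<open>Three cases for the position x: beyond the region below the saved cells the input is 0;
  from \<open>low\<close> on it is still in cell x + 1; below \<open>low\<close> it is in the saved
  copy.\<close>

lemma computes_input:
  assumes "computes d f" "d \<le> 90"
  shows "computes d (\<lambda>D I e. I (f D I e))"
proof -
  obtain c t where 1: "poly t" "\<And>D I e rel m0. rep d D I e rel m0 \<Longrightarrow>
    triple ((=) m0) c (\<lambda>m. agree d m0 m \<and> m (rg d) = f D I e) (t D)"
    using assms(1) unfolding computes_def by blast
  let ?b1 = "[LoadC 4 low, Sub 4 0 4, Add 5 (rg d) 1, Sub 6 4 5]"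
  let ?b2 = "[LoadC 7 low, Sub 7 7 (rg d)]"
  let ?b3 = "[LoadI (rg d) 5]"
  let ?b4 = "[Add 4 4 (rg d), LoadI (rg d) 4]"
  let ?c = "seq (\<lambda>_. ?b1) (ifz 6 (\<lambda>_. [LoadC (rg d) 0]) (seq (\<lambda>_. ?b2) (ifz 7 (\<lambda>_. ?b3) (\<lambda>_. ?b4))))"
  show ?thesis unfolding computes_def
  proof (intro exI conjI allI impI)
    show "poly (\<lambda>D. t D + (length ?b1 + ((length ?b2 + (length ?b4 + 2)) + 2)))" by (intro poly_intros 1)
    fix D I e rel m0 assume rep: "rep d D I e rel m0"
    let ?h = "m0 0" and ?x = "f D I e"
    let ?Q = "\<lambda>m. agree d m0 m \<and> m (rg d) = I ?x"
    let ?A1 = "\<lambda>m. agree d m0 m \<and> m (rg d) = ?x \<and> m 4 = ?h - low \<and> m 5 = ?x + 1 \<and> m 6 = ?h - low - (?x + 1)"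
    let ?A2 = "\<lambda>m. agree d m0 m \<and> m (rg d) = ?x \<and> m 4 = ?h - low \<and> m 5 = ?x + 1 \<and> ?x + 1 < ?h - low \<and> m 7 = low - ?x"
    have cs: "m 1 = 1" "m (Suc 0) = 1" "m 2 = 0" "m 3 = D" "m 0 = ?h" "3 * low \<le> ?h"
      "a < low \<Longrightarrow> m (?h - low + a) = I a" "a < low \<Longrightarrow> m (?h + a - low) = I a" "low \<le> a \<Longrightarrow> Suc a < ?h - low \<Longrightarrow> m (Suc a) = I a"
      "?h - low \<le> Suc a \<Longrightarrow> I a = 0" if "agree d m0 m" for m a
      using rep_agree[OF rep that] agree_consts(1)[OF that] unfolding rep_def saved_def by auto
    have ne: "?h + a - low \<noteq> 4" for a using cs(6)[OF agree_refl] by (simp add: low_def)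
    show "triple ((=) m0) (seq c ?c) ?Q (t D + (length ?b1 + ((length ?b2 + (length ?b4 + 2)) + 2)))"
    proof (rule triple_seq[OF 1(2)[OF rep]], rule triple_seq[where Q = ?A1], goal_cases)
      case 1
      then show ?case using assms(2) by (intro triple_block) (auto intro!: agree_upd vol_simps simp: cs)
    next
      case 2
      show ?case
      proof (rule triple_ifz, goal_cases)
        case 1
        have "triple (\<lambda>m. ?A1 m \<and> m 6 = 0) (\<lambda>_. [LoadC (rg d) 0]) ?Q (length [LoadC (rg d) 0])"
          using assms(2) by (intro triple_block) (auto intro!: agree_upd vol_simps simp: cs)
        then show ?case by (rule triple_conseq) auto
      next
        case 2
        show ?case
        proof (rule triple_seq[where Q = ?A2], goal_cases)
          case 1
          then show ?case using assms(2) by (intro triple_block) (auto intro!: agree_upd vol_simps simp: cs)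
        next
          case 2
          show ?case
          proof (rule triple_ifz, goal_cases)
            case 1
            have "triple (\<lambda>m. ?A2 m \<and> m 7 = 0) (\<lambda>_. ?b3) (\<lambda>m. ?Q m \<and> m 2 = 0) (length ?b3)"
              using assms(2) by (intro triple_block) (auto intro!: agree_upd vol_simps simp: cs)
            then show ?case by (rule triple_conseq) auto
          next
            case 2
            have "triple (\<lambda>m. ?A2 m \<and> m 7 \<noteq> 0) (\<lambda>_. ?b4) (\<lambda>m. (?Q m \<and> m 2 = 0) \<and> m 2 = 0) (length ?b4)"
              using assms(2) by (intro triple_block) (auto intro!: agree_upd vol_simps simp: cs ne)
            then show ?case by (rule triple_conseq) auto
          qed
        qed
      qed
    qed
  qed
qed


section \<open>Decision of formulas\<close>

lemma decidesD:
  assumes "decides d \<phi>"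
  obtains c t where "poly t" "\<And>D I e rel m0. rep d D I e rel m0 \<Longrightarrow> \<forall>i < d. e i < D \<Longrightarrow>
     triple ((=) m0) c (\<lambda>m. agree d m0 m \<and> (m (rg d) \<noteq> 0) = \<phi> D I e rel) (t D)"
proof -
  from assms show thesis unfolding decides_def
  proof (elim exE conjE)
    fix c t
    assume 1: "poly t" and "\<forall>D I e rel m0. rep d D I e rel m0 \<longrightarrow> (\<forall>i < d. e i < D) \<longrightarrow>
     triple ((=) m0) c (\<lambda>m. agree d m0 m \<and> (m (rg d) \<noteq> 0) = \<phi> D I e rel) (t D)"
    then show thesis by (intro that[OF 1, of c]) simp
  qed
qed

lemma updatesD:
  assumes "updates d F"
  obtains c t where "poly t" "\<And>D I e rel m0. rep d D I e rel m0 \<Longrightarrow> \<forall>i < d. e i < D \<Longrightarrow>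
     triple ((=) m0) c (rep d D I e (F D I e rel)) (t D)"
proof -
  from assms show thesis unfolding updates_def
  proof (elim exE conjE)
    fix c t
    assume 1: "poly t" and "\<forall>D I e rel m0. rep d D I e rel m0 \<longrightarrow> (\<forall>i < d. e i < D) \<longrightarrow>
     triple ((=) m0) c (rep d D I e (F D I e rel)) (t D)"
    then show thesis by (intro that[OF 1, of c]) simp
  qed
qed

lemma computesD:
  assumes "computes d f"
  obtains c t where "poly t" "\<And>D I e rel m0. rep d D I e rel m0 \<Longrightarrow>
     triple ((=) m0) c (\<lambda>m. agree d m0 m \<and> m (rg d) = f D I e) (t D)"
proof -
  from assms show thesis unfolding computes_def
  proof (elim exE conjE)
    fix c t
    assume 1: "poly t" and "\<forall>D I e rel m0. rep d D I e rel m0 \<longrightarrow>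
     triple ((=) m0) c (\<lambda>m. agree d m0 m \<and> m (rg d) = f D I e) (t D)"
    then show thesis by (intro that[OF 1, of c]) simp
  qed
qed

lemma decides_not:
  assumes "decides d \<phi>" "d \<le> 90"
  shows "decides d (\<lambda>D I e rel. \<not> \<phi> D I e rel)"
proof -
  obtain c t where 1: "poly t" "\<And>D I e rel m0. rep d D I e rel m0 \<Longrightarrow> \<forall>i < d. e i < D \<Longrightarrow>
     triple ((=) m0) c (\<lambda>m. agree d m0 m \<and> (m (rg d) \<noteq> 0) = \<phi> D I e rel) (t D)"
    by (rule decidesD[OF assms(1)]) (rule that)
  show ?thesis unfolding decides_def
  proof (intro exI conjI allI impI)
    show "poly (\<lambda>D. t D + (length [LoadC (rg d) 0] + 2))" by (intro poly_intros 1)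
    fix D I e rel m0 assume rep: "rep d D I e rel m0" and e: "\<forall>i < d. e i < D"
    have "m 2 = 0" if "agree d m0 m" for m using rep_consts[OF rep_agree[OF rep that]] by auto
    note cs = this
    show "triple ((=) m0) (seq c (ifz (rg d) (\<lambda>_. [LoadC (rg d) 1]) (\<lambda>_. [LoadC (rg d) 0])))
       (\<lambda>m. agree d m0 m \<and> (m (rg d) \<noteq> 0) = (\<not> \<phi> D I e rel)) (t D + (length [LoadC (rg d) 0] + 2))"
    proof (rule triple_seq[OF 1(2)[OF rep]], goal_cases)
      case 2
      show ?case
      proof (rule triple_ifz, goal_cases)
        case 1
        have "triple (\<lambda>m. (agree d m0 m \<and> (m (rg d) \<noteq> 0) = \<phi> D I e rel) \<and> m (rg d) = 0) (\<lambda>_. [LoadC (rg d) 1])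
          (\<lambda>m. agree d m0 m \<and> (m (rg d) \<noteq> 0) = (\<not> \<phi> D I e rel)) (length [LoadC (rg d) 1])"
          using assms(2) by (intro triple_block) (auto intro!: agree_upd vol_simps)
        then show ?case by simp
      next
        case 2
        show ?case using assms(2) by (intro triple_block) (auto intro!: agree_upd vol_simps simp: cs)
      qed
    qed (use e in auto)
  qed
qed

lemma decides_conj:
  assumes "decides d \<phi>" "decides d \<psi>" "d \<le> 90"
  shows "decides d (\<lambda>D I e rel. \<phi> D I e rel \<and> \<psi> D I e rel)"
proof -
  obtain c1 t1 where 1: "poly t1" "\<And>D I e rel m0. rep d D I e rel m0 \<Longrightarrow> \<forall>i < d. e i < D \<Longrightarrow>
     triple ((=) m0) c1 (\<lambda>m. agree d m0 m \<and> (m (rg d) \<noteq> 0) = \<phi> D I e rel) (t1 D)"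
    by (rule decidesD[OF assms(1)]) (rule that)
  obtain c2 t2 where 2: "poly t2" "\<And>D I e rel m0. rep d D I e rel m0 \<Longrightarrow> \<forall>i < d. e i < D \<Longrightarrow>
     triple ((=) m0) c2 (\<lambda>m. agree d m0 m \<and> (m (rg d) \<noteq> 0) = \<psi> D I e rel) (t2 D)"
    by (rule decidesD[OF assms(2)]) (rule that)
  show ?thesis unfolding decides_def
  proof (intro exI conjI allI impI)
    show "poly (\<lambda>D. t1 D + (t2 D + 2))" by (intro poly_intros 1 2)
    fix D I e rel m0 assume rep: "rep d D I e rel m0" and e: "\<forall>i < d. e i < D"
    have cs: "m 2 = 0" if "agree d m0 m" for m using rep_consts[OF rep_agree[OF rep that]] by auto
    show "triple ((=) m0) (seq c1 (ifz (rg d) (\<lambda>_. []) c2))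
       (\<lambda>m. agree d m0 m \<and> (m (rg d) \<noteq> 0) = (\<phi> D I e rel \<and> \<psi> D I e rel)) (t1 D + (t2 D + 2))"
    proof (rule triple_seq[OF 1(2)[OF rep]], goal_cases)
      case C: 2
      show ?case
      proof (rule triple_ifz, goal_cases)
        case C1: 1
        have "triple (\<lambda>m. (agree d m0 m \<and> (m (rg d) \<noteq> 0) = \<phi> D I e rel) \<and> m (rg d) = 0) (\<lambda>_. [])
          (\<lambda>m. agree d m0 m \<and> (m (rg d) \<noteq> 0) = (\<phi> D I e rel \<and> \<psi> D I e rel)) (length ([] :: instr list))"
          by (intro triple_block) auto
        then show ?case by (rule triple_conseq) auto
      next
        case C2: 2
        show ?case
        proof (rule triple_start)
          fix m1 assume m1: "(agree d m0 m1 \<and> (m1 (rg d) \<noteq> 0) = \<phi> D I e rel) \<and> m1 (rg d) \<noteq> 0"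
          then have "rep d D I e rel m1" using rep_agree[OF rep] by blast
          note 3 = 2(2)[OF this]
          show "triple ((=) m1) c2 (\<lambda>m. (agree d m0 m \<and> (m (rg d) \<noteq> 0) = (\<phi> D I e rel \<and> \<psi> D I e rel)) \<and> m 2 = 0) (t2 D)"
            by (rule triple_conseq[OF 3]) (use e m1 agree_trans[of d m0 m1] cs in auto)
        qed
      qed
    qed (use e in auto)
  qed
qed

lemma decides_disj:
  assumes "decides d \<phi>" "decides d \<psi>" "d \<le> 90"
  shows "decides d (\<lambda>D I e rel. \<phi> D I e rel \<or> \<psi> D I e rel)"
  using decides_not[OF decides_conj[OF decides_not[OF assms(1,3)] decides_not[OF assms(2,3)] assms(3)] assms(3)]
  by simp

text \<open>Equality is the absence of both strict inequalities. Each side is the second argument of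
  one comparison, so it must also be computable one level up.\<close>

lemma decides_eq:
  assumes "computes d f" "computes (Suc d) f" "computes d g" "computes (Suc d) g"
    "\<And>D I e v. f D I (e(d := v)) = f D I e" "\<And>D I e v. g D I (e(d := v)) = g D I e" "d \<le> 90"
  shows "decides d (\<lambda>D I e rel. f D I e = g D I e)"
proof -
  have "decides d (\<lambda>D I e rel. \<not> f D I e < g D I e \<and> \<not> g D I e < f D I e)"
    using assms by (intro decides_conj decides_not decides_less) auto
  then show ?thesis by (simp add: not_less order.eq_iff conj_commute)
qed

text \<open>Register d is the bound variable and also the loop counter, so the matrix is evaluated
  one level up. The disjunction of its values is collected in the local cell of level d, which code
  of level \<open>Suc d\<close> leaves alone.\<close>

lemma decides_ex:
  assumes "decides (Suc d) (\<lambda>D I e rel. \<phi> D I e rel (e d))"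
    and "\<And>D I e rel v x. \<phi> D I (e(d := v)) rel x = \<phi> D I e rel x" and d: "d \<le> 80"
  shows "decides d (\<lambda>D I e rel. \<exists>x < D. \<phi> D I e rel x)"
proof -
  obtain c t where body: "poly t" "\<And>D I e rel m0. rep (Suc d) D I e rel m0 \<Longrightarrow> \<forall>i < Suc d. e i < D \<Longrightarrow>
     triple ((=) m0) c (\<lambda>m. agree (Suc d) m0 m \<and> (m (rg (Suc d)) \<noteq> 0) = \<phi> D I e rel (e d)) (t D)"
    by (rule decidesD[OF assms(1)]) (rule that)
  let ?a = "11 + 2 * d"
  let ?b1 = "[LoadC ?a 0]"
  let ?b2 = "[Add (rg d) ?a 2]"
  let ?body = "seq c (ifz (rg (Suc d)) (\<lambda>_. []) (\<lambda>_. [LoadC ?a 1]))"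
  show ?thesis unfolding decides_def
  proof (intro exI conjI allI impI)
    show "poly (\<lambda>D. length ?b1 + ((D * ((t D + (1 + 2)) + 4) + 3) + length ?b2))" by (intro poly_intros body)
    fix D I e rel m0 assume rep: "rep d D I e rel m0" and e: "\<forall>i < d. e i < D"
    let ?J = "\<lambda>i m. agree d m0 m \<and> (m ?a \<noteq> 0) = (\<exists>x < i. \<phi> D I e rel x) \<and> m (rg d) = i"
    have cs: "m 1 = 1" "m (Suc 0) = 1" "m 2 = 0" "m 3 = D" if "agree d m0 m" for m
      using rep_consts[OF rep_agree[OF rep that]] by auto
    show "triple ((=) m0) (seq (\<lambda>_. ?b1) (seq (forc (rg d) ?body) (\<lambda>_. ?b2)))
       (\<lambda>m. agree d m0 m \<and> (m (rg d) \<noteq> 0) = (\<exists>x < D. \<phi> D I e rel x))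
       (length ?b1 + ((D * ((t D + (1 + 2)) + 4) + 3) + length ?b2))"
    proof (rule triple_seq[where Q = "\<lambda>m. agree d m0 m \<and> m ?a = 0"], goal_cases)
      case 1
      show "triple ((=) m0) (\<lambda>_. ?b1) (\<lambda>m. agree d m0 m \<and> m ?a = 0) (length ?b1)"
        using d by (intro triple_block) (auto intro!: agree_upd agree_refl vol_simps)
    next
      case 2
      show ?case
      proof (rule triple_seq[where Q = "?J D"], goal_cases)
        case 1
        show "triple (\<lambda>m. agree d m0 m \<and> m ?a = 0) (forc (rg d) ?body) (?J D) (D * ((t D + (1 + 2)) + 4) + 3)"
        proof (rule triple_forc[where J = ?J and D = D], goal_cases)
          case (5 i)
          have "triple ((=) m1) ?body (\<lambda>m. m 1 = 1 \<and> ?J (Suc i) (m(rg d := m (rg d) + 1))) (t D + (1 + 2))"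
            if m1: "?J i m1" for m1
          proof -
            have "rep (Suc d) D I (e(d := i)) rel m1"
              using rep_enter[OF rep_agree[OF rep]] m1 by auto
            note 3 = body(2)[OF this]
            have 4: "triple ((=) m1) c (\<lambda>m. agree (Suc d) m1 m \<and> (m (rg (Suc d)) \<noteq> 0) = \<phi> D I e rel i) (t D)"
              by (rule triple_conseq[OF 3]) (use e 5 assms(2) in \<open>auto simp: less_Suc_eq\<close>)
            have ag: "agree d m0 m" "m (rg d) = i" "m ?a = m1 ?a" if "agree (Suc d) m1 m" for m
              using agree_trans[of d m0 m1 m] agree_Suc[OF that] agree_consts(7,8)[OF that, of d] m1 by auto
            have ex: "(\<exists>x < Suc i. \<phi> D I e rel x) \<longleftrightarrow> (\<exists>x < i. \<phi> D I e rel x) \<or> \<phi> D I e rel i"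
              by (auto simp: less_Suc_eq)
            let ?Q = "\<lambda>m. m 1 = 1 \<and> ?J (Suc i) (m(rg d := m (rg d) + 1))"
            show ?thesis
            proof (rule triple_seq[OF 4], rule triple_ifz, goal_cases)
              case 1
              have "triple (\<lambda>m. (agree (Suc d) m1 m \<and> (m (rg (Suc d)) \<noteq> 0) = \<phi> D I e rel i) \<and> m (rg (Suc d)) = 0)
                (\<lambda>_. []) ?Q (length ([] :: instr list))"
                using m1 d by (intro triple_block) (auto intro!: agree_upd vol_simps simp: ag cs ex)
              then show ?case by (rule triple_conseq) auto
            next
              case 2
              have "triple (\<lambda>m. (agree (Suc d) m1 m \<and> (m (rg (Suc d)) \<noteq> 0) = \<phi> D I e rel i) \<and> m (rg (Suc d)) \<noteq> 0)
                (\<lambda>_. [LoadC ?a 1]) (\<lambda>m. ?Q m \<and> m 2 = 0) (length [LoadC ?a 1])"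
                using m1 d by (intro triple_block) (auto intro!: agree_upd vol_simps simp: ag cs ex)
              then show ?case by simp
            qed
          qed
          then show ?case by (rule triple_start)
        qed (use d in \<open>auto intro!: agree_upd vol_simps simp: cs\<close>)
      next
        case 2
        show ?case using d by (intro triple_block) (auto intro!: agree_upd vol_simps simp: cs)
      qed
    qed
  qed
qed

lemma decides_rel:
  assumes "computes d (\<lambda>D I e. idx D i (e x) (e y))" "1 \<le> i" "x < d" "y < d" "d \<le> 90"
  shows "decides d (\<lambda>D I e rel. (e x, e y) \<in> rel i)"
proof -
  obtain c t where 1: "poly t" "\<And>D I e rel m0. rep d D I e rel m0 \<Longrightarrow>
     triple ((=) m0) c (\<lambda>m. agree d m0 m \<and> m (rg d) = idx D i (e x) (e y)) (t D)"
    by (rule computesD[OF assms(1)]) (rule that)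
  let ?b = "[Add (rg d) 0 (rg d), LoadI (rg d) (rg d)]"
  show ?thesis unfolding decides_def
  proof (intro exI conjI allI impI)
    show "poly (\<lambda>D. t D + length ?b)" by (intro poly_intros 1)
    fix D I e rel m0 assume rep: "rep d D I e rel m0" and e: "\<forall>i < d. e i < D"
    have r: "(0 < m (m 0 + idx D i (e x) (e y))) = ((e x, e y) \<in> rel i)" if "agree d m0 m" for m
      using rep_agree[OF rep that] e assms unfolding rep_def by simp
    show "triple ((=) m0) (seq c (\<lambda>_. ?b)) (\<lambda>m. agree d m0 m \<and> (m (rg d) \<noteq> 0) = ((e x, e y) \<in> rel i))
      (t D + length ?b)"
    proof (rule triple_seq[OF 1(2)[OF rep]], rule triple_block, goal_cases)
      case (2 m)
      have "m 0 \<ge> 3 * low" using rep_agree[OF rep] 2 by (auto simp: rep_def)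
      then have "m 0 + idx D i (e x) (e y) \<noteq> rg d" using \<open>d \<le> 90\<close> by (simp add: low_def)
      then show ?case using 2 assms(5) r by (auto intro!: agree_upd vol_simps)
    qed simp
  qed
qed

lemma computes_idx:
  assumes "x < d" "y < d" "d \<le> 80"
  shows "computes d (\<lambda>D I e. idx D i (e x) (e y))"
  unfolding idx_def using assms
  by (intro computes_add computes_times_D computes_const computes_var) auto

lemmas decides_mem = decides_rel[OF computes_idx]

section \<open>Updates of relations\<close>

lemma updates_comp:
  assumes "updates d F" "updates d G"
  shows "updates d (\<lambda>D I e rel. G D I e (F D I e rel))"
proof -
  obtain c1 t1 where 1: "poly t1" "\<And>D I e rel m0. rep d D I e rel m0 \<Longrightarrow> \<forall>i < d. e i < D \<Longrightarrow>
     triple ((=) m0) c1 (rep d D I e (F D I e rel)) (t1 D)"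
    by (rule updatesD[OF assms(1)]) (rule that)
  obtain c2 t2 where 2: "poly t2" "\<And>D I e rel m0. rep d D I e rel m0 \<Longrightarrow> \<forall>i < d. e i < D \<Longrightarrow>
     triple ((=) m0) c2 (rep d D I e (G D I e rel)) (t2 D)"
    by (rule updatesD[OF assms(2)]) (rule that)
  show ?thesis unfolding updates_def
  proof (intro exI conjI allI impI)
    show "poly (\<lambda>D. t1 D + t2 D)" by (intro poly_intros 1 2)
    fix D I e rel m0 assume rep: "rep d D I e rel m0" and e: "\<forall>i < d. e i < D"
    show "triple ((=) m0) (seq c1 c2) (rep d D I e (G D I e (F D I e rel))) (t1 D + t2 D)"
      by (rule triple_seq[OF 1(2)[OF rep] triple_start[OF 2(2)]]) (use e in auto)
  qed
qed

text \<open>The loop variable is register d; \<open>rep_enter\<close> and \<open>rep_leave\<close>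
  pass between its view as a component of e and as a cell above the current level.\<close>

lemma updates_for:
  assumes "updates (Suc d) (\<lambda>D I e. F D I e (e d))"
    and "\<And>D I e v x. F D I (e(d := v)) x = F D I e x" and d: "d \<le> 80"
  shows "updates d (\<lambda>D I e. fold (F D I e) [0..<D])"
proof -
  obtain c t where 1: "poly t" "\<And>D I e rel m0. rep (Suc d) D I e rel m0 \<Longrightarrow> \<forall>i < Suc d. e i < D \<Longrightarrow>
     triple ((=) m0) c (rep (Suc d) D I e (F D I e (e d) rel)) (t D)"
    by (rule updatesD[OF assms(1)]) (rule that)
  show ?thesis unfolding updates_def
  proof (intro exI conjI allI impI)
    show "poly (\<lambda>D. D * (t D + 4) + 3)" by (intro poly_intros 1)
    fix D I e rel m0 assume rep: "rep d D I e rel m0" and e: "\<forall>i < d. e i < D"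
    let ?J = "\<lambda>i m. rep d D I e (fold (F D I e) [0..<i] rel) m \<and> m (rg d) = i"
    have "triple ((=) m0) (forc (rg d) c) (?J D) (D * (t D + 4) + 3)"
    proof (rule triple_forc[where J = ?J and D = D], goal_cases)
      case (1 i m)
      then show ?case using rep_consts[of d D I e _ m] by auto
    next
      case (2 m)
      have "agree d m0 (m0(rg d := 0))" using d by (intro agree_upd agree_refl vol_simps) simp
      then have "rep d D I e rel (m0(rg d := 0))" by (rule rep_agree[OF rep])
      then show ?case using 2 by simp
    next
      case (3 i m v)
      have "agree d m (m(4 := v))" by (intro agree_upd agree_refl vol_simps)
      with 3 have "rep d D I e (fold (F D I e) [0..<i] rel) (m(4 := v))" using rep_agree by blast
      then show ?case using 3 by simp
    next
      case (5 i)
      show ?case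
      proof (rule triple_start)
        fix m1 assume m1: "?J i m1"
        then have "rep (Suc d) D I (e(d := i)) (fold (F D I e) [0..<i] rel) m1"
          using rep_enter[of d D I e _ m1] by auto
        note 3 = 1(2)[OF this]
        show "triple ((=) m1) c (\<lambda>m. m 1 = 1 \<and> ?J (Suc i) (m(rg d := m (rg d) + 1))) (t D)"
        proof (rule triple_conseq[OF 3])
          show "\<forall>j < Suc d. (e(d := i)) j < D" using e 5 by (auto simp: less_Suc_eq)
        next
          fix m assume "rep (Suc d) D I (e(d := i)) (F D I (e(d := i)) ((e(d := i)) d) (fold (F D I e) [0..<i] rel)) m"
          then have r: "rep d D I e (fold (F D I e) [0..<Suc i] rel) m" "m (rg d) = i"
            using rep_leave[of d D I e i _ m] assms(2) by auto
          have "agree d m (m(rg d := m (rg d) + 1))" using d by (intro agree_upd agree_refl vol_simps) simp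
          then have "rep d D I e (fold (F D I e) [0..<Suc i] rel) (m(rg d := m (rg d) + 1))"
            by (rule rep_agree[OF r(1)])
          then show "m 1 = 1 \<and> ?J (Suc i) (m(rg d := m (rg d) + 1))"
            using rep_consts(1)[OF r(1)] r(2) by simp
        qed auto
      qed
    qed simp
    then show "triple ((=) m0) (forc (rg d) c) (rep d D I e (fold (F D I e) [0..<D] rel)) (D * (t D + 4) + 3)"
      by (rule triple_conseq) auto
  qed
qed

lemma fold_const: "fold (\<lambda>_. f) [0..<n] = f ^^ n"
  by (induction n) auto

lemma updates_iter:
  assumes "updates (Suc d) F" "\<And>D I e v. F D I (e(d := v)) = F D I e" "d \<le> 80"
  shows "updates d (\<lambda>D I e. F D I e ^^ D)"
  using updates_for[of d "\<lambda>D I e x. F D I e"] assms by (simp add: fold_const)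


lemma agree_regs: "d \<le> 90 \<Longrightarrow> agree d m (m(rg d := v))" "d \<le> 90 \<Longrightarrow> agree d m (m(rg (Suc d) := v))"
    "agree d m (m(4 := v))"
  by (intro agree_upd agree_refl vol_simps; simp)+

text \<open>Rule for a double loop: the invariant is indexed by the set of pairs already visited,
  which is why the order of the visits disappears from the result.\<close>

lemma triple_pairs:
  assumes J: "\<And>S m. J S m \<Longrightarrow> m 1 = 1 \<and> m 2 = 0 \<and> m 3 = D"
    and ag: "\<And>S m m'. J S m \<Longrightarrow> agree d m m' \<Longrightarrow> J S m'"
    and body: "\<And>S x y. x < D \<Longrightarrow> y < D \<Longrightarrow> triple (\<lambda>m. J S m \<and> m (rg d) = x \<and> m (rg (Suc d)) = y) body
      (\<lambda>m. J (insert (x, y) S) m \<and> m (rg d) = x \<and> m (rg (Suc d)) = y) t"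
    and d: "d \<le> 80"
  shows "triple (J {}) (forc (rg d) (forc (rg (Suc d)) body)) (J ({..<D} \<times> {..<D}))
    (D * ((D * (t + 4) + 3) + 4) + 3)"
proof -
  let ?A = "\<lambda>x y. {..<x} \<times> {..<D} \<union> {x} \<times> {..<y}"
  let ?J1 = "\<lambda>x m. J ({..<x} \<times> {..<D}) m \<and> m (rg d) = x"
  let ?J2 = "\<lambda>x y m. J (?A x y) m \<and> m (rg d) = x \<and> m (rg (Suc d)) = y"
  have d': "d \<le> 90" using d by simp
  have inner: "triple (?J1 x) (forc (rg (Suc d)) body) (?J2 x D) (D * (t + 4) + 3)" if x: "x < D" for x
  proof (rule triple_forc[where J = "?J2 x" and D = D], goal_cases)
    case (1 i m)
    then show ?case using J by blast
  next
    case (2 m)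
    have "J ({..<x} \<times> {..<D}) (m(rg (Suc d) := 0))" using ag[OF conjunct1[OF 2] agree_regs(2)[OF d']] .
    then show ?case using 2 by simp
  next
    case (3 i m v)
    have "J (?A x i) (m(4 := v))" using ag[OF conjunct1[OF 3] agree_regs(3)] .
    then show ?case using 3 by simp
  next
    case (5 i)
    show ?case
    proof (rule triple_conseq[OF body[OF x 5, of "?A x i"]])
      fix m assume m: "J (insert (x, i) (?A x i)) m \<and> m (rg d) = x \<and> m (rg (Suc d)) = i"
      have "insert (x, i) (?A x i) = ?A x (Suc i)" by (auto simp: less_Suc_eq)
      then have "J (?A x (Suc i)) m" using m by simp
      then have "J (?A x (Suc i)) (m(rg (Suc d) := Suc i))" using ag agree_regs(2)[OF d'] by blast
      then show "m 1 = 1 \<and> ?J2 x (Suc i) (m(rg (Suc d) := m (rg (Suc d)) + 1))"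
        using m J[OF conjunct1[OF m]] by simp
    qed simp_all
  qed simp
  show ?thesis
  proof (rule triple_conseq[OF triple_forc[where J = ?J1 and D = D and P = "J {}" and t = "D * (t + 4) + 3"]], goal_cases)
    case (1 i m)
    then show ?case using J by blast
  next
    case (2 m)
    have "J {} (m(rg d := 0))" using ag[OF 2 agree_regs(1)[OF d']] .
    then show ?case by simp
  next
    case (3 i m v)
    have "J ({..<i} \<times> {..<D}) (m(4 := v))" using ag[OF conjunct1[OF 3] agree_regs(3)] .
    then show ?case using 3 by simp
  next
    case (5 i)
    show ?case
    proof (rule triple_conseq[OF inner[OF 5]])
      fix m assume m: "?J2 i D m"
      have "?A i D = {..<Suc i} \<times> {..<D}" by (auto simp: less_Suc_eq)
      then have "J ({..<Suc i} \<times> {..<D}) m" using m by simp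
      then have "J ({..<Suc i} \<times> {..<D}) (m(rg d := Suc i))" using ag agree_regs(1)[OF d'] by blast
      then show "m 1 = 1 \<and> ?J1 (Suc i) (m(rg d := m (rg d) + 1))"
        using m J[OF conjunct1[OF m]] by simp
    qed simp_all
  qed simp_all
qed

text \<open>\<open>rep\<close> describes tables from number 1 on, so the buffer at place 0 may be
  written without changing the represented relations.\<close>

lemma rep_hidden:
  assumes "rep d D I e rel m" "x < D" "y < D" "d \<le> 90"
  shows "rep d D I e rel (m(m 0 + idx D 0 x y := v))"
proof -
  have "rep d D I e (rel(0 := if v \<noteq> 0 then insert (x, y) (rel 0) else rel 0 - {(x, y)})) (m(m 0 + idx D 0 x y := v))"
    by (rule rep_store[OF assms])
  then show ?thesis unfolding rep_def by simp
qed

text \<open>The formula may read the relation that is being replaced. Therefore all its values are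
  first written to the hidden buffer and copied only afterwards, so the assignment is
  simultaneous.\<close>

lemma updates_assign:
  assumes "decides (Suc (Suc d)) (\<lambda>D I e rel. \<phi> D I e rel (e d) (e (Suc d)))"
    and "\<And>D I e rel v x y. \<phi> D I (e(d := v)) rel x y = \<phi> D I e rel x y"
    and "\<And>D I e rel v x y. \<phi> D I (e(Suc d := v)) rel x y = \<phi> D I e rel x y" and d: "d \<le> 70"
  shows "updates d (\<lambda>D I e rel. rel(i := {(x, y). x < D \<and> y < D \<and> \<phi> D I e rel x y}))"
proof -
  let ?d2 = "Suc (Suc d)" and ?d3 = "Suc (Suc (Suc d))"
  obtain c t where c: "poly t" "\<And>D I e rel m0. rep ?d2 D I e rel m0 \<Longrightarrow> \<forall>i < ?d2. e i < D \<Longrightarrow>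
     triple ((=) m0) c (\<lambda>m. agree ?d2 m0 m \<and>
       (m (rg ?d2) \<noteq> 0) = \<phi> D I e rel (e d) (e (Suc d))) (t D)"
    by (rule decidesD[OF assms(1)]) (rule that)
  have "computes ?d3 (\<lambda>D I e. idx D 0 (e d) (e (Suc d)))" using d by (intro computes_idx) auto
  then obtain a s where a: "poly s" "\<And>D I e rel m0. rep ?d3 D I e rel m0 \<Longrightarrow>
     triple ((=) m0) a (\<lambda>m. agree ?d3 m0 m \<and>
       m (rg ?d3) = idx D 0 (e d) (e (Suc d))) (s D)"
    by (rule computesD) (rule that)
  have "computes ?d3 (\<lambda>D I e. idx D i (e d) (e (Suc d)))" using d by (intro computes_idx) auto
  then obtain b r where b: "poly r" "\<And>D I e rel m0. rep ?d3 D I e rel m0 \<Longrightarrow>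
     triple ((=) m0) b (\<lambda>m. agree ?d3 m0 m \<and>
       m (rg ?d3) = idx D i (e d) (e (Suc d))) (r D)"
    by (rule computesD) (rule that)
  let ?r1 = "rg d" and ?r2 = "rg (Suc d)" and ?r3 = "rg ?d2" and ?r4 = "rg ?d3"
  let ?st = "[Add ?r4 ?r4 0, StoreI ?r4 ?r3]"
  let ?ld = "[Add ?r4 ?r4 0, LoadI ?r3 ?r4]"
  let ?body1 = "seq c (seq a (\<lambda>_. ?st))"
  let ?body2 = "seq a (seq (\<lambda>_. ?ld) (seq b (\<lambda>_. ?st)))"
  let ?t1 = "\<lambda>D. t D + (s D + length ?st)"
  let ?t2 = "\<lambda>D. s D + (length ?ld + (r D + length ?st))"
  show ?thesis unfolding updates_def
  proof (intro exI conjI allI impI)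
    show "poly (\<lambda>D. (D * ((D * (?t1 D + 4) + 3) + 4) + 3) + (D * ((D * (?t2 D + 4) + 3) + 4) + 3))"
      by (intro poly_intros a b c)
    fix D I e rel m0 assume rep: "rep d D I e rel m0" and e: "\<forall>i < d. e i < D"
    let ?e = "\<lambda>x y. e(d := x, Suc d := y)"
    let ?w = "\<lambda>t. D * ((D * (t + 4) + 3) + 4) + 3"
    let ?rep = "\<lambda>x y. rep ?d2 D I (?e x y)"
    let ?P = "\<phi> D I e rel"
    \<comment> \<open>While the buffer is filled, the represented relations stay as they were; S is
      the part of the buffer already filled.\<close>
    let ?J1 = "\<lambda>S m. rep d D I e rel m \<and> (\<forall>(x, y) \<in> S. x < D \<longrightarrow> y < D \<longrightarrow> (m (m 0 + idx D 0 x y) \<noteq> 0) = ?P x y)"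
    \<comment> \<open>During the copying the target is new on S and old elsewhere.\<close>
    let ?rel = "\<lambda>S. rel(i := (rel i - S) \<union> {(x, y) \<in> S. ?P x y})"
    let ?J2 = "\<lambda>S m. rep d D I e (?rel S) m \<and>
      (i \<ge> 1 \<longrightarrow> (\<forall>x < D. \<forall>y < D. (m (m 0 + idx D 0 x y) \<noteq> 0) = ?P x y))"
    have ee: "\<phi> D I (?e x y) rel = ?P" for x y
      using assms(2,3) by (intro ext) simp
    have enter: "?rep x y rl m"
      if "rep d D I e rl m" "m ?r1 = x" "m ?r2 = y" for m x y rl
      using rep_enter[OF rep_enter[OF that(1)]] that(2,3) by simp
    have leave: "rep d D I e rl m" "m ?r1 = x" "m ?r2 = y" if "?rep x y rl m" for m x y rl
      using rep_leave[OF that] rep_leave[of d D I e x rl m] by auto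
    have buf: "m' (m' 0 + k) = m (m 0 + k)" if "agree n m m'" "rep n' D I e' rl m" for m m' n n' e' rl k
    proof -
      have "m 0 + k \<ge> low" using that(2) by (simp add: rep_def low_def)
      then show ?thesis using agree_consts(1,6)[OF that(1)] by simp
    qed
    have bd: "\<forall>j < ?d2. ?e x y j < D" if "x < D" "y < D" for x y
      using e that by (auto simp: less_Suc_eq)
    have phase1: "triple (?J1 {}) (forc ?r1 (forc ?r2 ?body1)) (?J1 ({..<D} \<times> {..<D}))
        (?w (?t1 D))"
    proof (rule triple_pairs[where J = ?J1], goal_cases)
      case (1 S m)
      then show ?case using rep_consts[of d D I e rel m] by blast
    next
      case (2 S m m')
      then show ?case using rep_agree[of d D I e rel m m'] buf[of d m m' d e rel] by simp
    next
      case (3 S x y)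
      show ?case
      proof (rule triple_start)
        fix m1 assume m1: "?J1 S m1 \<and> m1 ?r1 = x \<and> m1 ?r2 = y"
        then have rp1: "?rep x y rel m1" using enter by blast
        show "triple ((=) m1) ?body1 (\<lambda>m. ?J1 (insert (x, y) S) m \<and> m ?r1 = x \<and> m ?r2 = y) (?t1 D)"
        proof (rule triple_seq[OF c(2)[OF rp1 bd[OF 3]]], rule triple_start)
          fix m2 assume "agree ?d2 m1 m2 \<and> (m2 ?r3 \<noteq> 0) = \<phi> D I (?e x y) rel (?e x y d) (?e x y (Suc d))"
          then have m2: "agree ?d2 m1 m2" "(m2 ?r3 \<noteq> 0) = ?P x y" using ee by auto
          have rp2: "?rep x y rel m2" by (rule rep_agree[OF rp1 m2(1)])
          note A = a(2)[OF rep_enter[OF rp2]]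
          show "triple ((=) m2) (seq a (\<lambda>_. ?st))
            (\<lambda>m. ?J1 (insert (x, y) S) m \<and> m ?r1 = x \<and> m ?r2 = y) (s D + length ?st)"
          proof (rule triple_seq[OF A], rule triple_block, goal_cases)
            case (2 m3)
            then have m3: "agree ?d3 m2 m3" "m3 ?r4 = idx D 0 x y" by auto
            have v: "(m3 ?r3 \<noteq> 0) = ?P x y" using agree_consts(7)[OF m3(1), of "?d2"] m2(2) by simp
            have ag: "agree ?d2 m1 m3" using agree_trans[OF m2(1) agree_Suc[OF m3(1)]] .
            have rp3: "?rep x y rel m3" by (rule rep_agree[OF rp1 ag])
            let ?m4 = "m3(?r4 := idx D 0 x y + m3 0)"
            have ag4: "agree ?d2 m3 ?m4" using d by (intro agree_regs) simp
            have rp4: "?rep x y rel ?m4" by (rule rep_agree[OF rp3 ag4])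
            let ?m5 = "?m4(m3 0 + idx D 0 x y := m3 ?r3)"
            have "?rep x y rel (?m4(?m4 0 + idx D 0 x y := m3 ?r3))"
              by (rule rep_hidden[OF rp4 3]) (use d in simp)
            then have rp5: "?rep x y rel ?m5" by simp
            have eq: "fold upd ?st m3 = ?m5" using m3(2) by (simp add: add.commute)
            have "m3 0 > 0" using rp3 by (simp add: rep_def low_def)
            then have m50: "?m5 0 = m3 0" by auto
            have "(?m5 (?m5 0 + idx D 0 x' y') \<noteq> 0) = ?P x' y'"
              if "(x', y') \<in> insert (x, y) S" "x' < D" "y' < D" for x' y'
            proof (cases "(x', y') = (x, y)")
              case True
              then show ?thesis unfolding m50 using v by simp
            next
              case False
              then have ne: "idx D 0 x' y' \<noteq> idx D 0 x y" using idx_inject(2,3)[OF that(2,3) 3] by auto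
              have "(m1 (m1 0 + idx D 0 x' y') \<noteq> 0) = ?P x' y'" using m1 that False by auto
              moreover have "m3 (m3 0 + idx D 0 x' y') = m1 (m1 0 + idx D 0 x' y')"
                by (rule buf[OF ag rp1])
              moreover have "?m4 (m3 0 + idx D 0 x' y') = m3 (m3 0 + idx D 0 x' y')"
                using buf[OF ag4 rp3, of "idx D 0 x' y'"] by simp
              moreover have "?m5 (m3 0 + idx D 0 x' y') = ?m4 (m3 0 + idx D 0 x' y')" using ne by simp
              ultimately show ?thesis unfolding m50 by metis
            qed
            then show ?case unfolding eq using leave[OF rp5] by blast
          qed simp
        qed
      qed
    qed (use d in simp)
    have phase2: "triple (?J2 {}) (forc ?r1 (forc ?r2 ?body2)) (?J2 ({..<D} \<times> {..<D}))
        (?w (?t2 D))"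
    proof (rule triple_pairs[where J = ?J2], goal_cases)
      case (1 S m)
      then show ?case using rep_consts[of d D I e "?rel S" m] by blast
    next
      case (2 S m m')
      then show ?case using rep_agree[of d D I e "?rel S" m m'] buf[of d m m' d e "?rel S"] by simp
    next
      case (3 S x y)
      show ?case
      proof (rule triple_start)
        fix m1 assume m1: "?J2 S m1 \<and> m1 ?r1 = x \<and> m1 ?r2 = y"
        then have rp1: "?rep x y (?rel S) m1" using enter by blast
        note A = a(2)[OF rep_enter[OF rp1]]
        show "triple ((=) m1) ?body2 (\<lambda>m. ?J2 (insert (x, y) S) m \<and> m ?r1 = x \<and> m ?r2 = y) (?t2 D)"
        proof (rule triple_seq[OF A], rule triple_seq[where
              Q = "\<lambda>m. agree ?d2 m1 m \<and> m ?r3 = m1 (m1 0 + idx D 0 x y)"], goal_cases)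
          case 1
          show ?case
          proof (rule triple_block, goal_cases)
            case (2 m)
            then have m: "agree ?d3 m1 m" "m ?r4 = idx D 0 x y" by auto
            have "m (m 0 + idx D 0 x y) = m1 (m1 0 + idx D 0 x y)" by (rule buf[OF m(1) rp1])
            moreover have "m 0 + idx D 0 x y \<noteq> ?r4" using rep_agree[OF rp1 agree_Suc[OF m(1)]] d
              by (simp add: rep_def low_def)
            ultimately show ?case using m(2) agree_Suc[OF m(1)] d
              by (auto simp: add.commute vol_def low_def intro!: agree_upd)
          qed simp
        next
          case 2
          show ?case
          proof (rule triple_start)
            fix m2 assume m2: "agree ?d2 m1 m2 \<and> m2 ?r3 = m1 (m1 0 + idx D 0 x y)"
            then have rp2: "?rep x y (?rel S) m2" using rep_agree[OF rp1] by blast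
            note B = b(2)[OF rep_enter[OF rp2]]
            show "triple ((=) m2) (seq b (\<lambda>_. ?st))
              (\<lambda>m. ?J2 (insert (x, y) S) m \<and> m ?r1 = x \<and> m ?r2 = y) (r D + length ?st)"
            proof (rule triple_seq[OF B], rule triple_block, goal_cases)
              case (2 m3)
              then have m3: "agree ?d3 m2 m3" "m3 ?r4 = idx D i x y" by auto
              have v: "m3 ?r3 = m1 (m1 0 + idx D 0 x y)"
                using agree_consts(7)[OF m3(1), of "?d2"] m2 by simp
              have ag: "agree ?d2 m1 m3" using agree_trans[OF conjunct1[OF m2] agree_Suc[OF m3(1)]] .
              have rp3: "?rep x y (?rel S) m3" by (rule rep_agree[OF rp1 ag])
              let ?m4 = "m3(?r4 := idx D i x y + m3 0)"
              have ag4: "agree ?d2 m3 ?m4" using d by (intro agree_regs) simp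
              have rp4: "?rep x y (?rel S) ?m4" by (rule rep_agree[OF rp3 ag4])
              let ?m5 = "?m4(m3 0 + idx D i x y := m3 ?r3)"
              let ?rl = "(?rel S)(i := if m3 ?r3 \<noteq> 0 then insert (x, y) (?rel S i) else ?rel S i - {(x, y)})"
              have "?rep x y ?rl (?m4(?m4 0 + idx D i x y := m3 ?r3))"
                by (rule rep_store[OF rp4 3]) (use d in simp)
              then have rp5: "?rep x y ?rl ?m5" by simp
              have eq: "fold upd ?st m3 = ?m5" using m3(2) by (simp add: add.commute)
              have "m3 0 > 0" using rp3 by (simp add: rep_def low_def)
              then have m50: "?m5 0 = m3 0" by auto
              show ?case
              proof (cases "i \<ge> 1")
                case True
                have "(m3 ?r3 \<noteq> 0) = ?P x y" unfolding v using m1 True 3 by blast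
                then have "?rl = ?rel (insert (x, y) S)" by (auto simp: fun_eq_iff)
                then have rp5': "?rep x y (?rel (insert (x, y) S)) ?m5" using rp5 by simp
                have same: "?m5 (?m5 0 + idx D 0 x' y') = m1 (m1 0 + idx D 0 x' y')"
                  if "x' < D" "y' < D" for x' y'
                proof -
                  have ne: "idx D 0 x' y' \<noteq> idx D i x y" using idx_inject(1)[OF that 3, of 0 i] True by auto
                  have "m3 (m3 0 + idx D 0 x' y') = m1 (m1 0 + idx D 0 x' y')"
                    by (rule buf[OF ag rp1])
                  moreover have "?m4 (m3 0 + idx D 0 x' y') = m3 (m3 0 + idx D 0 x' y')"
                    using buf[OF ag4 rp3, of "idx D 0 x' y'"] by simp
                  moreover have "?m5 (m3 0 + idx D 0 x' y') = ?m4 (m3 0 + idx D 0 x' y')" using ne by simp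
                  ultimately show ?thesis unfolding m50 by metis
                qed
                have "(?m5 (?m5 0 + idx D 0 x' y') \<noteq> 0) = ?P x' y'" if "x' < D" "y' < D" for x' y'
                  unfolding same[OF that] using m1 True that by blast
                then show ?thesis unfolding eq using leave[OF rp5'] by blast
              next
                \<comment> \<open>For i = 0 the target is the buffer itself, of which
                  \<open>rep\<close> says nothing.\<close>
                case False
                then have "?rep x y (?rel (insert (x, y) S)) ?m5"
                  using rp5 unfolding rep_def by simp
                then show ?thesis unfolding eq using leave[of x y _ ?m5] False by blast
              qed
            qed simp
          qed
        qed
      qed
    qed (use d in simp)
    show "triple ((=) m0) (seq (forc ?r1 (forc ?r2 ?body1)) (forc ?r1 (forc ?r2 ?body2)))
      (rep d D I e (rel(i := {(x, y). x < D \<and> y < D \<and> ?P x y})))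
      ((?w (?t1 D)) + (?w (?t2 D)))"
    proof (rule triple_seq[where Q = "?J2 {}"])
      show "triple ((=) m0) (forc ?r1 (forc ?r2 ?body1)) (?J2 {}) (?w (?t1 D))"
        by (rule triple_conseq[OF phase1]) (use rep in auto)
      show "triple (?J2 {}) (forc ?r1 (forc ?r2 ?body2))
        (rep d D I e (rel(i := {(x, y). x < D \<and> y < D \<and> ?P x y}))) (?w (?t2 D))"
        by (rule triple_conseq[OF phase2]) (auto elim!: rep_rel_cong)
    qed
  qed
qed

section \<open>The saturation algorithm\<close>

lemma funpow_stable:
  assumes "\<And>x. P x \<Longrightarrow> P (f x) \<and> (f x = x \<or> \<mu> x < (\<mu> (f x) :: nat)) \<and> \<mu> x \<le> n" "P x"
  shows "f ((f ^^ n) x) = (f ^^ n) x"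
proof -
  have P: "P ((f ^^ k) x)" for k using assms by (induction k) auto
  \<comment> \<open>Each step before stabilisation raises the measure, so an iteration still
    unstable after n steps would exceed the bound n.\<close>
  have "f ((f ^^ k) x) = (f ^^ k) x \<or> k \<le> \<mu> ((f ^^ k) x)" for k
  proof (induction k)
    case (Suc k)
    then show ?case using assms(1)[OF P[of k]] by auto
  qed simp
  moreover have "f ((f ^^ n) x) = (f ^^ n) x \<or> \<mu> ((f ^^ n) x) < \<mu> ((f ^^ Suc n) x)"
    using assms(1)[OF P[of n]] by simp
  moreover have "\<mu> ((f ^^ Suc n) x) \<le> n" using assms(1)[OF P] by blast
  ultimately show ?thesis by fastforce
qed

lemma saturate:
  assumes "finite X" "card X \<le> n" "V0 \<subseteq> X" "\<And>V. V \<subseteq> X \<Longrightarrow> V \<subseteq> f V \<and> f V \<subseteq> X"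
  shows "f ((f ^^ n) V0) = (f ^^ n) V0"
proof (rule funpow_stable[where P = "\<lambda>V. V \<subseteq> X" and \<mu> = card])
  fix V assume V: "V \<subseteq> X"
  have "finite (f V)" using finite_subset[OF conjunct2[OF assms(4)[OF V]] assms(1)] .
  then have "f V = V \<or> card V < card (f V)"
    using assms(4)[OF V] psubset_card_mono[of "f V" V] by (cases "f V = V") auto
  moreover have "card V \<le> n" using card_mono[OF assms(1) V] assms(2) by simp
  ultimately show "f V \<subseteq> X \<and> (f V = V \<or> card V < card (f V)) \<and> card V \<le> n" using assms(4)[OF V] by blast
qed (rule assms(3))

text \<open>One round acts on all tables, so the next set of pairs need not be a function of the
  current set alone, and a fixed-point lemma for set functions does not fit. Lower and upper bounds
  for each round suffice: a round that adds nothing shows closure under E.\<close>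

lemma closure_sequence:
  assumes "finite X" "card X \<le> n" "E\<^sup>* `` V 0 \<subseteq> X"
    and step: "\<And>i. V i \<subseteq> X \<Longrightarrow> V i \<union> E `` V i \<subseteq> V (Suc i) \<and> V (Suc i) \<subseteq> E\<^sup>* `` V i"
  shows "V n = E\<^sup>* `` V 0"
proof -
  let ?C = "E\<^sup>* `` V 0"
  have idem: "E\<^sup>* `` ?C = ?C" by (auto intro: rtrancl_trans)
  have sub: "V 0 \<subseteq> V k \<and> V k \<subseteq> ?C" for k
  proof (induction k)
    case (Suc k)
    then have "V k \<subseteq> X" using assms(3) by blast
    have "E\<^sup>* `` V k \<subseteq> E\<^sup>* `` ?C" using Suc by blast
    then show ?case using step[OF \<open>V k \<subseteq> X\<close>] Suc unfolding idem by blast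
  qed auto
  then have X: "V k \<subseteq> X" for k using assms(3) by blast
  have "k \<le> card (V k) \<or> V k = ?C" for k
  proof (induction k)
    case (Suc k)
    consider "V k = ?C" | "V (Suc k) = V k" | "V k \<subset> V (Suc k)" using step[OF X] by blast
    then show ?case
    proof cases
      case 1
      then show ?thesis using step[OF X[of k]] sub[of "Suc k"] by blast
    next
      case 2
      then have "E `` V k \<subseteq> V k" using step[OF X[of k]] by blast
      then have "E\<^sup>* `` V k = V k" by (rule Image_closed_trancl)
      then have "?C \<subseteq> V k" using sub[of k] by blast
      then show ?thesis using sub[of k] 2 by blast
    next
      case 3
      then have "card (V k) < card (V (Suc k))"
        using psubset_card_mono[of "V (Suc k)"] finite_subset[OF X assms(1)] by blast
      moreover have "V (Suc k) = ?C" if "V k = ?C" using that 3 sub[of "Suc k"] by blast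
      ultimately show ?thesis using Suc by linarith
    qed
  qed simp
  then consider "V n = ?C" | "n \<le> card (V n)" by blast
  then show ?thesis
  proof cases
    case 2
    then have "V n = X" using card_seteq[OF assms(1) X] assms(2) by simp
    then show ?thesis using sub[of n] assms(3) by blast
  qed
qed

lemma saturate_down:
  assumes "finite X" "card X \<le> n" "V0 \<subseteq> X" "\<And>V. V \<subseteq> X \<Longrightarrow> f V \<subseteq> V"
  shows "f ((f ^^ n) V0) = (f ^^ n) V0"
proof (rule funpow_stable[where P = "\<lambda>V. V \<subseteq> X" and \<mu> = "\<lambda>V. card (X - V)"])
  fix V assume V: "V \<subseteq> X"
  have "f V = V \<or> X - V \<subset> X - f V" using assms(4)[OF V] V by blast
  then have "f V = V \<or> card (X - V) < card (X - f V)"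
    using psubset_card_mono[of "X - f V" "X - V"] assms(1) by blast
  moreover have "card (X - V) \<le> n" using card_mono[of X "X - V"] assms(1,2) by simp
  ultimately show "f V \<subseteq> X \<and> (f V = V \<or> card (X - V) < card (X - f V)) \<and> card (X - V) \<le> n"
    using assms(4)[OF V] V by blast
qed (rule assms(3))

section \<open>Operations of the saturation\<close>

type_synonym trans_pred = "nat \<Rightarrow> nat \<Rightarrow> nat \<Rightarrow> bool"

text \<open>Relation 1 holds a set of letters on its diagonal, relations 2 and 3 hold reachability in
  the two automata through these letters, and relation 4 the reached pairs of states.\<close>

definition init_reach :: "nat \<Rightarrow> nat \<Rightarrow> rels \<Rightarrow> rels" where
  "init_reach D q rel = rel(q := {(x, y). x < D \<and> y < D \<and> x = y})"

definition step_reach :: "nat \<Rightarrow> trans_pred \<Rightarrow> nat \<Rightarrow> rels \<Rightarrow> rels" where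
  "step_reach D T q rel = rel(q := {(x, y). x < D \<and> y < D \<and> ((x, y) \<in> rel q \<or>
     (\<exists>z < D. \<exists>a < D. (x, z) \<in> rel q \<and> (a, a) \<in> rel 1 \<and> T z a y))})"

text \<open>A relation on {..<D} can grow at most D * D times. Loops run D times, so this many
  rounds take two nested iterations; the same holds for \<open>main\<close>.\<close>

definition reach :: "nat \<Rightarrow> trans_pred \<Rightarrow> nat \<Rightarrow> rels \<Rightarrow> rels" where
  "reach D T q rel = ((step_reach D T q ^^ D) ^^ D) (init_reach D q rel)"

text \<open>The formula \<open>0 < 1\<close> expresses truth by means of the available
  comparison.\<close>

definition all_letters :: "nat \<Rightarrow> rels \<Rightarrow> rels" where
  "all_letters D rel = rel(1 := {(x, y). x < D \<and> y < D \<and> (0 :: nat) < 1})"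

definition loop :: "nat \<Rightarrow> trans_pred \<Rightarrow> (nat \<times> nat) set \<Rightarrow> nat \<Rightarrow> nat \<Rightarrow> bool" where
  "loop D T S r a \<longleftrightarrow> (\<exists>x < D. \<exists>y < D. (r, x) \<in> S \<and> T x a y \<and> (y, r) \<in> S)"

definition filter_letters :: "nat \<Rightarrow> trans_pred \<Rightarrow> trans_pred \<Rightarrow> nat \<Rightarrow> nat \<Rightarrow> rels \<Rightarrow> rels" where
  "filter_letters D T1 T2 r1 r2 rel = rel(1 := {(x, y). x < D \<and> y < D \<and>
     ((x, y) \<in> rel 1 \<and> loop D T1 (rel 2) r1 x \<and> loop D T2 (rel 3) r2 x)})"

definition both_reach :: "nat \<Rightarrow> trans_pred \<Rightarrow> trans_pred \<Rightarrow> rels \<Rightarrow> rels" where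
  "both_reach D T1 T2 rel = reach D T2 3 (reach D T1 2 rel)"

definition round :: "nat \<Rightarrow> trans_pred \<Rightarrow> trans_pred \<Rightarrow> nat \<Rightarrow> nat \<Rightarrow> rels \<Rightarrow> rels" where
  "round D T1 T2 r1 r2 rel = filter_letters D T1 T2 r1 r2 (both_reach D T1 T2 rel)"

definition add_star :: "nat \<Rightarrow> nat \<Rightarrow> nat \<Rightarrow> rels \<Rightarrow> rels" where
  "add_star D r1 r2 rel = rel(4 := {(x, y). x < D \<and> y < D \<and> ((x, y) \<in> rel 4 \<or>
     (\<exists>p1 < D. \<exists>p2 < D. (p1, p2) \<in> rel 4 \<and> (p1, r1) \<in> rel 2 \<and> (p2, r2) \<in> rel 3 \<and>
       (r1, x) \<in> rel 2 \<and> (r2, y) \<in> rel 3))})"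

text \<open>At most D letters can be removed, so D rounds reach the greatest set. The reachability
  tables are then recomputed, since the last filtering may have changed the letters after they were
  filled.\<close>

definition inner :: "nat \<Rightarrow> trans_pred \<Rightarrow> trans_pred \<Rightarrow> nat \<Rightarrow> nat \<Rightarrow> rels \<Rightarrow> rels" where
  "inner D T1 T2 r1 r2 rel =
     add_star D r1 r2 (both_reach D T1 T2 ((round D T1 T2 r1 r2 ^^ D) (all_letters D rel)))"

definition add_letter :: "nat \<Rightarrow> trans_pred \<Rightarrow> trans_pred \<Rightarrow> rels \<Rightarrow> rels" where
  "add_letter D T1 T2 rel = rel(4 := {(x, y). x < D \<and> y < D \<and> ((x, y) \<in> rel 4 \<or>
     (\<exists>p1 < D. \<exists>p2 < D. \<exists>a < D. (p1, p2) \<in> rel 4 \<and> T1 p1 a x \<and> T2 p2 a y))})"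

definition outer :: "nat \<Rightarrow> trans_pred \<Rightarrow> trans_pred \<Rightarrow> rels \<Rightarrow> rels" where
  "outer D T1 T2 rel =
     add_letter D T1 T2 (fold (\<lambda>r1. fold (\<lambda>r2. inner D T1 T2 r1 r2) [0..<D]) [0..<D] rel)"

definition init_pairs :: "nat \<Rightarrow> (nat \<Rightarrow> bool) \<Rightarrow> (nat \<Rightarrow> bool) \<Rightarrow> rels \<Rightarrow> rels" where
  "init_pairs D I1 I2 rel = rel(4 := {(x, y). x < D \<and> y < D \<and> (I1 x \<and> I2 y)})"

definition main :: "nat \<Rightarrow> trans_pred \<Rightarrow> trans_pred \<Rightarrow> (nat \<Rightarrow> bool) \<Rightarrow> (nat \<Rightarrow> bool) \<Rightarrow> rels \<Rightarrow> rels" where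
  "main D T1 T2 I1 I2 rel = ((outer D T1 T2 ^^ D) ^^ D) (init_pairs D I1 I2 rel)"

definition edges :: "trans_pred \<Rightarrow> nat set \<Rightarrow> (nat \<times> nat) set" where
  "edges T B = {(x, y). \<exists>a \<in> B. T x a y}"

definition box :: "nat \<Rightarrow> (nat \<times> nat) set" where
  "box D = {..<D} \<times> {..<D}"

lemma finite_box: "finite (box D)" and card_box: "card (box D) = D * D"
  by (simp_all add: box_def)

definition diag :: "nat \<Rightarrow> (nat \<times> nat) set \<Rightarrow> nat set" where
  "diag D S = {a. a < D \<and> (a, a) \<in> S}"

lemma funpow_other:
  fixes f :: "rels \<Rightarrow> rels"
  assumes "\<And>rel. f rel j = rel j"
  shows "(f ^^ n) rel j = rel j"
  using assms by (induction n) auto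

lemma funpow_square: "(f ^^ n) ^^ n = f ^^ (n * n)" for f :: "'a \<Rightarrow> 'a"
  by (simp add: funpow_mult)

lemma reach_other: "j \<noteq> q \<Longrightarrow> reach D T q rel j = rel j"
  unfolding reach_def funpow_square
  by (subst funpow_other) (simp_all add: step_reach_def init_reach_def)

text \<open>The letters in relation 1 stay fixed while relation q grows, so the iteration acts on
  relation q as the set function g, to which \<open>saturate\<close> applies.\<close>

lemma reach_self:
  assumes T: "\<And>x a y. T x a y \<Longrightarrow> x < D \<and> y < D" and "q \<noteq> 1"
  shows "reach D T q rel q = (edges T (diag D (rel 1)))\<^sup>* \<inter> box D"
proof -
  let ?E = "edges T (diag D (rel 1))"
  define g where "g S = {(x, y). x < D \<and> y < D \<and> ((x, y) \<in> S \<or> (\<exists>z < D. (x, z) \<in> S \<and> (z, y) \<in> ?E))}" for S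
  have step: "((step_reach D T q ^^ n) rel') q = (g ^^ n) (rel' q) \<and> ((step_reach D T q ^^ n) rel') 1 = rel 1"
    if "rel' 1 = rel 1" for n rel'
  proof (induction n)
    case (Suc n)
    then show ?case using \<open>q \<noteq> 1\<close>
      by (auto simp: step_reach_def g_def edges_def diag_def)
  qed (use that in simp)
  let ?I = "{(x, y). x < D \<and> y < D \<and> x = y}"
  let ?S = "(g ^^ (D * D)) ?I"
  have eq: "reach D T q rel q = ?S"
    unfolding reach_def funpow_square
    using step[of "init_reach D q rel" "D * D"] \<open>q \<noteq> 1\<close> by (simp add: init_reach_def)
  have fixed: "g ?S = ?S"
    by (rule saturate[OF finite_box[of D]]) (auto simp: card_box box_def g_def)
  have sub: "(g ^^ n) ?I \<subseteq> ?E\<^sup>* \<inter> box D" for n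
  proof (induction n)
    case (Suc n)
    have "g S \<subseteq> ?E\<^sup>* \<inter> box D" if "S \<subseteq> ?E\<^sup>* \<inter> box D" for S
      using that unfolding g_def box_def by (auto intro: rtrancl_into_rtrancl)
    then show ?case using Suc by simp
  qed (auto simp: box_def)
  have "?I \<subseteq> (g ^^ n) ?I" for n
  proof (induction n)
    case (Suc n)
    have "(g ^^ n) ?I \<subseteq> g ((g ^^ n) ?I)" using sub[of n] unfolding g_def box_def by auto
    then show ?case using Suc by auto
  qed simp
  then have refl: "(x, x) \<in> ?S" if "x < D" for x using that by blast
  have "(x, y) \<in> ?S" if "(x, y) \<in> ?E\<^sup>*" "x < D" for x y
    using that(1)
  proof (induction rule: rtrancl_induct)
    case base
    then show ?case using refl that by blast
  next
    case (step y z)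
    have "y < D \<and> z < D" using step.hyps(2) T by (auto simp: edges_def)
    then have "(x, z) \<in> g ?S" using step \<open>x < D\<close> unfolding g_def by blast
    then show ?case unfolding fixed .
  qed
  then show ?thesis unfolding eq using sub[of "D * D"] by (auto simp: box_def)
qed

lemma edges_mono: "B \<subseteq> C \<Longrightarrow> edges T B \<subseteq> edges T C"
  by (auto simp: edges_def)

lemma loop_mono: "loop D T S r a \<Longrightarrow> S \<subseteq> S' \<Longrightarrow> loop D T S' r a"
  unfolding loop_def by blast

section \<open>Correctness of the saturation\<close>

locale automata_pair =
  fixes D :: nat and T1 T2 :: trans_pred and L1 L2 :: "(nat \<times> nat \<times> nat) list"
  assumes T1: "T1 x a y \<longleftrightarrow> (x, a, y) \<in> set L1" and T2: "T2 x a y \<longleftrightarrow> (x, a, y) \<in> set L2"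
    and bound1: "(x, a, y) \<in> set L1 \<Longrightarrow> x < D \<and> a < D \<and> y < D"
    and bound2: "(x, a, y) \<in> set L2 \<Longrightarrow> x < D \<and> a < D \<and> y < D"
begin

lemma T_bounds: "T1 x a y \<Longrightarrow> x < D \<and> y < D" "T2 x a y \<Longrightarrow> x < D \<and> y < D"
  using T1 T2 bound1 bound2 by blast+

definition clo1 :: "nat set \<Rightarrow> (nat \<times> nat) set" where
  "clo1 B = (edges T1 B)\<^sup>* \<inter> box D"

definition clo2 :: "nat set \<Rightarrow> (nat \<times> nat) set" where
  "clo2 B = (edges T2 B)\<^sup>* \<inter> box D"

definition shrink :: "nat \<Rightarrow> nat \<Rightarrow> nat set \<Rightarrow> nat set" where
  "shrink r1 r2 B = {a \<in> B. loop D T1 (clo1 B) r1 a \<and> loop D T2 (clo2 B) r2 a}"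

text \<open>Greatest fixed point of \<open>shrink\<close> by descending iteration from the full set:
  the largest B such that in each automaton every letter of B lies on a cycle through the given
  state within B.\<close>

definition common :: "nat \<Rightarrow> nat \<Rightarrow> nat set" where
  "common r1 r2 = (shrink r1 r2 ^^ D) {..<D}"

lemma clo_mono: "B \<subseteq> C \<Longrightarrow> clo1 B \<subseteq> clo1 C" "B \<subseteq> C \<Longrightarrow> clo2 B \<subseteq> clo2 C"
  unfolding clo1_def clo2_def using rtrancl_mono[OF edges_mono] by blast+

lemma both_reach:
  "both_reach D T1 T2 rel 1 = rel 1" "both_reach D T1 T2 rel 4 = rel 4"
  "both_reach D T1 T2 rel 2 = clo1 (diag D (rel 1))" "both_reach D T1 T2 rel 3 = clo2 (diag D (rel 1))"
  unfolding both_reach_def clo1_def clo2_def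
  by (simp_all add: reach_other reach_self T_bounds)

lemma round:
  "diag D (round D T1 T2 r1 r2 rel 1) = shrink r1 r2 (diag D (rel 1))" "round D T1 T2 r1 r2 rel 4 = rel 4"
  unfolding round_def filter_letters_def fun_upd_apply both_reach
  by (auto simp: diag_def shrink_def)

lemma rounds:
  "diag D ((round D T1 T2 r1 r2 ^^ n) rel 1) = (shrink r1 r2 ^^ n) (diag D (rel 1))"
  "(round D T1 T2 r1 r2 ^^ n) rel 4 = rel 4"
  by (induction n) (simp_all add: round del: One_nat_def)

lemma common_fixed: "shrink r1 r2 (common r1 r2) = common r1 r2"
  unfolding common_def by (rule saturate_down[of "{..<D}"]) (auto simp: shrink_def)

text \<open>\<open>shrink\<close> is monotone, since more letters give more reachability; a set
  contained in its own image therefore stays inside every iterate.\<close>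

lemma common_greatest:
  assumes "B \<subseteq> {..<D}" "B \<subseteq> shrink r1 r2 B"
  shows "B \<subseteq> common r1 r2"
proof -
  have "B \<subseteq> (shrink r1 r2 ^^ n) {..<D}" for n
  proof (induction n)
    case (Suc n)
    have "shrink r1 r2 B \<subseteq> shrink r1 r2 C" if "B \<subseteq> C" for C
      using that clo_mono[OF that] loop_mono unfolding shrink_def by blast
    then show ?case using Suc assms(2) by (simp del: subset_iff) blast
  qed (use assms in simp)
  then show ?thesis by (simp add: common_def)
qed

definition star :: "nat \<Rightarrow> nat \<Rightarrow> ((nat \<times> nat) \<times> (nat \<times> nat)) set" where
  "star r1 r2 = {((p1, p2), (x, y)). let B = common r1 r2 in
     (p1, r1) \<in> clo1 B \<and> (p2, r2) \<in> clo2 B \<and> (r1, x) \<in> clo1 B \<and> (r2, y) \<in> clo2 B}"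

lemma inner:
  fixes rel :: rels
  assumes "rel 4 \<subseteq> box D"
  shows "inner D T1 T2 r1 r2 rel 4 = rel 4 \<union> star r1 r2 `` rel 4"
proof -
  have d: "diag D (all_letters D rel 1) = {..<D}" by (auto simp: diag_def all_letters_def)
  show ?thesis
    unfolding inner_def add_star_def fun_upd_same both_reach rounds d common_def[symmetric]
    using assms by (auto simp: all_letters_def star_def Let_def box_def clo1_def clo2_def)
qed

lemma path_edges:
  assumes "path L p w q" "set w \<subseteq> B" "\<And>x a y. T x a y \<longleftrightarrow> (x, a, y) \<in> set L"
  shows "(p, q) \<in> (edges T B)\<^sup>*"
  using assms(1,2)
proof (induction w arbitrary: p)
  case (Cons a w)
  then obtain r where "(p, a, r) \<in> set L" "path L r w q" by auto
  then have "(p, r) \<in> edges T B" "(r, q) \<in> (edges T B)\<^sup>*"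
    using Cons assms(3) by (auto simp: edges_def)
  then show ?case by (rule converse_rtrancl_into_rtrancl)
qed simp

lemma edges_path:
  assumes "(p, q) \<in> (edges T B)\<^sup>*" "\<And>x a y. T x a y \<longleftrightarrow> (x, a, y) \<in> set L"
  shows "\<exists>w. path L p w q \<and> set w \<subseteq> B"
  using assms(1)
proof (induction rule: rtrancl_induct)
  case base
  show ?case by (intro exI[of _ "[]"]) simp
next
  case (step q r)
  then obtain w a where "path L p w q" "set w \<subseteq> B" "a \<in> B" "(q, a, r) \<in> set L"
    using assms(2) by (auto simp: edges_def)
  then show ?case by (intro exI[of _ "w @ [a]"]) (auto simp: path_append)
qed

lemma conn_loop:
  assumes "conn L B p r q" "\<And>x a y. T x a y \<longleftrightarrow> (x, a, y) \<in> set L"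
    and bound: "\<And>x a y. (x, a, y) \<in> set L \<Longrightarrow> x < D \<and> a < D \<and> y < D" and "p < D"
  shows "(p, r) \<in> (edges T B)\<^sup>* \<inter> box D" "(r, q) \<in> (edges T B)\<^sup>* \<inter> box D"
    "a \<in> B \<Longrightarrow> loop D T ((edges T B)\<^sup>* \<inter> box D) r a" "B \<subseteq> {..<D}"
proof -
  obtain x y z where xyz: "path L p x r" "path L r y r" "path L r z q"
     "set x \<subseteq> B" "set y = B" "set z \<subseteq> B" using assms(1) unfolding conn_def by blast
  have lt: "q' < D" if "path L p' w q'" "p' < D" for p' w q'
    using path_less[OF that] bound by blast
  have r: "r < D" "q < D" using lt[OF xyz(1) \<open>p < D\<close>] lt[OF xyz(3)] by blast+
  show "(p, r) \<in> (edges T B)\<^sup>* \<inter> box D" "(r, q) \<in> (edges T B)\<^sup>* \<inter> box D"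
    using path_edges[OF xyz(1,4) assms(2)] path_edges[OF xyz(3,6) assms(2)] r \<open>p < D\<close> by (auto simp: box_def)
  have "set y \<subseteq> {..<D}" using path_labels[OF xyz(2)] bound unfolding lists_eq_set by blast
  then show "B \<subseteq> {..<D}" using xyz(5) by simp
  show "loop D T ((edges T B)\<^sup>* \<inter> box D) r a" if a: "a \<in> B"
  proof -
    obtain u v where y: "y = u @ a # v" using split_list[of a y] a xyz(5) by blast
    then obtain s t where st: "path L r u s" "(s, a, t) \<in> set L" "path L t v r"
      using xyz(2) by (auto simp: path_append)
    have uv: "set u \<subseteq> B" "set v \<subseteq> B" using y xyz(5) by auto
    note path_edges[OF st(1) uv(1) assms(2)] path_edges[OF st(3) uv(2) assms(2)]
    moreover have "T s a t" "s < D" "t < D" using st(2) bound assms(2) by blast+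
    ultimately show ?thesis using r unfolding loop_def box_def by blast
  qed
qed

text \<open>Separate cycles through r, one per letter of B, are concatenated into a single loop that
  reads all of B; finiteness of B makes this possible.\<close>

lemma loop_conn:
  assumes "(p, r) \<in> (edges T B)\<^sup>*" "(r, q) \<in> (edges T B)\<^sup>*" "finite B"
    and T: "\<And>x a y. T x a y \<longleftrightarrow> (x, a, y) \<in> set L"
    and loop: "\<And>a. a \<in> B \<Longrightarrow> loop D T ((edges T B)\<^sup>* \<inter> box D) r a"
  shows "conn L B p r q"
proof -
  have "\<exists>y. path L r y r \<and> C \<subseteq> set y \<and> set y \<subseteq> B" if "finite C" "C \<subseteq> B" for C
    using that
  proof (induction C)
    case empty
    show ?case by (intro exI[of _ "[]"]) simp
  next
    case (insert a C)
    then obtain y where y: "path L r y r" "C \<subseteq> set y" "set y \<subseteq> B" by auto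
    obtain s t where st: "(r, s) \<in> (edges T B)\<^sup>*" "T s a t" "(t, r) \<in> (edges T B)\<^sup>*"
      using loop[of a] insert.prems unfolding loop_def by blast
    obtain u where u: "path L r u s" "set u \<subseteq> B" using edges_path[OF st(1) T] by blast
    obtain v where v: "path L t v r" "set v \<subseteq> B" using edges_path[OF st(3) T] by blast
    show ?case using y u v st(2) T insert.prems
      by (intro exI[of _ "y @ u @ a # v"]) (auto simp: path_append)
  qed
  then obtain y where "path L r y r" "set y = B" using assms(3) by blast
  moreover obtain x z where "path L p x r" "set x \<subseteq> B" "path L r z q" "set z \<subseteq> B"
    using edges_path[OF assms(1) T] edges_path[OF assms(2) T] by blast
  ultimately show ?thesis unfolding conn_def by blast
qed

text \<open>\<open>common r1 r2\<close> itself serves as the letter set B, being a fixed point of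
  \<open>shrink\<close>.\<close>

lemma star_sound: "star r1 r2 \<subseteq> pair_step L1 L2"
proof (clarify, goal_cases)
  case (1 p1 p2 x y)
  let ?B = "common r1 r2"
  have fin: "finite ?B" using common_fixed
  proof -
    have "(shrink r1 r2 ^^ n) {..<D} \<subseteq> {..<D}" for n by (induction n) (auto simp: shrink_def)
    then show ?thesis unfolding common_def using finite_subset by blast
  qed
  have lp: "loop D T1 (clo1 ?B) r1 a" "loop D T2 (clo2 ?B) r2 a" if "a \<in> ?B" for a
    using that common_fixed[of r1 r2] unfolding shrink_def by blast+
  have "(p1, r1) \<in> (edges T1 ?B)\<^sup>*" "(r1, x) \<in> (edges T1 ?B)\<^sup>*" "(p2, r2) \<in> (edges T2 ?B)\<^sup>*" "(r2, y) \<in> (edges T2 ?B)\<^sup>*"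
    using 1 unfolding star_def clo1_def clo2_def by (auto simp: Let_def)
  then have "conn L1 ?B p1 r1 x" "conn L2 ?B p2 r2 y"
    using loop_conn[OF _ _ fin T1 lp(1)[unfolded clo1_def]] loop_conn[OF _ _ fin T2 lp(2)[unfolded clo2_def]] by blast+
  then show ?case unfolding pair_step_def by blast
qed

text \<open>Any admissible B lies in \<open>common r1 r2\<close>, and the paths into and out of the
  loop remain valid over the larger set. So it loses nothing to test one set per pair of loop
  states.\<close>

lemma star_complete:
  assumes "conn L1 B p1 r1 x" "conn L2 B p2 r2 y" "p1 < D" "p2 < D"
  shows "((p1, p2), (x, y)) \<in> star r1 r2" "r1 < D" "r2 < D"
proof -
  note c1 = conn_loop[OF assms(1) T1 bound1 assms(3)] and c2 = conn_loop[OF assms(2) T2 bound2 assms(4)]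
  have "B \<subseteq> shrink r1 r2 B" unfolding shrink_def clo1_def clo2_def using c1(3) c2(3) by blast
  then have "B \<subseteq> common r1 r2" using common_greatest[of B r1 r2] c1(4) by blast
  note m = clo_mono[OF this]
  show "((p1, p2), (x, y)) \<in> star r1 r2"
    using c1(1,2) c2(1,2) m unfolding star_def Let_def clo1_def clo2_def by blast
  show "r1 < D" "r2 < D" using c1(1) c2(1) by (auto simp: box_def)
qed

abbreviation "E \<equiv> pair_step L1 L2"

lemma pair_step_box: "(P, Q) \<in> E \<Longrightarrow> P \<in> box D \<Longrightarrow> Q \<in> box D"
  unfolding pair_step_def
proof (clarify, goal_cases)
  case (1 p1 p2 q1 q2)
  then show ?case
  proof (elim disjE exE conjE)
    fix B r1 r2 assume c: "conn L1 B p1 r1 q1" "conn L2 B p2 r2 q2"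
    have p: "p1 < D" "p2 < D" using 1 by (auto simp: box_def)
    show ?thesis
      using conn_loop(2)[OF c(1) T1 bound1 p(1)] conn_loop(2)[OF c(2) T2 bound2 p(2)] by (auto simp: box_def)
  qed (use bound1 bound2 in \<open>auto simp: box_def\<close>)
qed

lemma Image_box: "V \<subseteq> box D \<Longrightarrow> E\<^sup>* `` V \<subseteq> box D"
proof
  fix Q assume V: "V \<subseteq> box D" and "Q \<in> E\<^sup>* `` V"
  then obtain P where "(P, Q) \<in> E\<^sup>*" "P \<in> box D" by blast
  then show "Q \<in> box D" by (induction rule: rtrancl_induct) (auto intro: pair_step_box)
qed

text \<open>X r is the part of the edge relation for which round r is responsible. Pairs found in
  earlier rounds persist, so the loop covers the union; used for the loops over both r2 and
  r1.\<close>

lemma fold_grows: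
  fixes rel :: rels
  assumes step: "\<And>r rel. rel 4 \<subseteq> box D \<Longrightarrow> r < D \<Longrightarrow>
      rel 4 \<union> X r `` rel 4 \<subseteq> f r rel 4 \<and> f r rel 4 \<subseteq> E\<^sup>* `` rel 4"
    and rel: "rel 4 \<subseteq> box D"
  shows "n \<le> D \<Longrightarrow> rel 4 \<union> (\<Union>r < n. X r) `` rel 4 \<subseteq> fold f [0..<n] rel 4 \<and> fold f [0..<n] rel 4 \<subseteq> E\<^sup>* `` rel 4"
proof (induction n)
  case 0
  then show ?case by auto
next
  case (Suc n)
  let ?r = "fold f [0..<n] rel"
  have IH: "rel 4 \<union> (\<Union>r < n. X r) `` rel 4 \<subseteq> ?r 4" "?r 4 \<subseteq> E\<^sup>* `` rel 4" using Suc by auto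
  have "?r 4 \<subseteq> box D" using IH(2) Image_box[OF rel] by blast
  then have s: "?r 4 \<union> X n `` ?r 4 \<subseteq> f n ?r 4" "f n ?r 4 \<subseteq> E\<^sup>* `` ?r 4" using step[of ?r n] Suc.prems by auto
  have "(\<Union>r < Suc n. X r) = (\<Union>r < n. X r) \<union> X n" by (auto simp: less_Suc_eq)
  then have U: "(\<Union>r < Suc n. X r) `` rel 4 = (\<Union>r < n. X r) `` rel 4 \<union> X n `` rel 4" by (simp add: Un_Image)
  have "rel 4 \<subseteq> ?r 4" using IH(1) by blast
  then have "X n `` rel 4 \<subseteq> X n `` ?r 4" by (rule Image_mono[OF subset_refl])
  note Un_least[OF order.trans[OF IH(1) order.trans[OF Un_upper1 s(1)]]
      order.trans[OF this order.trans[OF Un_upper2 s(1)]]]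
  then have 1: "rel 4 \<union> (\<Union>r < Suc n. X r) `` rel 4 \<subseteq> f n ?r 4" unfolding U Un_assoc .
  have "E\<^sup>* `` ?r 4 \<subseteq> E\<^sup>* `` (E\<^sup>* `` rel 4)" using IH(2) by blast
  also have "\<dots> = E\<^sup>* `` rel 4" by (metis relcomp_Image rtrancl_idemp_self_comp)
  finally show ?case using 1 s(2) by auto
qed

lemma add_letter:
  fixes rel :: rels
  assumes "rel 4 \<subseteq> box D"
  shows "add_letter D T1 T2 rel 4 =
    rel 4 \<union> {((p1, p2), (x, y)). \<exists>a. (p1, a, x) \<in> set L1 \<and> (p2, a, y) \<in> set L2} `` rel 4"
proof -
  have "x < D \<and> y < D" if "(x, y) \<in> rel 4" for x y using assms that by (auto simp: box_def)
  then show ?thesis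
    unfolding add_letter_def fun_upd_same T1 T2 using bound1 bound2 by (auto; blast)
qed

text \<open>Every edge leaving a pair in the box is a letter edge or a star edge with loop states
  below D, so one round follows all edges at least once and never leaves the closure.\<close>

lemma outer:
  fixes rel :: rels
  assumes rel: "rel 4 \<subseteq> box D"
  shows "rel 4 \<union> E `` rel 4 \<subseteq> outer D T1 T2 rel 4" "outer D T1 T2 rel 4 \<subseteq> E\<^sup>* `` rel 4"
proof -
  have in1: "rel 4 \<union> star r1 r2 `` rel 4 \<subseteq> inner D T1 T2 r1 r2 rel 4 \<and> inner D T1 T2 r1 r2 rel 4 \<subseteq> E\<^sup>* `` rel 4"
    if "rel 4 \<subseteq> box D" for r1 r2 and rel :: rels
    unfolding inner[of rel, OF that] using star_sound[of r1 r2] by blast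
  have in2: "rel 4 \<union> (\<Union>r2 < D. star r1 r2) `` rel 4 \<subseteq> fold (inner D T1 T2 r1) [0..<D] rel 4 \<and>
      fold (inner D T1 T2 r1) [0..<D] rel 4 \<subseteq> E\<^sup>* `` rel 4" if "rel 4 \<subseteq> box D" for r1 and rel :: rels
    by (rule fold_grows[where X = "star r1"]) (use in1 that in auto)
  let ?r = "fold (\<lambda>r1. fold (inner D T1 T2 r1) [0..<D]) [0..<D] rel"
  have in3: "rel 4 \<union> (\<Union>r1 < D. \<Union>r2 < D. star r1 r2) `` rel 4 \<subseteq> ?r 4 \<and> ?r 4 \<subseteq> E\<^sup>* `` rel 4"
    by (rule fold_grows[where X = "\<lambda>r1. \<Union>r2 < D. star r1 r2"]) (use in2 rel in auto)
  have rbox: "?r 4 \<subseteq> box D" using in3 Image_box[OF rel] by blast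
  let ?L = "{((p1, p2), (x, y)). \<exists>a. (p1, a, x) \<in> set L1 \<and> (p2, a, y) \<in> set L2}"
  have o: "outer D T1 T2 rel 4 = ?r 4 \<union> ?L `` ?r 4"
    unfolding outer_def by (rule add_letter[of ?r, OF rbox])
  have "E `` rel 4 \<subseteq> (\<Union>r1 < D. \<Union>r2 < D. star r1 r2) `` rel 4 \<union> ?L `` rel 4"
  proof
    fix Q assume "Q \<in> E `` rel 4"
    then obtain P where P: "P \<in> rel 4" "(P, Q) \<in> E" by blast
    obtain p1 p2 q1 q2 where PQ: "P = (p1, p2)" "Q = (q1, q2)" by (metis surj_pair)
    then have p: "p1 < D" "p2 < D" using P(1) rel by (auto simp: box_def)
    consider a where "(p1, a, q1) \<in> set L1" "(p2, a, q2) \<in> set L2"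
      | B r1 r2 where "conn L1 B p1 r1 q1" "conn L2 B p2 r2 q2"
      using P(2) PQ unfolding pair_step_def by auto
    then show "Q \<in> (\<Union>r1 < D. \<Union>r2 < D. star r1 r2) `` rel 4 \<union> ?L `` rel 4"
    proof cases
      case 1
      then show ?thesis using P(1) PQ by blast
    next
      case 2
      note s = star_complete[OF 2 p]
      then show ?thesis using P(1) PQ by blast
    qed
  qed
  note E = this
  have A: "rel 4 \<subseteq> ?r 4" "(\<Union>r1 < D. \<Union>r2 < D. star r1 r2) `` rel 4 \<subseteq> ?r 4" "?r 4 \<subseteq> E\<^sup>* `` rel 4"
    using in3[unfolded Un_subset_iff] by simp_all
  have L: "?L `` rel 4 \<subseteq> ?L `` ?r 4" by (rule Image_mono[OF subset_refl A(1)])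
  show "rel 4 \<union> E `` rel 4 \<subseteq> outer D T1 T2 rel 4" unfolding o
    by (intro Un_least le_supI1[OF A(1)] order.trans[OF E] Un_mono[OF A(2) L])
  have "?L \<subseteq> E" by (auto simp: pair_step_def)
  then have "?L `` ?r 4 \<subseteq> E `` (E\<^sup>* `` rel 4)" by (rule Image_mono[OF _ A(3)])
  also have "\<dots> \<subseteq> E\<^sup>* `` rel 4" by (auto intro: rtrancl_into_rtrancl)
  finally show "outer D T1 T2 rel 4 \<subseteq> E\<^sup>* `` rel 4" unfolding o by (rule Un_least[OF A(3)])
qed

text \<open>The right-hand side does not mention \<open>rel\<close>: whatever the tables contain at
  the start is overwritten before it matters.\<close>

lemma main_closure:
  "main D T1 T2 I1 I2 rel 4 = E\<^sup>* `` {(x, y). x < D \<and> y < D \<and> (I1 x \<and> I2 y)}"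
proof -
  let ?i = "init_pairs D I1 I2 rel"
  let ?V = "\<lambda>n. (outer D T1 T2 ^^ n) ?i 4"
  have i: "?i 4 = {(x, y). x < D \<and> y < D \<and> (I1 x \<and> I2 y)}" by (simp add: init_pairs_def)
  have "?V (D * D) = E\<^sup>* `` ?V 0"
  proof (rule closure_sequence[OF finite_box[of D]])
    show "E\<^sup>* `` ?V 0 \<subseteq> box D" by (rule Image_box) (auto simp: i box_def)
    show "?V n \<union> E `` ?V n \<subseteq> ?V (Suc n) \<and> ?V (Suc n) \<subseteq> E\<^sup>* `` ?V n" if "?V n \<subseteq> box D" for n
      using outer[of "(outer D T1 T2 ^^ n) ?i", OF that] by simp
  qed (simp add: card_box)
  then show ?thesis unfolding main_def funpow_square by (simp add: i)
qed

end

section \<open>Reading the encoded automata\<close>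

text \<open>Positions in the input, such as the start of an encoded automaton, are functions of the
  input.\<close>
type_synonym input = "nat \<Rightarrow> nat"

definition final_pos :: "(input \<Rightarrow> nat) \<Rightarrow> input \<Rightarrow> nat" where
  "final_pos s I = s I + 2 + I (s I + 1)"

definition trans_pos :: "(input \<Rightarrow> nat) \<Rightarrow> input \<Rightarrow> nat" where
  "trans_pos s I = final_pos s I + 1 + I (final_pos s I)"

text \<open>A transition occupies three cells, and the tripling is written as a sum because terms
  are built with addition.\<close>

definition end_pos :: "(input \<Rightarrow> nat) \<Rightarrow> input \<Rightarrow> nat" where
  "end_pos s I = trans_pos s I + 1 + (I (trans_pos s I) + I (trans_pos s I) + I (trans_pos s I))"

definition is_initial :: "(input \<Rightarrow> nat) \<Rightarrow> nat \<Rightarrow> input \<Rightarrow> nat \<Rightarrow> bool" where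
  "is_initial s D I x \<longleftrightarrow> (\<exists>j < D. j < I (s I + 1) \<and> I (s I + 2 + j) = x)"

definition is_final :: "(input \<Rightarrow> nat) \<Rightarrow> nat \<Rightarrow> input \<Rightarrow> nat \<Rightarrow> bool" where
  "is_final s D I x \<longleftrightarrow> (\<exists>j < D. j < I (final_pos s I) \<and> I (final_pos s I + 1 + j) = x)"

definition is_trans :: "(input \<Rightarrow> nat) \<Rightarrow> nat \<Rightarrow> input \<Rightarrow> trans_pred" where
  "is_trans s D I x a y \<longleftrightarrow> (\<exists>j < D. j < I (trans_pos s I) \<and>
     (I (trans_pos s I + 1 + (j + j + j)) = x \<and> (I (trans_pos s I + 2 + (j + j + j)) = a \<and>
      I (trans_pos s I + 3 + (j + j + j)) = y)))"

text \<open>Position 0 of the input holds the size of the alphabet.\<close>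

definition pos1 :: "input \<Rightarrow> nat" where "pos1 = (\<lambda>I. 1)"
definition pos2 :: "input \<Rightarrow> nat" where "pos2 = end_pos pos1"

text \<open>Above all states, letters and list positions at once, so a single D serves as loop
  bound, index range and table width. As a sum of fields it can be computed before any bound is
  available.\<close>

definition bound :: "input \<Rightarrow> nat" where
  "bound I = I 0 + I (pos1 I) + I (pos2 I) + I (pos1 I + 1) + I (pos2 I + 1) +
     I (final_pos pos1 I) + I (final_pos pos2 I) + I (trans_pos pos1 I) + I (trans_pos pos2 I) + 1"

definition at :: "input \<Rightarrow> nat \<Rightarrow> nat list \<Rightarrow> bool" where
  "at I p ys \<longleftrightarrow> (\<forall>i < length ys. I (p + i) = ys ! i)"

lemma at_simps [simp]:
  "at I p []" "at I p (y # ys) \<longleftrightarrow> I p = y \<and> at I (Suc p) ys"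
  "at I p (xs @ ys) \<longleftrightarrow> at I p xs \<and> at I (p + length xs) ys"
proof -
  show "at I p []" by (simp add: at_def)
  show C: "at I p (y # ys) \<longleftrightarrow> I p = y \<and> at I (Suc p) ys" for p y ys
    by (auto simp: at_def nth_Cons less_Suc_eq_0_disj split: nat.splits)
  show "at I p (xs @ ys) \<longleftrightarrow> at I p xs \<and> at I (p + length xs) ys"
    by (induction xs arbitrary: p) (auto simp: C, auto simp: at_def)
qed

lemma at_mem: "at I p ys \<Longrightarrow> (x \<in> set ys) = (\<exists>j < length ys. I (p + j) = x)"
  by (auto simp: at_def in_set_conv_nth)

lemma at_triples:
  "at I p (concat (map (\<lambda>(x, a, y). [x, a, y]) T)) \<Longrightarrow> j < length T \<Longrightarrow>
     T ! j = (I (p + 3 * j), I (p + 1 + 3 * j), I (p + 2 + 3 * j))"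
proof (induction T arbitrary: p j)
  case (Cons t T)
  obtain x a y where t: "t = (x, a, y)" by (cases t)
  show ?case
  proof (cases j)
    case 0
    then show ?thesis using Cons.prems t by simp
  next
    case (Suc i)
    then have "T ! i = (I (p + 3 + 3 * i), I (p + 3 + 1 + 3 * i), I (p + 3 + 2 + 3 * i))"
      using Cons.prems t by (intro Cons.IH) (simp_all add: numeral_3_eq_3)
    then show ?thesis using Suc by (simp add: add.assoc)
  qed
qed simp

lemma length_triples: "length (concat (map (\<lambda>(x, a, y). [x, a, y]) T)) = 3 * length T"
  by (induction T) auto

lemma encoded:
  assumes "at I (s I) (enc_nfa M)"
  shows "I (s I) = nstates M" "I (s I + 1) = length (initial M)" "I (final_pos s I) = length (final M)"
    "I (trans_pos s I) = length (trans M)" "end_pos s I = s I + length (enc_nfa M)"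
    "length (initial M) \<le> D \<Longrightarrow> is_initial s D I x \<longleftrightarrow> x \<in> set (initial M)"
    "length (final M) \<le> D \<Longrightarrow> is_final s D I x \<longleftrightarrow> x \<in> set (final M)"
    "length (trans M) \<le> D \<Longrightarrow> is_trans s D I x a y \<longleftrightarrow> (x, a, y) \<in> set (trans M)"
proof -
  let ?n = "length (initial M)" and ?m = "length (final M)"
  have a: "I (s I) = nstates M" "I (s I + 1) = ?n" "at I (s I + 2) (initial M)"
    "I (s I + 2 + ?n) = ?m" "at I (s I + 2 + ?n + 1) (final M)"
    "I (s I + 2 + ?n + 1 + ?m) = length (trans M)"
    "at I (s I + 2 + ?n + 1 + ?m + 1) (concat (map (\<lambda>(p, a, q). [p, a, q]) (trans M)))"
    using assms by (simp_all add: enc_nfa_def add_ac)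
  have f: "final_pos s I = s I + 2 + ?n" using a(2) by (simp add: final_pos_def)
  have t: "trans_pos s I = s I + 2 + ?n + 1 + ?m" using a(4) f by (simp add: trans_pos_def)
  show "I (s I) = nstates M" "I (s I + 1) = ?n" by (rule a)+
  show F: "I (final_pos s I) = ?m" unfolding f by (rule a)
  show TT: "I (trans_pos s I) = length (trans M)" unfolding t by (rule a)
  show "end_pos s I = s I + length (enc_nfa M)"
    unfolding end_pos_def TT using t by (simp add: enc_nfa_def length_triples)
  show "is_initial s D I x \<longleftrightarrow> x \<in> set (initial M)" if "?n \<le> D"
    unfolding is_initial_def a(2) at_mem[OF a(3)] using less_le_trans[OF _ that] by blast
  show "is_final s D I x \<longleftrightarrow> x \<in> set (final M)" if "?m \<le> D"
    unfolding is_final_def F unfolding f at_mem[OF a(5)] using less_le_trans[OF _ that] by blast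
  show "is_trans s D I x a y \<longleftrightarrow> (x, a, y) \<in> set (trans M)" if "length (trans M) \<le> D"
  proof -
    let ?P = "\<lambda>j. I (trans_pos s I + 1 + (j + j + j)) = x \<and> I (trans_pos s I + 2 + (j + j + j)) = a \<and>
      I (trans_pos s I + 3 + (j + j + j)) = y"
    have "trans M ! j = (x, a, y) \<longleftrightarrow> ?P j" if "j < length (trans M)" for j
      using at_triples[OF a(7) that] unfolding t by (simp add: algebra_simps numeral_eq_Suc)
    then have "(x, a, y) \<in> set (trans M) \<longleftrightarrow> (\<exists>j < length (trans M). ?P j)"
      unfolding in_set_conv_nth by blast
    then show ?thesis unfolding is_trans_def TT using less_le_trans[OF _ that] by blast
  qed
qed

section \<open>The algorithm as a program\<close>

text \<open>The same position is needed at different quantifier depths, hence computability at all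
  levels up to k. Each nested second argument uses one more level, so the admissible k decreases
  with the size of the term.\<close>

definition readable :: "nat \<Rightarrow> (input \<Rightarrow> nat) \<Rightarrow> bool" where
  "readable k s \<longleftrightarrow> (\<forall>d \<le> k. computes d (\<lambda>D I e. s I))"

lemma readableD: "readable k s \<Longrightarrow> d \<le> k \<Longrightarrow> computes d (\<lambda>D I e. s I)"
  by (simp add: readable_def)

lemma readable_mono: "readable k s \<Longrightarrow> l \<le> k \<Longrightarrow> readable l s"
  by (simp add: readable_def)

lemma readable_const: "k \<le> 80 \<Longrightarrow> readable k (\<lambda>I. n)"
  unfolding readable_def by (intro allI impI computes_const) simp

lemma readable_input: "readable k s \<Longrightarrow> k \<le> 80 \<Longrightarrow> readable k (\<lambda>I. I (s I))"
  unfolding readable_def by (intro allI impI computes_input) auto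

lemma readable_add: "readable (Suc k) s \<Longrightarrow> readable (Suc k) t \<Longrightarrow> k \<le> 80 \<Longrightarrow> readable k (\<lambda>I. s I + t I)"
  unfolding readable_def by (intro allI impI computes_add) auto

lemma readable_final_pos:
  assumes "readable (k + 2) s" "k \<le> 70" shows "readable k (final_pos s)"
proof -
  have "readable k s" "readable (Suc k) s" "readable (Suc (Suc k)) s"
    using assms readable_mono by auto
  then show ?thesis unfolding final_pos_def[abs_def] using assms(2)
    by (intro readable_add readable_input readable_const) auto
qed

lemma readable_trans_pos:
  assumes "readable (k + 4) s" "k \<le> 60" shows "readable k (trans_pos s)"
proof -
  have "readable (Suc k) (final_pos s)" "readable (Suc (Suc k)) (final_pos s)"
    using assms by (auto intro!: readable_final_pos intro: readable_mono)
  then show ?thesis unfolding trans_pos_def[abs_def] using assms(2)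
    by (intro readable_add readable_input readable_const) auto
qed

lemma readable_end_pos:
  assumes "readable (k + 7) s" "k \<le> 50" shows "readable k (end_pos s)"
proof -
  have "readable (Suc k) (trans_pos s)" "readable (Suc (Suc k)) (trans_pos s)" "readable (Suc (Suc (Suc k))) (trans_pos s)"
    using assms by (auto intro!: readable_trans_pos intro: readable_mono)
  then show ?thesis unfolding end_pos_def[abs_def] using assms(2)
    by (intro readable_add readable_input readable_const) auto
qed

text \<open>The 57 is 50 plus the seven levels consumed by \<open>end_pos\<close>.\<close>

lemma readable_pos: "readable 50 pos1" "readable 50 pos2"
proof -
  have "readable 57 pos1" unfolding pos1_def by (rule readable_const) simp
  then show "readable 50 pos1" "readable 50 pos2"
    unfolding pos2_def by (auto intro: readable_mono readable_end_pos)
qed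

lemma computes_bound: "computes 0 (\<lambda>D I e. bound I)"
proof -
  have "readable (Suc k) s" "readable (Suc k) (\<lambda>I. I (s I))" "readable (Suc k) (\<lambda>I. I (s I + 1))"
    "readable (Suc k) (\<lambda>I. I (final_pos s I))" "readable (Suc k) (\<lambda>I. I (trans_pos s I))"
    if "readable 50 s" "k \<le> 30" for s k
    using that by (auto intro!: readable_input readable_add readable_const readable_final_pos readable_trans_pos
      intro: readable_mono simp del: One_nat_def)
  note r = this[OF readable_pos(1)] this[OF readable_pos(2)]
  have "readable 0 (\<lambda>I. bound I)"
    unfolding bound_def by (intro readable_add r readable_input[OF readable_const] readable_const) simp_all
  then show ?thesis by (rule readableD) simp
qed

lemmas logic_intros = decides_conj decides_less decides_eq computes_add computes_input computes_const computes_var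

lemma decides_is_initial:
  assumes "readable 50 s" "x < d" "d \<le> 40"
  shows "decides d (\<lambda>D I e rel. is_initial s D I (e x))"
  unfolding is_initial_def
  by (rule decides_ex) (use assms in \<open>((intro logic_intros readableD[OF assms(1)])?; simp)+\<close>)

lemma decides_is_final:
  assumes "readable 50 s" "x < d" "d \<le> 40"
  shows "decides d (\<lambda>D I e rel. is_final s D I (e x))"
proof -
  have r: "readable 48 (final_pos s)" by (rule readable_final_pos) (use assms in simp_all)
  show ?thesis unfolding is_final_def
    by (rule decides_ex) (use assms in \<open>((intro logic_intros readableD[OF r])?; simp)+\<close>)
qed

lemma decides_is_trans:
  assumes "readable 50 s" "x < d" "a < d" "y < d" "d \<le> 40"
  shows "decides d (\<lambda>D I e rel. is_trans s D I (e x) (e a) (e y))"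
proof -
  have r: "readable 46 (trans_pos s)" by (rule readable_trans_pos) (use assms in simp_all)
  show ?thesis unfolding is_trans_def
    by (rule decides_ex) (use assms in \<open>((intro logic_intros readableD[OF r])?; simp)+\<close>)
qed

section \<open>Programs for the saturation operations\<close>

lemma updates_init_reach:
  assumes "d \<le> 30" shows "updates d (\<lambda>D I e. init_reach D q)"
  unfolding init_reach_def[abs_def]
  by (rule updates_assign) (use assms in \<open>((intro logic_intros)?; simp)+\<close>)

lemma updates_step_reach:
  assumes "readable 50 s" "d \<le> 30" "1 \<le> q" shows "updates d (\<lambda>D I e. step_reach D (is_trans s D I) q)"
  unfolding step_reach_def[abs_def]
proof (rule updates_assign)
  show "decides (Suc (Suc d)) (\<lambda>D I e rel. (e d, e (Suc d)) \<in> rel q \<or> (\<exists>z < D. \<exists>a < D.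
    (e d, z) \<in> rel q \<and> (a, a) \<in> rel 1 \<and> is_trans s D I z a (e (Suc d))))"
    by (rule decides_disj decides_ex decides_conj decides_mem decides_is_trans[OF assms(1)]
       | use assms in \<open>simp; fail\<close>)+
qed (use assms in simp_all)

lemma updates_reach:
  assumes "readable 50 s" "d \<le> 20" "1 \<le> q" shows "updates d (\<lambda>D I e. reach D (is_trans s D I) q)"
proof -
  have "updates d (\<lambda>D I e. (step_reach D (is_trans s D I) q ^^ D) ^^ D)"
    by (intro updates_iter updates_step_reach) (use assms in simp_all)
  from updates_comp[OF updates_init_reach this, of q] show ?thesis
    unfolding reach_def[abs_def] using assms(2) by simp
qed

abbreviation "tr1 \<equiv> is_trans pos1"
abbreviation "tr2 \<equiv> is_trans pos2"

lemma updates_both_reach: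
  assumes "d \<le> 20" shows "updates d (\<lambda>D I e. both_reach D (tr1 D I) (tr2 D I))"
  using updates_comp[OF updates_reach[OF readable_pos(1) assms, of 2] updates_reach[OF readable_pos(2) assms, of 3]]
  unfolding both_reach_def[abs_def] by simp

lemma decides_loop:
  assumes "readable 50 s" "d \<le> 35" "1 \<le> q" "r < d" "a < d"
  shows "decides d (\<lambda>D I e rel. loop D (is_trans s D I) (rel q) (e r) (e a))"
  unfolding loop_def
  by (rule decides_ex decides_conj decides_mem decides_is_trans[OF assms(1)]
       | use assms in \<open>simp; fail\<close>)+

lemma updates_filter_letters:
  assumes "d \<le> 30" "r1 < d" "r2 < d"
  shows "updates d (\<lambda>D I e. filter_letters D (tr1 D I) (tr2 D I) (e r1) (e r2))"
  unfolding filter_letters_def[abs_def]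
proof (rule updates_assign)
  show "decides (Suc (Suc d)) (\<lambda>D I e rel. (e d, e (Suc d)) \<in> rel 1 \<and>
    loop D (tr1 D I) (rel 2) (e r1) (e d) \<and> loop D (tr2 D I) (rel 3) (e r2) (e d))"
    by (rule decides_conj decides_mem decides_loop[OF readable_pos(1)] decides_loop[OF readable_pos(2)]
       | use assms in \<open>simp; fail\<close>)+
qed (use assms in simp_all)

lemma updates_add_star:
  assumes "d \<le> 30" "r1 < d" "r2 < d"
  shows "updates d (\<lambda>D I e. add_star D (e r1) (e r2))"
  unfolding add_star_def[abs_def]
proof (rule updates_assign)
  show "decides (Suc (Suc d)) (\<lambda>D I e rel. (e d, e (Suc d)) \<in> rel 4 \<or>
     (\<exists>p1 < D. \<exists>p2 < D. (p1, p2) \<in> rel 4 \<and> (p1, e r1) \<in> rel 2 \<and> (p2, e r2) \<in> rel 3 \<and>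
       (e r1, e d) \<in> rel 2 \<and> (e r2, e (Suc d)) \<in> rel 3))"
    by (rule decides_disj decides_ex decides_conj decides_mem
       | use assms in \<open>simp; fail\<close>)+
qed (use assms in simp_all)

lemma updates_all_letters:
  assumes "d \<le> 30" shows "updates d (\<lambda>D I e. all_letters D)"
  unfolding all_letters_def[abs_def]
  by (rule updates_assign) (use assms in \<open>((intro logic_intros)?; simp)+\<close>)

lemma updates_round:
  assumes "d \<le> 20" "r1 < d" "r2 < d"
  shows "updates d (\<lambda>D I e. round D (tr1 D I) (tr2 D I) (e r1) (e r2))"
  using updates_comp[OF updates_both_reach[OF assms(1)] updates_filter_letters[OF _ assms(2,3)]] assms(1)
  unfolding round_def[abs_def] by simp

lemma updates_inner:
  assumes "d \<le> 10" "r1 < d" "r2 < d"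
  shows "updates d (\<lambda>D I e. inner D (tr1 D I) (tr2 D I) (e r1) (e r2))"
proof -
  have "updates d (\<lambda>D I e. round D (tr1 D I) (tr2 D I) (e r1) (e r2) ^^ D)"
    by (intro updates_iter updates_round) (use assms in simp_all)
  from updates_comp[OF updates_comp[OF updates_comp[OF updates_all_letters this]
        updates_both_reach] updates_add_star[OF _ assms(2,3)]] assms(1)
  show ?thesis unfolding inner_def[abs_def] by simp
qed

lemma updates_add_letter:
  assumes "d \<le> 30"
  shows "updates d (\<lambda>D I e. add_letter D (tr1 D I) (tr2 D I))"
  unfolding add_letter_def[abs_def]
proof (rule updates_assign)
  show "decides (Suc (Suc d)) (\<lambda>D I e rel. (e d, e (Suc d)) \<in> rel 4 \<or>
     (\<exists>p1 < D. \<exists>p2 < D. \<exists>a < D. (p1, p2) \<in> rel 4 \<and> tr1 D I p1 a (e d) \<and>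
       tr2 D I p2 a (e (Suc d))))"
    by (rule decides_disj decides_ex decides_conj decides_mem decides_is_trans[OF readable_pos(1)]
         decides_is_trans[OF readable_pos(2)]
       | use assms in \<open>simp; fail\<close>)+
qed (use assms in simp_all)

lemma updates_outer:
  assumes "d \<le> 5"
  shows "updates d (\<lambda>D I e. outer D (tr1 D I) (tr2 D I))"
proof -
  have "updates d (\<lambda>D I e. fold (\<lambda>r1. fold (\<lambda>r2. inner D (tr1 D I) (tr2 D I) r1 r2) [0..<D]) [0..<D])"
    by (intro updates_for updates_inner) (use assms in simp_all)
  from updates_comp[OF this updates_add_letter] assms show ?thesis
    unfolding outer_def[abs_def] by simp
qed

lemma updates_init_pairs:
  "updates 0 (\<lambda>D I e. init_pairs D (is_initial pos1 D I) (is_initial pos2 D I))"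
  unfolding init_pairs_def[abs_def]
  by (rule updates_assign) ((intro decides_conj decides_is_initial readable_pos)?; simp)+

lemma updates_main:
  "updates 0 (\<lambda>D I e. main D (tr1 D I) (tr2 D I) (is_initial pos1 D I) (is_initial pos2 D I))"
proof -
  have "updates 0 (\<lambda>D I e. (outer D (tr1 D I) (tr2 D I) ^^ D) ^^ D)"
    by (intro updates_iter updates_outer) simp_all
  from updates_comp[OF updates_init_pairs this] show ?thesis unfolding main_def[abs_def] .
qed

lemma decides_answer:
  "decides 0 (\<lambda>D I e rel. \<not> (\<exists>x < D. \<exists>y < D. (x, y) \<in> rel 4 \<and> is_final pos1 D I x \<and> is_final pos2 D I y))"
  by (rule decides_not decides_ex decides_conj decides_mem decides_is_final[OF readable_pos(1)]
       decides_is_final[OF readable_pos(2)] | simp; fail)+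

section \<open>Relocation of the input\<close>

definition input_of :: "nat list \<Rightarrow> input" where
  "input_of xs = (\<lambda>i. if i < length xs then xs ! i else 0)"

text \<open>Starts with j = 1, as cell 1 has been saved before it receives the constant 1.\<close>

definition save_block :: "nat \<Rightarrow> instr list" where
  "save_block n = concat (map (\<lambda>j. [Add 0 0 1, StoreI 0 (Suc j)]) [1..<n])"

text \<open>No constant is available in a register at first, so the length in cell 0 is doubled ten
  times. For nonempty input, 1024 times the length exceeds both the end of the input and 2 *
  \<open>low\<close>, which gives a free address for the saved cells. Cell 3 gets the provisional
  bound 0.\<close>

definition prologue :: "instr list" where
  "prologue = replicate 10 (Add 0 0 0) @ [StoreI 0 1, LoadC 1 1] @ save_block low @ [Add 0 0 1, LoadC 2 0, LoadC 3 0]"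

lemma basic_prologue: "list_all basic prologue"
  by (simp add: prologue_def save_block_def list_all_iff)

lemma fold_double: "fold upd (replicate n (Add 0 0 0)) m = m(0 := 2 ^ n * m 0)"
  by (induction n arbitrary: m) (auto simp: fun_eq_iff)

lemma fold_save_block:
  assumes "m 0 = b" "m 1 = 1" "1 \<le> n" "n \<le> low" "2 * low \<le> b"
  shows "fold upd (save_block n) m 0 = b + n - 1" "fold upd (save_block n) m 1 = 1"
    "\<And>a. 1 \<le> a \<Longrightarrow> a < n \<Longrightarrow> fold upd (save_block n) m (b + a) = m (Suc a)"
    "\<And>a. 2 \<le> a \<Longrightarrow> a \<le> b \<Longrightarrow> fold upd (save_block n) m a = m a"
proof -
  let ?m = "\<lambda>n. fold upd (save_block n) m"
  have "?m n 0 = b + n - 1 \<and> ?m n 1 = 1 \<and> (\<forall>a. 1 \<le> a \<longrightarrow> a < n \<longrightarrow> ?m n (b + a) = m (Suc a)) \<and>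
    (\<forall>a. 2 \<le> a \<longrightarrow> a \<le> b \<longrightarrow> ?m n a = m a)"
    using assms(3,4)
  proof (induction n rule: dec_induct)
    case base
    then show ?case using assms by (simp add: save_block_def)
  next
    case (step n)
    then have IH: "?m n 0 = b + n - 1" "?m n 1 = 1" "\<And>a. 1 \<le> a \<Longrightarrow> a < n \<Longrightarrow> ?m n (b + a) = m (Suc a)"
      "\<And>a. 2 \<le> a \<Longrightarrow> a \<le> b \<Longrightarrow> ?m n a = m a" and n: "n < low" "1 \<le> n" by auto
    have "save_block (Suc n) = save_block n @ [Add 0 0 1, StoreI 0 (Suc n)]" using n by (simp add: save_block_def)
    moreover have "?m n (Suc n) = m (Suc n)" using IH(4)[of "Suc n"] n assms(5) by simp
    ultimately have eq: "?m (Suc n) = (?m n)(0 := b + n, b + n := m (Suc n))"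
      using IH(1,2) n by simp
    have "low = 200" by (simp add: low_def)
    then show ?case unfolding eq using IH n assms(5) by (auto simp: less_Suc_eq)
  qed
  then show "?m n 0 = b + n - 1" "?m n 1 = 1" "\<And>a. 1 \<le> a \<Longrightarrow> a < n \<Longrightarrow> ?m n (b + a) = m (Suc a)"
    "\<And>a. 2 \<le> a \<Longrightarrow> a \<le> b \<Longrightarrow> ?m n a = m a" by auto
qed

lemma prologue_rep:
  assumes "xs \<noteq> []"
  shows "rep 0 0 (input_of xs) e rel (fold upd prologue (snd (init_config xs)))"
proof -
  define m where "m = snd (init_config xs)"
  define b where "b = 2 ^ 10 * length xs"
  have m: "m (Suc a) = input_of xs a" "m 0 = length xs" for a
    by (auto simp: m_def init_config_def input_of_def)
  have b: "2 * low \<le> b" "length xs < b" using assms by (cases xs; simp add: b_def low_def)+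
  have low: "low = 200" by (simp add: low_def)
  define m1 where "m1 = m(0 := b, b := m 1, 1 := 1)"
  have m1: "m1 0 = b" "m1 1 = 1" using b low by (simp_all add: m1_def)
  have R1: "1 \<le> low" by (simp add: low)
  note s = fold_save_block[OF m1 R1 order.refl b(1)]
  let ?m2 = "fold upd (save_block low) m1"
  define m3 where "m3 = ?m2(0 := b + low, 2 := 0, 3 := 0)"
  have eq: "fold upd prologue m = m3"
  proof -
    have "fold upd [StoreI 0 1, LoadC 1 1] (m(0 := b)) = m1"
      using b low by (simp add: m1_def)
    moreover have "2 ^ 10 * m 0 = b" by (simp add: m(2) b_def)
    ultimately have "fold upd prologue m = fold upd [Add 0 0 1, LoadC 2 0, LoadC 3 0] ?m2"
      by (simp only: prologue_def fold_append comp_apply fold_double)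
    then show ?thesis using s(1,2) R1 by (simp add: m3_def)
  qed
  have save: "m3 (b + a) = input_of xs a" if "a < low" for a
  proof (cases "a = 0")
    case True
    have "?m2 b = m1 b" using s(4)[of b] b low by simp
    also have "\<dots> = input_of xs 0" using b low m(1)[of 0] by (simp add: m1_def)
    finally show ?thesis using True b low by (simp add: m3_def)
  next
    case False
    then have "?m2 (b + a) = m1 (Suc a)" using s(3)[of a] that by simp
    also have "\<dots> = input_of xs a" using False that b low m(1)[of a] by (simp add: m1_def)
    finally show ?thesis using that b low by (simp add: m3_def)
  qed
  have rest: "m3 (Suc a) = input_of xs a" if "low \<le> a" "Suc a < b" for a
  proof -
    have "?m2 (Suc a) = m1 (Suc a)" using s(4)[of "Suc a"] that low by simp
    also have "\<dots> = input_of xs a" using that low m(1)[of a] by (simp add: m1_def)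
    finally show ?thesis using that low by (simp add: m3_def)
  qed
  have "m3 0 = b + low" "m3 1 = 1" "m3 2 = 0" "m3 3 = 0" using s(2) by (simp_all add: m3_def)
  then show ?thesis unfolding m_def[symmetric] eq rep_def saved_def
    using save rest b by (auto simp: input_of_def)
qed

lemma triple_run:
  assumes "triple ((=) m) c Q t"
  shows "\<exists>t' m'. t' \<le> t \<and> run (c 0) t' (0, m) = (length (c 0), m') \<and> Q m'"
proof -
  obtain m' where "reaches (c 0) t (0, m) (0 + length (c 0), m')" "Q m'"
    by (rule tripleD[OF assms refl, of "c 0" "[]" "[]" 0]) simp_all
  then show ?thesis unfolding reaches_def by auto
qed

text \<open>Two stages: with the provisional bound 0 the true bound is computed, at the constant
  cost \<open>t1 0\<close>; after it is stored in cell 3 the main part runs. The tables are not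
  cleared, hence the existential \<open>rel\<close>.\<close>

lemma program_exists:
  assumes f: "computes 0 (\<lambda>D I e. f I)" and F: "updates 0 (\<lambda>D I e. F D I)"
    and \<phi>: "decides 0 (\<lambda>D I e rel. \<phi> D I rel)"
  shows "\<exists>P t. poly t \<and> (\<forall>xs. xs \<noteq> [] \<longrightarrow> (\<exists>rel. halts_with P xs (t (f (input_of xs)))
    (if \<phi> (f (input_of xs)) (input_of xs) (F (f (input_of xs)) (input_of xs) rel) then 1 else 0)))"
proof -
  obtain c1 t1 where 1: "poly t1" "\<And>D I e rel m0. rep 0 D I e rel m0 \<Longrightarrow>
     triple ((=) m0) c1 (\<lambda>m. agree 0 m0 m \<and> m (rg 0) = f I) (t1 D)"
    by (rule computesD[OF f]) (rule that)
  obtain c2 t2 where 2: "poly t2" "\<And>D I e rel m0. rep 0 D I e rel m0 \<Longrightarrow> \<forall>i < 0. e i < D \<Longrightarrow>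
     triple ((=) m0) c2 (rep 0 D I e (F D I rel)) (t2 D)"
    by (rule updatesD[OF F]) (rule that)
  obtain c3 t3 where 3: "poly t3" "\<And>D I e rel m0. rep 0 D I e rel m0 \<Longrightarrow> \<forall>i < 0. e i < D \<Longrightarrow>
     triple ((=) m0) c3 (\<lambda>m. agree 0 m0 m \<and> (m (rg 0) \<noteq> 0) = \<phi> D I rel) (t3 D)"
    by (rule decidesD[OF \<phi>]) (rule that)
  let ?b = "[Add 3 (rg 0) 2]"
  let ?c4 = "ifz (rg 0) (\<lambda>_. [LoadC 0 0]) (\<lambda>_. [LoadC 0 1])"
  let ?c3 = "seq c2 (seq c3 ?c4)"
  let ?c = "seq (\<lambda>_. prologue) (seq c1 (seq (\<lambda>_. ?b)
    ?c3))"
  let ?t = "\<lambda>D. length prologue + (t1 0 + (length ?b + (t2 D + (t3 D + (1 + 2)))))"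
  have poly: "poly ?t" by (intro poly_intros 1 2 3)
  have run: "\<exists>rel. halts_with (?c 0) xs (?t (f I)) (if \<phi> (f I) I (F (f I) I rel) then 1 else 0)"
    if xs: "xs \<noteq> []" and I: "I = input_of xs" for xs I
  proof -
    let ?D = "f I" and ?e = "\<lambda>_. 0" and ?m = "snd (init_config xs)"
    let ?rep0 = "rep 0 0 I ?e (\<lambda>_. {})"
    let ?Q = "\<lambda>m. \<exists>rel. m 0 = (if \<phi> ?D I (F ?D I rel) then 1 else (0 :: nat))"
    have "triple ((=) ?m) ?c ?Q (?t ?D)"
    proof (rule triple_seq[where Q = "?rep0"])
      show "triple ((=) ?m) (\<lambda>_. prologue) (?rep0) (length prologue)"
        by (rule triple_block[OF basic_prologue]) (use prologue_rep[OF xs] I in auto)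
      show "triple (?rep0) (seq c1 (seq (\<lambda>_. ?b)
          ?c3)) ?Q
          (t1 0 + (length ?b + (t2 ?D + (t3 ?D + (1 + 2)))))"
      proof (rule triple_seq[where Q = "\<lambda>m. ?rep0 m \<and> m (rg 0) = ?D"])
        show "triple (?rep0) c1 (\<lambda>m. ?rep0 m \<and> m (rg 0) = ?D) (t1 0)"
        proof (rule triple_start)
          fix m0 assume m0: "?rep0 m0"
          show "triple ((=) m0) c1 (\<lambda>m. ?rep0 m \<and> m (rg 0) = ?D) (t1 0)"
            by (rule triple_conseq[OF 1(2)[OF m0]]) (use rep_agree[OF m0] in auto)
        qed
        show "triple (\<lambda>m. ?rep0 m \<and> m (rg 0) = ?D) (seq (\<lambda>_. ?b)
          ?c3) ?Q
          (length ?b + (t2 ?D + (t3 ?D + (1 + 2))))"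
        proof (rule triple_seq[where Q = "\<lambda>m. \<exists>rel. rep 0 ?D I ?e rel m"])
          show "triple (\<lambda>m. ?rep0 m \<and> m (rg 0) = ?D) (\<lambda>_. ?b)
            (\<lambda>m. \<exists>rel. rep 0 ?D I ?e rel m) (length ?b)"
          proof (rule triple_block)
            fix m assume m: "?rep0 m \<and> m (rg 0) = ?D"
            let ?m' = "m(3 := ?D)"
            have h: "3 * low \<le> m 0" using m by (simp add: rep_def)
            have "saved (m 0) a \<noteq> 3" for a using h unfolding saved_def low_def by arith
            then have "?m' (saved (m 0) a) = m (saved (m 0) a)" "low \<le> a \<Longrightarrow> ?m' (a + 1) = m (a + 1)" for a
              by (simp_all add: low_def)
            \<comment> \<open>Changing the bound changes how the heap is read as tables; the
              relations are taken to be whatever is found there.\<close>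
            then have "rep 0 ?D I ?e (\<lambda>i. {(x, y). ?m' (m 0 + idx ?D i x y) \<noteq> 0}) ?m'"
              using m unfolding rep_def by simp
            moreover have "fold upd ?b m = ?m'" using m by (auto simp: rep_def)
            ultimately show "\<exists>rel. rep 0 ?D I ?e rel (fold upd ?b m)" by auto
          qed simp
          show "triple (\<lambda>m. \<exists>rel. rep 0 ?D I ?e rel m)
            ?c3 ?Q (t2 ?D + (t3 ?D + (1 + 2)))"
          proof (rule triple_start, elim exE)
            fix m0 rel assume m0: "rep 0 ?D I ?e rel m0"
            let ?rel = "F ?D I rel"
            show "triple ((=) m0) ?c3 ?Q
              (t2 ?D + (t3 ?D + (1 + 2)))"
            proof (rule triple_seq[OF 2(2)[OF m0]], simp, rule triple_start)
              fix m1 assume m1: "rep 0 ?D I ?e ?rel m1"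
              show "triple ((=) m1) (seq c3 ?c4) ?Q (t3 ?D + (1 + 2))"
              proof (rule triple_seq[OF 3(2)[OF m1]], simp, rule triple_ifz)
                let ?P = "\<lambda>m. agree 0 m1 m \<and> (m (rg 0) \<noteq> 0) = \<phi> ?D I ?rel"
                have "triple (\<lambda>m. ?P m \<and> m (rg 0) = 0) (\<lambda>_. [LoadC 0 0]) ?Q (length [LoadC 0 0])"
                  by (rule triple_block) auto
                then show "triple (\<lambda>m. ?P m \<and> m (rg 0) = 0) (\<lambda>_. [LoadC 0 0]) ?Q 1" by simp
                have z: "m 2 = 0" if "agree 0 m1 m" for m using rep_consts(3)[OF rep_agree[OF m1 that]] .
                have "triple (\<lambda>m. ?P m \<and> m (rg 0) \<noteq> 0) (\<lambda>_. [LoadC 0 1]) (\<lambda>m. ?Q m \<and> m 2 = 0) (length [LoadC 0 1])"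
                  by (rule triple_block) (auto simp: z)
                then show "triple (\<lambda>m. ?P m \<and> m (rg 0) \<noteq> 0) (\<lambda>_. [LoadC 0 1]) (\<lambda>m. ?Q m \<and> m 2 = 0) 1" by simp
              qed
            qed
          qed
        qed
      qed
    qed
    from triple_run[OF this] obtain t' m' rel where t': "t' \<le> ?t ?D" "run (?c 0) t' (0, ?m) = (length (?c 0), m')"
      and rel: "m' 0 = (if \<phi> ?D I (F ?D I rel) then 1 else 0)"
      by (elim exE conjE) (rule that)
    have "(0, ?m) = init_config xs" by (simp add: init_config_def)
    then have "run (?c 0) t' (init_config xs) = (length (?c 0), m')" using t'(2) by simp
    then have "halts_with (?c 0) xs (?t ?D) (m' 0)"
      unfolding halts_with_def using t'(1) by (intro exI[of _ t']) (simp add: halted_def)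
    then show ?thesis unfolding rel by (rule exI[of _ rel])
  qed
  show ?thesis
    by (rule exI[of _ "?c 0"], rule exI[of _ ?t], intro conjI allI impI, rule poly, rule run[OF _ refl])
qed

section \<open>The main theorem\<close>

lemma bound_encoded:
  assumes wf: "wf_nfa k M1" "wf_nfa k M2" and I: "I = input_of (enc_input k M1 M2)"
  shows "at I (pos1 I) (enc_nfa M1)" "at I (pos2 I) (enc_nfa M2)"
    "bound I = k + nstates M1 + nstates M2 + length (initial M1) + length (initial M2) +
      length (final M1) + length (final M2) + length (trans M1) + length (trans M2) + 1"
proof -
  have "at I 0 (enc_input k M1 M2)" by (simp add: at_def I input_of_def)
  then have a: "I 0 = k" "at I 1 (enc_nfa M1)" "at I (1 + length (enc_nfa M1)) (enc_nfa M2)"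
    by (simp_all add: enc_input_def)
  show 1: "at I (pos1 I) (enc_nfa M1)" using a(2) by (simp add: pos1_def)
  have "pos2 I = 1 + length (enc_nfa M1)" using encoded(5)[of I pos1, OF 1] by (simp add: pos2_def pos1_def)
  then show 2: "at I (pos2 I) (enc_nfa M2)" using a(3) by simp
  show "bound I = k + nstates M1 + nstates M2 + length (initial M1) + length (initial M2) +
      length (final M1) + length (final M2) + length (trans M1) + length (trans M2) + 1"
    unfolding bound_def a(1) encoded(1-4)[of I pos1, OF 1] encoded(1-4)[of I pos2, OF 2] by simp
qed

lemma answer_correct:
  assumes wf: "wf_nfa k M1" "wf_nfa k M2" and I: "I = input_of (enc_input k M1 M2)" and D: "D = bound I"
  shows "(\<exists>x < D. \<exists>y < D. (x, y) \<in> main D (tr1 D I) (tr2 D I)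
      (is_initial pos1 D I) (is_initial pos2 D I) rel 4 \<and> is_final pos1 D I x \<and> is_final pos2 D I y) \<longleftrightarrow>
    \<not> PT_separable {..<k} (nfa_lang k M1) (nfa_lang k M2)"
proof -
  note b = bound_encoded[OF wf I]
  have le: "length (initial M1) \<le> D" "length (final M1) \<le> D" "length (trans M1) \<le> D"
    "length (initial M2) \<le> D" "length (final M2) \<le> D" "length (trans M2) \<le> D"
    "k \<le> D" "nstates M1 \<le> D" "nstates M2 \<le> D" unfolding D b(3) by simp_all
  note e1 = encoded(6-8)[of I pos1, OF b(1)] and e2 = encoded(6-8)[of I pos2, OF b(2)]
  note e = e1(1)[OF le(1)] e1(2)[OF le(2)] e1(3)[OF le(3)] e2(1)[OF le(4)] e2(2)[OF le(5)] e2(3)[OF le(6)]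
  have lt: "(x, a, y) \<in> set (trans M1) \<Longrightarrow> x < D \<and> a < D \<and> y < D"
    "(x, a, y) \<in> set (trans M2) \<Longrightarrow> x < D \<and> a < D \<and> y < D"
    "x \<in> set (initial M1) \<Longrightarrow> x < D" "x \<in> set (initial M2) \<Longrightarrow> x < D"
    "x \<in> set (final M1) \<Longrightarrow> x < D" "x \<in> set (final M2) \<Longrightarrow> x < D" for x a y
    using wf le(7-9) unfolding wf_nfa_def by force+
  interpret automata_pair D "tr1 D I" "tr2 D I" "trans M1" "trans M2"
    by (rule automata_pair.intro[OF e(3) e(6) lt(1) lt(2)])
  let ?S = "{(x, y). x < D \<and> y < D \<and> (x \<in> set (initial M1) \<and> y \<in> set (initial M2))}"
  show ?thesis
    unfolding main_closure PT_separable_iff_no_pattern[OF wf] e not_not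
  proof
    assume "\<exists>x < D. \<exists>y < D. (x, y) \<in> E\<^sup>* `` ?S \<and> x \<in> set (final M1) \<and> y \<in> set (final M2)"
    then obtain x y p1 p2 where "((p1, p2), (x, y)) \<in> E\<^sup>*" "p1 \<in> set (initial M1)" "p2 \<in> set (initial M2)"
      "x \<in> set (final M1)" "y \<in> set (final M2)" by auto
    then show "\<exists>p1 \<in> set (initial M1). \<exists>p2 \<in> set (initial M2). \<exists>q1 \<in> set (final M1). \<exists>q2 \<in> set (final M2).
      ((p1, p2), (q1, q2)) \<in> E\<^sup>*" by (intro bexI)
  next
    assume "\<exists>p1 \<in> set (initial M1). \<exists>p2 \<in> set (initial M2). \<exists>q1 \<in> set (final M1). \<exists>q2 \<in> set (final M2).
      ((p1, p2), (q1, q2)) \<in> E\<^sup>*"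
    then obtain x y p1 p2 where p: "((p1, p2), (x, y)) \<in> E\<^sup>*" "p1 \<in> set (initial M1)" "p2 \<in> set (initial M2)"
      "x \<in> set (final M1)" "y \<in> set (final M2)" by (elim bexE) (rule that)
    have "(p1, p2) \<in> ?S" using lt(3,4) p(2,3) by simp
    then have "(x, y) \<in> E\<^sup>* `` ?S" using p(1) by (rule ImageI[rotated])
    then show "\<exists>x < D. \<exists>y < D. (x, y) \<in> E\<^sup>* `` ?S \<and> x \<in> set (final M1) \<and> y \<in> set (final M2)"
      using lt(5,6) p(4,5) by (intro exI conjI) simp_all
  qed
qed

text \<open>The lists are distinct, so initial and final states contribute at most N each and the
  transitions at most N ^ 3 per automaton. Altogether 8 * N ^ 3 would do.\<close>

lemma bound_le:
  assumes wf: "wf_nfa k M1" "wf_nfa k M2" and I: "I = input_of (enc_input k M1 M2)"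
  shows "bound I + 1 \<le> 10 * (nstates M1 + nstates M2 + k + 1) ^ 3"
proof -
  define N where "N = nstates M1 + nstates M2 + k + 1"
  have len: "length (initial M) \<le> N" "length (final M) \<le> N" "length (trans M) \<le> N ^ 3"
    if "wf_nfa k M" "nstates M \<le> N" for M
  proof -
    have n: "nstates M \<le> N" "k \<le> N" using that(2) by (simp_all add: N_def)
    have d: "distinct (initial M)" "distinct (final M)" "distinct (trans M)"
      "set (initial M) \<subseteq> {..<nstates M}" "set (final M) \<subseteq> {..<nstates M}"
      "set (trans M) \<subseteq> {..<nstates M} \<times> {..<k} \<times> {..<nstates M}"
      using that(1) unfolding wf_nfa_def by force+
    show "length (initial M) \<le> N" "length (final M) \<le> N"
      using card_mono[OF _ d(4)] card_mono[OF _ d(5)] distinct_card[OF d(1)] distinct_card[OF d(2)] n by simp_all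
    have "length (trans M) \<le> nstates M * (k * nstates M)"
      using card_mono[OF _ d(6)] distinct_card[OF d(3)] by (simp add: card_cartesian_product)
    also have "\<dots> \<le> N * (N * N)" using n by (intro mult_mono) auto
    finally show "length (trans M) \<le> N ^ 3" by (simp add: power3_eq_cube mult.assoc)
  qed
  have "N \<le> N ^ 3" by (simp add: self_le_power N_def)
  moreover have "1 \<le> N ^ 3" by (simp add: N_def)
  moreover have "nstates M1 \<le> N" "nstates M2 \<le> N" by (simp_all add: N_def)
  moreover have "k + nstates M1 + nstates M2 + 1 = N" by (simp add: N_def)
  ultimately show ?thesis
    unfolding bound_encoded(3)[OF wf I] N_def[symmetric] using len[OF wf(1)] len[OF wf(2)] by linarith
qed

text \<open>The running time is a polynomial of degree q in the bound, and the bound is cubic in the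
  size; this gives the exponent 3 * q and the factor 10 ^ q.\<close>

theorem theorem1:
  "\<exists>(P :: instr list) (c :: nat) (d :: nat).
     \<forall>k M1 M2. wf_nfa k M1 \<longrightarrow> wf_nfa k M2 \<longrightarrow>
       halts_with P (enc_input k M1 M2)
         (c * (nstates M1 + nstates M2 + k + 1) ^ d)
         (if PT_separable {..<k} (nfa_lang k M1) (nfa_lang k M2) then 1 else 0)"
proof -
  let ?F = "\<lambda>D I. main D (tr1 D I) (tr2 D I) (is_initial pos1 D I) (is_initial pos2 D I)"
  let ?\<phi> = "\<lambda>D I (rel :: rels). \<not> (\<exists>x < D. \<exists>y < D. (x, y) \<in> rel 4 \<and> is_final pos1 D I x \<and> is_final pos2 D I y)"
  from program_exists[OF computes_bound updates_main decides_answer]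
  obtain P t where t: "poly t" and P: "\<And>xs. xs \<noteq> [] \<Longrightarrow> \<exists>rel. halts_with P xs (t (bound (input_of xs)))
    (if ?\<phi> (bound (input_of xs)) (input_of xs) (?F (bound (input_of xs)) (input_of xs) rel) then 1 else 0)"
    by (elim exE conjE) blast
  obtain c q where c: "\<And>D. t D \<le> c * (D + 1) ^ q" using t unfolding poly_def by blast
  have "halts_with P (enc_input k M1 M2) ((c * 10 ^ q) * (nstates M1 + nstates M2 + k + 1) ^ (3 * q))
      (if PT_separable {..<k} (nfa_lang k M1) (nfa_lang k M2) then 1 else 0)"
    if wf: "wf_nfa k M1" "wf_nfa k M2" for k M1 M2
  proof -
    let ?I = "input_of (enc_input k M1 M2)" and ?N = "nstates M1 + nstates M2 + k + 1"
    have "enc_input k M1 M2 \<noteq> []" by (simp add: enc_input_def)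
    from P[OF this] have h: "halts_with P (enc_input k M1 M2) (t (bound ?I))
        (if PT_separable {..<k} (nfa_lang k M1) (nfa_lang k M2) then 1 else 0)"
      unfolding answer_correct[OF wf refl refl] by simp
    have "t (bound ?I) \<le> c * (bound ?I + 1) ^ q" by (rule c)
    also have "\<dots> \<le> c * (10 * ?N ^ 3) ^ q"
      using bound_le[OF wf refl] by (intro mult_left_mono power_mono) simp_all
    also have "\<dots> = (c * 10 ^ q) * ?N ^ (3 * q)" by (simp add: power_mult_distrib power_mult)
    finally show ?thesis using h unfolding halts_with_def by (meson le_trans)
  qed
  then show ?thesis by blast
qed

end
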